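(* Assume GRH. For any pair $a,b$ of distinct reduced residues modulo $q$, let $r_1$ and $r_2$ denote the least positive residues of $ab^{-1}$ and $ba^{-1}$ modulo $q$. Then \[ M^*(q;a,b) = \phi(q) \bigg( \frac{\Lambda(r_1)}{r_1} +\frac{\Lambda(r_2)}{r_2} + H(q;a,b) + O \bigg( \frac{\log^2 q}{q} \bigg) \bigg), \] where the implied constant is absolute.
   Context: GRH: every nontrivial zero of every Dirichlet $L$-function has real part $\frac12$. $\Lambda$ is the von Mangoldt function. For a character $\chi\bmod q$, $\chi^*$ is the primitive character inducing it, and $M^*(q;a,b)=\sum_{\chi\bmod q,\ \chi\ne\chi_0}|\chi(a)-\chi(b)|^2\frac{L'(1,\chi^* )}{L(1,\chi^* )}$. For a prime $p$ let $\nu\ge0$ be such that $p^\nu\parallel q$; for a reduced residue $r\bmod q$, $e(q;p,r)=\min\{e\ge1: p^e\equiv r^{-1}\pmod{q/p^\nu}\}$ (with $e(q;p,r)=\infty$ if no such $e$ exists), and $h(q;p,r)=\frac{1}{\phi(p^\nu)}\frac{\log p}{p^{e(q;p,r)}}$ (with $h=0$ when $e=\infty$). Finally $H(q;a,b)=\sum_{p\mid q}\big(h(q;p,ab^{-1})+h(q;p,ba^{-1})\big)$. *)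

theory Defs
  imports
    "HOL-Complex_Analysis.Complex_Analysis"
    "HOL-Number_Theory.Number_Theory"
    "HOL-Number_Theory.Prime_Powers"
    "HOL-Number_Theory.Modular_Inverse"
    "HOL-Library.Extended_Nat"
begin

section \<open>Dirichlet characters\<close>

definition dirichlet_character :: "nat \<Rightarrow> (int \<Rightarrow> complex) \<Rightarrow> bool" where
  "dirichlet_character q chi \<longleftrightarrow>
     q > 0 \<and>
     (\<forall>m n. chi (m * n) = chi m * chi n) \<and>
     (\<forall>n. chi (n + int q) = chi n) \<and>
     (\<forall>n. chi n \<noteq> 0 \<longleftrightarrow> coprime n (int q))"

definition principal_character :: "nat \<Rightarrow> int \<Rightarrow> complex" where
  "principal_character q = (\<lambda>n. if coprime n (int q) then 1 else 0)"

definition induces :: "nat \<Rightarrow> (int \<Rightarrow> complex) \<Rightarrow> nat \<Rightarrow> (int \<Rightarrow> complex) \<Rightarrow> bool" where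
  "induces d psi q chi \<longleftrightarrow>
     dirichlet_character d psi \<and> dirichlet_character q chi \<and> d dvd q \<and>
     (\<forall>n. coprime n (int q) \<longrightarrow> chi n = psi n)"

definition primitive_character :: "nat \<Rightarrow> (int \<Rightarrow> complex) \<Rightarrow> bool" where
  "primitive_character q chi \<longleftrightarrow>
     dirichlet_character q chi \<and> \<not> (\<exists>d psi. d < q \<and> induces d psi q chi)"

definition inducing_primitive :: "nat \<Rightarrow> (int \<Rightarrow> complex) \<Rightarrow> int \<Rightarrow> complex" where
  "inducing_primitive q chi = (THE psi. \<exists>d. primitive_character d psi \<and> induces d psi q chi)"


section \<open>Dirichlet L-functions\<close>

definition has_dirichlet_series :: "(int \<Rightarrow> complex) \<Rightarrow> complex \<Rightarrow> complex \<Rightarrow> bool" where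
  "has_dirichlet_series chi s l \<longleftrightarrow>
     (\<lambda>n. chi (int (Suc n)) / of_nat (Suc n) powr s) sums l"

text \<open>
  The continuation is taken over half planes, punctured at the possible pole \<open>1\<close> unless the
  value at \<open>1\<close> itself is asked for. Thus for nonprincipal characters the value at \<open>1\<close> is
  that of the holomorphic continuation across \<open>1\<close>, whereas for principal characters
  it is unspecified. The lemma \<open>Dirichlet_L_eqI\<close> below shows that the value does not depend
  on the half plane or on the continuation.
\<close>
definition continuation_domain :: "real \<Rightarrow> complex \<Rightarrow> complex set" where
  "continuation_domain c s = (if s = 1 then {w. Re w > c} else {w. Re w > c} - {1})"

definition dirichlet_continuation ::
    "(int \<Rightarrow> complex) \<Rightarrow> complex set \<Rightarrow> (complex \<Rightarrow> complex) \<Rightarrow> bool" where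
  "dirichlet_continuation chi D f \<longleftrightarrow>
     f holomorphic_on D \<and> (\<forall>w\<in>D. Re w > 1 \<longrightarrow> has_dirichlet_series chi w (f w))"

definition Dirichlet_L :: "(int \<Rightarrow> complex) \<Rightarrow> complex \<Rightarrow> complex" where
  "Dirichlet_L chi s =
     (THE z. \<exists>c f. Re s > c \<and> dirichlet_continuation chi (continuation_domain c s) f \<and> f s = z)"

lemma Dirichlet_L_eqI:
  assumes c: "Re s > c"
    and f: "dirichlet_continuation chi (continuation_domain c s) f"
  shows "Dirichlet_L chi s = f s"
  unfolding Dirichlet_L_def
proof (rule the_equality)
  show "\<exists>c f'. Re s > c \<and> dirichlet_continuation chi (continuation_domain c s) f' \<and> f' s = f s"
    using assms by blast
next
  fix z assume "\<exists>c f. Re s > c \<and> dirichlet_continuation chi (continuation_domain c s) f \<and> f s = z"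
  then obtain c' g where c': "Re s > c'"
    and g: "dirichlet_continuation chi (continuation_domain c' s) g" and z: "z = g s" by blast
  define D where "D = continuation_domain (max c c') s"
  have sub: "D \<subseteq> continuation_domain c s" "D \<subseteq> continuation_domain c' s"
    by (auto simp: D_def continuation_domain_def)
  have op: "open {w. Re w > r}" for r by (rule open_halfspace_Re_gt)
  have D_open: "open D"
    unfolding D_def continuation_domain_def using op[of "max c c'"] by (simp del: max_less_iff_conj add: open_Diff)
  have D_conn: "connected D"
    unfolding D_def continuation_domain_def
    using connected_open_delete[OF op[of "max c c'"]]
      convex_connected[OF convex_halfspace_Re_gt[of "max c c'"]]
    by (simp del: max_less_iff_conj)
  define E where "E = D \<inter> {w. Re w > 1}"
  have "open E" using D_open op by (auto simp: E_def)
  moreover have "of_real (max (max c c') 1 + 1) \<in> E"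
    by (auto simp: E_def D_def continuation_domain_def complex_eq_iff)
  then have "E \<noteq> {}" by blast
  moreover have "f w = g w" if "w \<in> E" for w
    using f g sub that unfolding dirichlet_continuation_def has_dirichlet_series_def E_def
    by (blast intro: sums_unique2)
  moreover have "f holomorphic_on D" "g holomorphic_on D"
    using f g sub unfolding dirichlet_continuation_def by (blast intro: holomorphic_on_subset)+
  moreover have "s \<in> D" using c c' by (auto simp: D_def continuation_domain_def)
  ultimately have "f s = g s"
    by (intro analytic_continuation_open[of E D f g s]) (auto simp: E_def D_open D_conn)
  then show "z = f s" using z by simp
qed

text \<open>
  The nontrivial zeros are those in the open critical strip. In particular the zeros on the
  imaginary axis that come from the Euler factors of imprimitive characters count as trivial.
\<close>
definition GRH :: bool where
  "GRH \<longleftrightarrow>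
     (\<forall>q chi s. dirichlet_character q chi \<and> 0 < Re s \<and> Re s < 1 \<and> Dirichlet_L chi s = 0
        \<longrightarrow> Re s = 1 / 2)"


section \<open>The quantities in the asymptotic formula\<close>

definition Mstar :: "nat \<Rightarrow> int \<Rightarrow> int \<Rightarrow> complex" where
  "Mstar q a b =
     (\<Sum>chi | dirichlet_character q chi \<and> chi \<noteq> principal_character q.
        complex_of_real ((cmod (chi a - chi b))\<^sup>2) *
        (deriv (Dirichlet_L (inducing_primitive q chi)) 1 / Dirichlet_L (inducing_primitive q chi) 1))"

text \<open>A representative of the residue class of \<open>a b\<^sup>-\<^sup>1\<close> modulo \<open>q\<close>, for \<open>b\<close> coprime to \<open>q\<close>.\<close>
definition residue_quotient :: "nat \<Rightarrow> int \<Rightarrow> int \<Rightarrow> int" where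
  "residue_quotient q a b = a * modular_inverse (int q) b"

definition least_positive_residue :: "nat \<Rightarrow> int \<Rightarrow> nat" where
  "least_positive_residue q x = (LEAST r. r \<ge> 1 \<and> [int r = x] (mod int q))"

text \<open>In \<open>e_index\<close>, the infimum of the empty set is \<open>\<infinity>\<close>.\<close>
definition e_index :: "nat \<Rightarrow> nat \<Rightarrow> int \<Rightarrow> enat" where
  "e_index q p r =
     Inf (enat ` {e. e \<ge> 1 \<and>
       [int p ^ e = modular_inverse (int q) r] (mod int (q div p ^ multiplicity p q))})"

definition h_term :: "nat \<Rightarrow> nat \<Rightarrow> int \<Rightarrow> real" where
  "h_term q p r =
     (case e_index q p r of
        enat e \<Rightarrow> 1 / real (totient (p ^ multiplicity p q)) * (ln (real p) / real p ^ e)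
      | \<infinity> \<Rightarrow> 0)"

definition H_sum :: "nat \<Rightarrow> int \<Rightarrow> int \<Rightarrow> real" where
  "H_sum q a b =
     (\<Sum>p | prime p \<and> p dvd q.
        h_term q p (residue_quotient q a b) + h_term q p (residue_quotient q b a))"

end

theory Submission
  imports Defs
begin

text \<open>
  Expanding \<open>F = - L'/L\<close> in its Taylor series around \<open>2\<close> and evaluating the \<open>J\<close>-th Taylor
  polynomial at \<open>1\<close> turns the Dirichlet series of \<open>F\<close> into the sum of \<open>\<chi>(n) \<Lambda>(n) w(n) / n\<close>,
  where \<open>w(n)\<close> is the probability that a Poisson variable of mean \<open>ln n\<close> is at most \<open>J\<close>. Under
  GRH, \<open>F\<close> is holomorphic on a disk around \<open>2\<close> of radius greater than \<open>1\<close> and is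
  \<open>O(ln q)\<close> there by Borel-Caratheodory, so the remainder decays exponentially in \<open>J\<close>, and
  \<open>J\<close> of size \<open>9 ln q\<close> makes it \<open>O(ln q / q)\<close>; no contour integral is needed. GRH says
  nothing about the line \<open>Re s = 1\<close>, where the absence of zeros is classical.

  Orthogonality of characters then leaves the \<open>n\<close> congruent to \<open>1\<close>, \<open>ab\<^sup>-\<^sup>1\<close> or \<open>ba\<^sup>-\<^sup>1\<close>
  modulo \<open>q\<close> and, for each prime \<open>p\<close> dividing \<open>q\<close>, the powers of \<open>p\<close> in these classes modulo
  \<open>q / p\<^sup>\<nu>\<close>. The least element of each class gives the main terms; since
  \<open>w(n)\<close> is at most \<open>3 n\<^bsup>-1/(J+1)\<^esup>\<close>, the other elements contribute \<open>O(J\<^sup>2 / q)\<close>.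
\<close>

section \<open>Dirichlet characters and orthogonality\<close>

text \<open>GRH helps only to the right of 1/2, so the disk around 2 has radius between 1 and 3/2.
  The chain 11/8 > 5/4 > 9/8 > 1 leaves room for Borel-Caratheodory, for passing from the logarithm
  to its derivative, and for Cauchy's bound on Taylor coefficients. The last radius gives the ratio
  8/9, and \<open>8/9 \<le> exp (-1/9)\<close> explains the 9 in \<open>J\<close>. The squared
  difference of character values expands as 2 minus the values at both quotients. The 2 selects n
  congruent to 1, where the least element is n = 1 with vanishing von Mangoldt function, so this
  class is pure error. The terms h arise because the primitive character need not vanish at primes
  dividing q. A prime p is seen only by the characters of conductor prime to p; they number phi(q /
  p^nu), which is phi(q) / phi(p^nu), whence the factor 1 / phi(p^nu). The log^2 q comes from the
  tails of the residue classes: with weights decaying like n^(-1/(J+1)), the logarithm in the von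
  Mangoldt function and the sum over quotients by q cost one factor J each.\<close>

lemma dirichlet_character_mult: "dirichlet_character q chi \<Longrightarrow> chi (m * n) = chi m * chi n"
  by (simp add: dirichlet_character_def)

lemma dirichlet_character_nonzero_iff:
  "dirichlet_character q chi \<Longrightarrow> chi n \<noteq> 0 \<longleftrightarrow> coprime n (int q)"
  by (simp add: dirichlet_character_def)

lemma dirichlet_character_pos: "dirichlet_character q chi \<Longrightarrow> q > 0"
  by (simp add: dirichlet_character_def)

lemma periodic_int_cong:
  fixes f :: "int \<Rightarrow> 'a"
  assumes per: "\<And>n. f (n + c) = f n" and "[m = n] (mod c)"
  shows "f m = f n"
proof -
  have nat_shift: "f (n + int k * c) = f n" for n k
  proof (induction k)
    case (Suc k)
    have "n + int (Suc k) * c = (n + int k * c) + c" by (simp add: algebra_simps)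
    then show ?case using per Suc by metis
  qed simp
  have shift: "f (n + k * c) = f n" for n k
  proof (cases "k \<ge> 0")
    case True
    then show ?thesis using nat_shift[of n "nat k"] by simp
  next
    case False
    then show ?thesis using nat_shift[of "n + k * c" "nat (-k)"] by (simp add: algebra_simps)
  qed
  from assms(2) obtain k where "m = n + c * k" by (metis cong_iff_lin cong_sym)
  then show ?thesis using shift[of n k] by (simp add: mult.commute)
qed

lemma dirichlet_character_cong:
  assumes "dirichlet_character q chi" "[m = n] (mod int q)"
  shows "chi m = chi n"
  using assms(1) by (intro periodic_int_cong[OF _ assms(2)]) (simp add: dirichlet_character_def)

lemma dirichlet_character_one: "dirichlet_character q chi \<Longrightarrow> chi 1 = 1"
  using dirichlet_character_mult[of q chi 1 1] dirichlet_character_nonzero_iff[of q chi 1] by simp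

lemma dirichlet_character_power: "dirichlet_character q chi \<Longrightarrow> chi (m ^ k) = chi m ^ k"
  by (induction k) (simp_all add: dirichlet_character_one dirichlet_character_mult)

lemma euler_theorem_int:
  assumes "coprime (a::int) (int q)" "q > 0"
  shows "[a ^ totient q = 1] (mod int q)"
proof -
  define b where "b = nat (a mod int q)"
  have b: "int b = a mod int q" using assms by (simp add: b_def)
  have "coprime b q"
    using assms b by (metis coprime_int_iff coprime_mod_left_iff of_nat_0_less_iff less_irrefl)
  then have "[b ^ totient q = 1] (mod q)" by (rule euler_theorem)
  then have "[int b ^ totient q = 1] (mod int q)"
    by (metis cong_int_iff of_nat_1 of_nat_power)
  then show ?thesis by (simp add: b cong_def power_mod)
qed

lemma dirichlet_character_power_totient:
  assumes "dirichlet_character q chi" "coprime n (int q)"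
  shows "chi n ^ totient q = 1"
  using dirichlet_character_cong[OF assms(1) euler_theorem_int[OF assms(2)]] assms(1)
  by (simp add: dirichlet_character_power dirichlet_character_one dirichlet_character_pos)

lemma norm_dirichlet_character:
  assumes "dirichlet_character q chi"
  shows "norm (chi n) = (if coprime n (int q) then 1 else 0)"
proof (cases "coprime n (int q)")
  case True
  have pow: "norm (chi n) ^ totient q = 1 ^ totient q"
    by (metis dirichlet_character_power_totient[OF assms True] norm_one norm_power power_one)
  have "totient q > 0" using dirichlet_character_pos[OF assms] by simp
  then have "norm (chi n) = 1" by (intro power_eq_imp_eq_base[OF pow]) simp_all
  then show ?thesis using True by simp
qed (use dirichlet_character_nonzero_iff[OF assms, of n] in simp)

lemma norm_dirichlet_character_le: "dirichlet_character q chi \<Longrightarrow> norm (chi n) \<le> 1"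
  by (simp add: norm_dirichlet_character)

lemma cnj_dirichlet_character:
  assumes "dirichlet_character q chi" "coprime n (int q)"
  shows "chi n * cnj (chi n) = 1"
  using norm_dirichlet_character[OF assms(1), of n] assms(2)
  by (simp flip: complex_norm_square)

lemma coprime_add_modulus: "coprime (n + q) q \<longleftrightarrow> coprime n (q::int)"
  by (metis coprime_iff_gcd_eq_1 gcd_add1)

lemma dirichlet_character_principal: "q > 0 \<Longrightarrow> dirichlet_character q (principal_character q)"
  by (auto simp: dirichlet_character_def principal_character_def coprime_add_modulus)

lemma dirichlet_character_times:
  "dirichlet_character q chi \<Longrightarrow> dirichlet_character q psi \<Longrightarrow>
     dirichlet_character q (\<lambda>n. chi n * psi n)"
  by (auto simp: dirichlet_character_def)

lemma dirichlet_character_cnj: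
  "dirichlet_character q chi \<Longrightarrow> dirichlet_character q (\<lambda>n. cnj (chi n))"
  by (auto simp: dirichlet_character_def)

text \<open>A character is determined by its values on one period, and each value is 0 or a
  \<open>totient q\<close>-th root of unity, so restriction embeds the characters into a finite
  function space.\<close>

lemma finite_dirichlet_characters: "finite {chi. dirichlet_character q chi}"
proof (cases "q > 0")
  case True
  define R where "R = insert 0 {z::complex. z ^ totient q = 1}"
  have "finite R" using True finite_roots_unity[of "totient q"] by (simp add: R_def Suc_le_eq)
  then have fin: "finite ({0..<int q} \<rightarrow>\<^sub>E R)" by (intro finite_PiE) auto
  show ?thesis
  proof (rule inj_on_finite[OF _ _ fin])
    have "chi n \<in> R" if "dirichlet_character q chi" for chi n
      using dirichlet_character_power_totient[OF that, of n] dirichlet_character_nonzero_iff[OF that, of n]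
      unfolding R_def by blast
    then show "(\<lambda>chi. restrict chi {0..<int q}) ` {chi. dirichlet_character q chi} \<subseteq> {0..<int q} \<rightarrow>\<^sub>E R"
      by (intro image_subsetI) (simp only: restrict_PiE_iff mem_Collect_eq, blast)
    show "inj_on (\<lambda>chi. restrict chi {0..<int q}) {chi. dirichlet_character q chi}"
    proof (rule inj_onI, clarify)
      fix chi psi assume chi: "dirichlet_character q chi" and psi: "dirichlet_character q psi"
        and eq: "restrict chi {0..<int q} = restrict psi {0..<int q}"
      show "chi = psi"
      proof
        fix n
        have "n mod int q \<in> {0..<int q}" using True by simp
        then have "chi (n mod int q) = psi (n mod int q)" using fun_cong[OF eq] by (metis restrict_apply')
        then show "chi n = psi n"
          using dirichlet_character_cong[OF chi, of n "n mod int q"]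
            dirichlet_character_cong[OF psi, of n "n mod int q"] by (simp add: cong_def)
      qed
    qed
  qed
qed (simp add: dirichlet_character_def)

section \<open>Sums of one character over all residues\<close>

lemma bij_betw_mult_mod:
  assumes "coprime g (int q)" "q > 0"
  shows "bij_betw (\<lambda>m. g * m mod int q) {0..<int q} {0..<int q}"
proof -
  have "inj_on (\<lambda>m. g * m mod int q) {0..<int q}"
  proof (rule inj_onI)
    fix x y assume xy: "x \<in> {0..<int q}" "y \<in> {0..<int q}" and "g * x mod int q = g * y mod int q"
    then have "[g * x = g * y] (mod int q)" by (simp add: cong_def)
    then have "[x = y] (mod int q)" using assms(1) by (simp add: cong_mult_lcancel coprime_commute)
    then show "x = y" using xy by (simp add: cong_def)
  qed
  moreover have "(\<lambda>m. g * m mod int q) ` {0..<int q} \<subseteq> {0..<int q}" using assms(2) by auto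
  ultimately show ?thesis by (simp add: bij_betw_def endo_inj_surj)
qed

lemma card_coprime_residues:
  assumes "q > 0"
  shows "card {m \<in> {0..<int q}. coprime m (int q)} = totient q"
proof -
  \<comment> \<open>\<open>totatives q\<close> lies in 1 to \<open>q\<close>, the residues in 0 to
    \<open>q - 1\<close>. Both maps are the identity except that they exchange \<open>q\<close> with
    0, which happens only for \<open>q = 1\<close>.\<close>
  have "bij_betw (\<lambda>k. int k mod int q) (totatives q) {m \<in> {0..<int q}. coprime m (int q)}"
  proof (rule bij_betwI[where g = "\<lambda>m. if m = 0 then q else nat m"])
    show "(\<lambda>k. int k mod int q) \<in> totatives q \<rightarrow> {m \<in> {0..<int q}. coprime m (int q)}"
      using assms by (auto simp: totatives_def coprime_mod_left_iff)
    show "(\<lambda>m. if m = 0 then q else nat m) \<in> {m \<in> {0..<int q}. coprime m (int q)} \<rightarrow> totatives q"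
    proof
      fix m assume m: "m \<in> {m \<in> {0..<int q}. coprime m (int q)}"
      show "(if m = 0 then q else nat m) \<in> totatives q"
      proof (cases "m = 0")
        case True
        then have "q = 1" using m by simp
        then show ?thesis using True by simp
      next
        case False
        have "coprime (nat m) q" using m coprime_int_iff[of "nat m" q] by simp
        then show ?thesis using False m by (simp add: totatives_def nat_le_iff)
      qed
    qed
    fix k assume "k \<in> totatives q"
    then show "(if int k mod int q = 0 then q else nat (int k mod int q)) = k"
      by (cases "k = q") (auto simp: totatives_def simp flip: zmod_int)
  next
    fix m assume "m \<in> {m \<in> {0..<int q}. coprime m (int q)}"
    then show "int (if m = 0 then q else nat m) mod int q = m" by auto
  qed
  then show ?thesis by (simp add: totient_def bij_betw_same_card)
qed

lemma sum_dirichlet_character: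
  assumes chi: "dirichlet_character q chi"
  shows "(\<Sum>m\<in>{0..<int q}. chi m) = (if chi = principal_character q then of_nat (totient q) else 0)"
proof (cases "chi = principal_character q")
  case True
  then show ?thesis using card_coprime_residues[OF dirichlet_character_pos[OF chi]]
    by (simp add: principal_character_def flip: sum.inter_filter)
next
  case False
  then obtain g where g: "chi g \<noteq> principal_character q g" by auto
  then have cop: "coprime g (int q)"
    using dirichlet_character_nonzero_iff[OF chi, of g] by (auto simp: principal_character_def)
  \<comment> \<open>Multiplication by \<open>g\<close> permutes the residues and multiplies the sum
    by \<open>chi g\<close>, which is not 1.\<close>
  have "(\<Sum>m\<in>{0..<int q}. chi m) = (\<Sum>m\<in>{0..<int q}. chi (g * m mod int q))"
    by (rule sum.reindex_bij_betw[OF bij_betw_mult_mod[OF cop dirichlet_character_pos[OF chi]], symmetric])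
  also have "\<dots> = (\<Sum>m\<in>{0..<int q}. chi g * chi m)"
    using dirichlet_character_cong[OF chi] dirichlet_character_mult[OF chi]
    by (intro sum.cong refl) (metis cong_mod_left cong_refl)
  also have "\<dots> = chi g * (\<Sum>m\<in>{0..<int q}. chi m)" by (simp add: sum_distrib_left)
  finally have "(1 - chi g) * (\<Sum>m\<in>{0..<int q}. chi m) = 0" by (simp add: algebra_simps)
  moreover have "chi g \<noteq> 1" using g cop by (simp add: principal_character_def)
  ultimately show ?thesis using False by simp
qed

section \<open>Enough characters to separate residues\<close>

text \<open>
  The isotypic components of \<open>f\<close> under \<open>f \<mapsto> f (h * _)\<close>, an operator whose \<open>m\<close>-th power
  fixes \<open>f\<close>; being combinations of translates of \<open>f\<close>, they keep all other symmetries of \<open>f\<close>.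
\<close>
lemma eigen_decomposition:
  fixes f :: "int \<Rightarrow> complex"
  assumes m: "m > 0" and fix_pow: "\<And>x. f (h ^ m * x) = f x"
  shows "\<exists>c z. (\<forall>x. f x = (\<Sum>k<m. c k x)) \<and> (\<forall>k x. c k (h * x) = z k * c k x) \<and>
    (\<forall>k g l. (\<forall>x. f (g * x) = l * f x) \<longrightarrow> (\<forall>x. c k (g * x) = l * c k x)) \<and>
    (\<forall>k d. (\<forall>x. f (x + d) = f x) \<longrightarrow> (\<forall>x. c k (x + d) = c k x))"
proof -
  define w where "w = cis (2 * pi / real m)"
  \<comment> \<open>A discrete Fourier transform along the orbit under \<open>h\<close>;
    \<open>c k\<close> projects onto the eigenvalue \<open>inverse (w ^ k)\<close>.\<close>
  define c where "c = (\<lambda>k x. (\<Sum>i<m. w ^ (k * i) * f (h ^ i * x)) / of_nat m)"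
  have w_pow: "w ^ m = 1" unfolding w_def Complex.DeMoivre using m by simp
  have w_nz: "w \<noteq> 0" by (simp add: w_def)
  have w_ne: "w ^ i \<noteq> 1" if "0 < i" "i < m" for i
  proof
    assume "w ^ i = 1"
    then have eq: "cis (2 * pi * real i / real m) = cis (2 * pi * real 0 / real m)" by (simp add: w_def Complex.DeMoivre field_simps)
    have inj: "inj_on (\<lambda>k. cis (2 * pi * real k / real m)) {..<m}"
      using Complex.bij_betw_roots_unity[OF m] by (simp add: bij_betw_def)
    have "i = 0" by (rule inj_onD[OF inj eq]) (use that in auto)
    then show False using that by simp
  qed
  have ortho: "(\<Sum>k<m. w ^ (k * i)) = (if i = 0 then of_nat m else 0)" if "i < m" for i
  proof (cases "i = 0")
    case False
    have "(\<Sum>k<m. (w ^ i) ^ k) = ((w ^ i) ^ m - 1) / (w ^ i - 1)"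
      using w_ne[of i] False that by (intro geometric_sum) auto
    also have "(w ^ i) ^ m = 1" by (metis w_pow power_commutes power_mult power_one mult.commute)
    finally show ?thesis using False by (simp add: mult.commute flip: power_mult)
  qed simp
  show ?thesis
  proof (rule exI[of _ c], rule exI[of _ "\<lambda>k. inverse (w ^ k)"], intro conjI allI impI)
    fix x
    have "(\<Sum>k<m. c k x) = (\<Sum>k<m. \<Sum>i<m. w ^ (k * i) * f (h ^ i * x)) / of_nat m"
      by (simp add: c_def sum_divide_distrib)
    also have "(\<Sum>k<m. \<Sum>i<m. w ^ (k * i) * f (h ^ i * x)) = (\<Sum>i<m. (\<Sum>k<m. w ^ (k * i)) * f (h ^ i * x))"
      by (subst sum.swap) (simp add: sum_distrib_right)
    also have "\<dots> = (\<Sum>i<m. if i = 0 then of_nat m * f x else 0)"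
      by (intro sum.cong) (auto simp: ortho)
    also have "\<dots> = of_nat m * f x" using m by simp
    finally show "f x = (\<Sum>k<m. c k x)" using m by simp
  next
    fix k x
    define u where "u = (\<lambda>i. w ^ (k * i) * f (h ^ i * x))"
    have "w ^ k * (\<Sum>i<m. w ^ (k * i) * f (h ^ i * (h * x))) = (\<Sum>i<m. u (Suc i))"
      by (simp add: u_def sum_distrib_left power_add algebra_simps)
    also have "\<dots> = (\<Sum>i<m. u i) + u m - u 0"
      using sum.lessThan_Suc_shift[of u m] by (simp add: algebra_simps)
    also have "u m = u 0"
      using fix_pow w_pow by (simp add: u_def) (metis power_mult power_one mult.commute)
    finally have shift: "w ^ k * (\<Sum>i<m. w ^ (k * i) * f (h ^ i * (h * x))) = (\<Sum>i<m. u i)" by simp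
    have "(\<Sum>i<m. w ^ (k * i) * f (h ^ i * (h * x))) = inverse (w ^ k) * (\<Sum>i<m. u i)"
      unfolding shift[symmetric] using w_nz by simp
    then show "c k (h * x) = inverse (w ^ k) * c k x" by (simp add: c_def u_def)
  next
    fix k g l x assume "\<forall>x. f (g * x) = l * f x"
    then have "f (h ^ i * (g * x)) = l * f (h ^ i * x)" for i by (metis mult.left_commute)
    then show "c k (g * x) = l * c k x"
      by (simp add: c_def sum_distrib_left mult.left_commute)
  next
    fix k d x assume per: "\<forall>x. f (x + d) = f x"
    have "f (h ^ i * (x + d)) = f (h ^ i * x)" for i
      by (rule periodic_int_cong[of f d]) (use per in \<open>auto simp: cong_iff_dvd_diff algebra_simps\<close>)
    then show "c k (x + d) = c k x" by (simp add: c_def)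
  qed
qed

text \<open>The character is built as a system of joint eigenvalues. The indicator function of the
  class of 1 is split under multiplication by \<open>n\<close>, where some component has an
  eigenvalue other than 1. Splitting further under every reduced residue keeps this eigenvalue, and
  the eigenvalues of a joint eigenfunction are multiplicative in the residue.\<close>

lemma dirichlet_character_separates:
  assumes q: "q > 0" and n: "coprime n (int q)" "\<not> [n = 1] (mod int q)"
  obtains chi where "dirichlet_character q chi" "chi n \<noteq> 1"
proof -
  define per where "per = (\<lambda>f::int \<Rightarrow> complex. \<forall>x. f (x + int q) = f x)"
  have tot: "totient q > 0" using q by simp
  have per_cong: "f x = f y" if "per f" "[x = y] (mod int q)" for f x y
    using that periodic_int_cong[of f "int q" x y] unfolding per_def by blast
  have fixp: "f (h ^ totient q * x) = f x" if "per f" "coprime h (int q)" for f h x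
    using per_cong[OF that(1) cong_mult[OF euler_theorem_int[OF that(2) q] cong_refl, of x]] by simp
  have base: "\<exists>f x0 l. per f \<and> f x0 \<noteq> 0 \<and> (\<forall>x. f (n * x) = l * f x) \<and> l \<noteq> 1"
  proof -
    define f where "f = (\<lambda>x. if [x = 1] (mod int q) then 1 else 0 :: complex)"
    have "per f" by (auto simp: per_def f_def cong_def)
    obtain c z where c: "\<forall>x. f x = (\<Sum>k<totient q. c k x)" "\<forall>k x. c k (n * x) = z k * c k x"
      "\<forall>k d. (\<forall>x. f (x + d) = f x) \<longrightarrow> (\<forall>x. c k (x + d) = c k x)"
      using eigen_decomposition[OF tot, of f n, OF fixp[OF \<open>per f\<close> n(1)]] by blast
    \<comment> \<open>If all nonzero components had eigenvalue 1, \<open>f\<close> would take the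
      same value at \<open>n\<close> and at 1, but these values are 0 and 1.\<close>
    have "\<exists>k<totient q. \<exists>x. c k x \<noteq> 0 \<and> z k \<noteq> 1"
    proof (rule ccontr)
      assume "\<not> ?thesis"
      then have "c k (n * 1) = c k 1" if "k < totient q" for k using c(2) that by (metis mult_1_left)
      then have "f (n * 1) = f 1" using c(1) by (metis (no_types, lifting) sum.cong lessThan_iff)
      then show False using n(2) by (simp add: f_def)
    qed
    then show ?thesis using c \<open>per f\<close> unfolding per_def by blast
  qed
  define S where "S = {m \<in> {0..<int q}. coprime m (int q)}"
  have "finite S" unfolding S_def by (rule finite_subset[of _ "{0..<int q}"]) auto
  \<comment> \<open>The induction carries no fixed function: each step replaces it by one of its
    components, keeping periodicity, a nonzero value and an eigenvalue at \<open>n\<close> other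
    than 1.\<close>
  define P where "P = (\<lambda>A. \<exists>f x0. per f \<and> f x0 \<noteq> 0 \<and> (\<exists>l. l \<noteq> 1 \<and> (\<forall>x. f (n * x) = l * f x)) \<and>
      (\<forall>g\<in>A. \<exists>l. \<forall>x. f (g * x) = l * f x))"
  have "P A" if "finite A" "A \<subseteq> S" for A
    using that
  proof (induction A rule: finite_induct)
    case empty
    show ?case unfolding P_def using base by blast
  next
    case (insert h A)
    then have "P A" by simp
    then obtain f x0 where f: "per f" "f x0 \<noteq> 0" "\<exists>l. l \<noteq> 1 \<and> (\<forall>x. f (n * x) = l * f x)"
      "\<forall>g\<in>A. \<exists>l. \<forall>x. f (g * x) = l * f x" unfolding P_def by blast
    have "coprime h (int q)" using insert.prems by (auto simp: S_def)
    then obtain c z where c: "\<forall>x. f x = (\<Sum>k<totient q. c k x)" "\<forall>k x. c k (h * x) = z k * c k x"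
      "\<forall>k g l. (\<forall>x. f (g * x) = l * f x) \<longrightarrow> (\<forall>x. c k (g * x) = l * c k x)"
      "\<forall>k d. (\<forall>x. f (x + d) = f x) \<longrightarrow> (\<forall>x. c k (x + d) = c k x)"
      using eigen_decomposition[OF tot, of f h, OF fixp[OF f(1)]] by blast
    have "(\<Sum>k<totient q. c k x0) \<noteq> 0" using f(2) c(1) by metis
    then obtain k where k: "c k x0 \<noteq> 0" by (meson sum.neutral)
    have "per (c k)" using c(4) f(1) unfolding per_def by blast
    moreover have "\<exists>l. l \<noteq> 1 \<and> (\<forall>x. c k (n * x) = l * c k x)" using f(3) c(3) by blast
    moreover have "\<forall>g\<in>insert h A. \<exists>l. \<forall>x. c k (g * x) = l * c k x" using f(4) c(2,3) by blast
    ultimately show ?case unfolding P_def using k by blast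
  qed
  from this[OF \<open>finite S\<close> subset_refl] obtain f x0 l where f: "per f" "f x0 \<noteq> 0" "l \<noteq> 1" "\<forall>x. f (n * x) = l * f x"
    "\<forall>g\<in>S. \<exists>l. \<forall>x. f (g * x) = l * f x" unfolding P_def by blast
  \<comment> \<open>The eigenvalue at \<open>m\<close>, read off at a point where \<open>f\<close>
    does not vanish.\<close>
  define chi where "chi = (\<lambda>m. if coprime m (int q) then f (m * x0) / f x0 else 0)"
  have eig: "f (g * x) = chi g * f x" if "coprime g (int q)" for g x
  proof -
    have "g mod int q \<in> S" using that q by (auto simp: S_def coprime_mod_left_iff)
    then obtain mu where mu: "\<And>x. f (g mod int q * x) = mu * f x" using f(5) by blast
    have mod_eq: "f (g * x) = f (g mod int q * x)" for x
      by (rule per_cong[OF f(1)]) (simp add: cong_def mod_mult_left_eq)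
    then show ?thesis using f(2) that mu by (simp add: chi_def)
  qed
  have nz: "chi g \<noteq> 0" if "coprime g (int q)" for g
  proof
    assume z: "chi g = 0"
    have "f (g ^ totient q * x0) = f (g * (g ^ (totient q - 1) * x0))"
      using tot by (cases "totient q") (auto simp: mult.assoc)
    also have "\<dots> = 0" using eig[OF that] z by simp
    finally show False using fixp[OF f(1) that] f(2) by simp
  qed
  have "dirichlet_character q chi"
    unfolding dirichlet_character_def
  proof (intro conjI allI)
    fix m k
    show "chi (m * k) = chi m * chi k"
    proof (cases "coprime m (int q) \<and> coprime k (int q)")
      case True
      then have "chi (m * k) = f (m * (k * x0)) / f x0" by (simp add: chi_def mult.assoc)
      also have "\<dots> = chi m * chi k" using eig[of m "k * x0"] eig[of k x0] True f(2) by simp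
      finally show ?thesis .
    qed (auto simp: chi_def)
    have "f ((m + int q) * x0) = f (m * x0)"
      by (rule per_cong[OF f(1)]) (simp add: cong_def algebra_simps)
    then show "chi (m + int q) = chi m" by (simp add: chi_def coprime_add_modulus)
    show "chi m \<noteq> 0 \<longleftrightarrow> coprime m (int q)" using nz[of m] by (auto simp: chi_def)
  qed (use q in simp)
  moreover have "chi n \<noteq> 1" using f(2-4) n(1) by (simp add: chi_def)
  ultimately show thesis using that by blast
qed

text \<open>Shifting the sum by a character \<open>psi\<close> with \<open>psi n\<close> different
  from 1 shows that it vanishes. For \<open>n\<close> congruent to 1 the number of characters is
  left unevaluated, because its value is deduced from this lemma.\<close>

lemma sum_over_dirichlet_characters:
  assumes q: "q > 0" and n: "coprime n (int q)"
  shows "(\<Sum>chi | dirichlet_character q chi. chi n) =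
    (if [n = 1] (mod int q) then of_nat (card {chi. dirichlet_character q chi}) else 0)"
proof (cases "[n = 1] (mod int q)")
  case True
  have "(\<Sum>chi | dirichlet_character q chi. chi n) = (\<Sum>chi | dirichlet_character q chi. 1)"
    by (intro sum.cong refl) (metis mem_Collect_eq dirichlet_character_cong[OF _ True] dirichlet_character_one)
  then show ?thesis using True by simp
next
  case False
  obtain psi where psi: "dirichlet_character q psi" "psi n \<noteq> 1"
    using dirichlet_character_separates[OF q n False] by blast
  define C where "C = {chi. dirichlet_character q chi}"
  have "bij_betw (\<lambda>chi m. psi m * chi m) C C"
  proof (rule bij_betwI[where g = "\<lambda>chi m. cnj (psi m) * chi m"])
    show "(\<lambda>chi m. psi m * chi m) \<in> C \<rightarrow> C" "(\<lambda>chi m. cnj (psi m) * chi m) \<in> C \<rightarrow> C"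
      using psi by (auto simp: C_def intro: dirichlet_character_times dirichlet_character_cnj)
    fix chi assume chi: "chi \<in> C"
    have *: "psi m * cnj (psi m) * chi m = chi m" for m
      using cnj_dirichlet_character[OF psi(1), of m] dirichlet_character_nonzero_iff[of q chi m] chi
      by (cases "coprime m (int q)") (auto simp: C_def)
    show "(\<lambda>m. cnj (psi m) * (psi m * chi m)) = chi" using * by (simp add: fun_eq_iff algebra_simps)
    show "(\<lambda>m. psi m * (cnj (psi m) * chi m)) = chi" using * by (simp add: fun_eq_iff algebra_simps)
  qed
  then have "(\<Sum>chi\<in>C. chi n) = (\<Sum>chi\<in>C. psi n * chi n)"
    by (rule sum.reindex_bij_betw[symmetric, of _ C C "\<lambda>chi. chi n"])
  then have "(\<Sum>chi\<in>C. chi n) = psi n * (\<Sum>chi\<in>C. chi n)" unfolding sum_distrib_left .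
  then have "(\<Sum>chi\<in>C. chi n) = 0" using psi(2) by (metis mult_cancel_right1)
  then show ?thesis using False by (simp add: C_def)
qed

text \<open>Double counting of all values of all characters: summed over residues first, only the
  principal character survives and gives \<open>totient q\<close>; summed over characters first,
  only the residue 1 survives.\<close>

lemma card_dirichlet_characters:
  assumes q: "q > 0"
  shows "card {chi. dirichlet_character q chi} = totient q"
proof -
  define C where "C = {chi. dirichlet_character q chi}"
  have "(\<Sum>m\<in>{0..<int q}. \<Sum>chi\<in>C. chi m) = (\<Sum>chi\<in>C. \<Sum>m\<in>{0..<int q}. chi m)"
    by (rule sum.swap)
  also have "\<dots> = (\<Sum>chi\<in>C. if chi = principal_character q then of_nat (totient q) else 0)"
    by (intro sum.cong refl sum_dirichlet_character) (simp add: C_def)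
  also have "\<dots> = of_nat (totient q)"
    using dirichlet_character_principal[OF q] finite_dirichlet_characters[of q] by (simp add: C_def)
  finally have 1: "(\<Sum>m\<in>{0..<int q}. \<Sum>chi\<in>C. chi m) = of_nat (totient q)" .
  \<comment> \<open>\<open>1 mod int q\<close> instead of 1 covers \<open>q = 1\<close>, where the
    only residue is 0.\<close>
  have "(\<Sum>chi\<in>C. chi m) = (if m = 1 mod int q then of_nat (card C) else 0)" if "m \<in> {0..<int q}" for m
  proof (cases "coprime m (int q)")
    case True
    have "[m = 1] (mod int q) \<longleftrightarrow> m = 1 mod int q" using that by (auto simp: cong_def)
    then show ?thesis using sum_over_dirichlet_characters[OF q True] by (simp add: C_def)
  next
    case False
    then have "m \<noteq> 1 mod int q" using q by (metis coprime_1_left coprime_mod_left_iff of_nat_0_less_iff less_irrefl)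
    moreover have "(\<Sum>chi\<in>C. chi m) = 0"
      using False dirichlet_character_nonzero_iff by (intro sum.neutral) (auto simp: C_def)
    ultimately show ?thesis by simp
  qed
  then have "(\<Sum>m\<in>{0..<int q}. \<Sum>chi\<in>C. chi m) = of_nat (card C)"
    using q by (simp add: sum.delta)
  with 1 show ?thesis unfolding C_def by (metis of_nat_eq_iff)
qed

lemma dirichlet_character_orthogonality:
  assumes "q > 0" "coprime n (int q)"
  shows "(\<Sum>chi | dirichlet_character q chi. chi n) =
    (if [n = 1] (mod int q) then of_nat (totient q) else 0)"
  using sum_over_dirichlet_characters[OF assms] card_dirichlet_characters[OF assms(1)] by simp

section \<open>The inducing primitive character\<close>

text \<open>With \<open>k\<close> the product of the primes of \<open>q\<close> that do not divide
  \<open>n\<close>, each prime of \<open>q\<close> divides exactly one summand of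
  \<open>n + k * int d\<close>: it divides \<open>k\<close> if it does not divide \<open>n\<close>,
  and otherwise it divides neither \<open>k\<close> nor \<open>d\<close>.\<close>

lemma exists_coprime_lift:
  fixes n :: int
  assumes n: "coprime n (int d)" and dq: "d dvd q" and q: "q > 0"
  obtains m where "[m = n] (mod int d)" "coprime m (int q)"
proof -
  define P where "P = {p \<in> prime_factors (int q). \<not> p dvd n}"
  define k where "k = \<Prod>P"
  have fin: "finite P" by (simp add: P_def)
  have "coprime (n + k * int d) (int q)"
  proof (rule ccontr)
    assume "\<not> coprime (n + k * int d) (int q)"
    then obtain c where c: "c dvd n + k * int d" "c dvd int q" "\<not> is_unit c" by (rule not_coprimeE)
    from c(2) q have "c \<noteq> 0" by auto
    with c(3) obtain p where p: "prime p" "p dvd c" by (auto elim: prime_divisorE)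
    have pd: "p dvd n + k * int d" "p dvd int q" using p c by (auto intro: dvd_trans)
    have pf: "p \<in> prime_factors (int q)" using p(1) pd(2) q by (simp add: in_prime_factors_iff)
    show False
    proof (cases "p dvd n")
      case True
      then have "p dvd k * int d" using pd(1) by (simp add: dvd_add_right_iff)
      moreover have "\<not> p dvd int d"
        using True n p(1) by (meson coprime_common_divisor not_prime_unit)
      ultimately have "p dvd k" using p(1) by (simp add: prime_dvd_mult_iff)
      then obtain r where r: "r \<in> P" "p dvd r"
        using p(1) fin unfolding k_def by (auto simp: prime_dvd_prod_iff)
      then have "r = p" using p(1) by (intro primes_dvd_imp_eq[symmetric]) (auto simp: P_def in_prime_factors_iff)
      then show False using r(1) True by (simp add: P_def)
    next
      case False
      then have "p \<in> P" using pf by (simp add: P_def)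
      then have "p dvd k" unfolding k_def using fin by (rule dvd_prodI[rotated])
      then show False using pd(1) False by (simp add: dvd_add_left_iff)
    qed
  qed
  moreover have "[n + k * int d = n] (mod int d)" by (simp add: cong_def)
  ultimately show thesis using that by blast
qed

section \<open>Moduli through which a character factors, and the conductor\<close>

lemma coprime_int_dvd: "coprime n (int q) \<Longrightarrow> d dvd q \<Longrightarrow> coprime n (int d)"
  by (meson coprime_divisors dvd_refl int_dvd_int_iff)

text \<open>For divisors \<open>d\<close> of \<open>q\<close> this is equivalent to being induced
  from modulus \<open>d\<close>, but it mentions no second character, so that different moduli can
  be compared directly.\<close>

definition trivial_mod :: "nat \<Rightarrow> (int \<Rightarrow> complex) \<Rightarrow> nat \<Rightarrow> bool" where
  "trivial_mod q chi d \<longleftrightarrow> (\<forall>n. coprime n (int q) \<longrightarrow> [n = 1] (mod int d) \<longrightarrow> chi n = 1)"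

lemma trivial_mod_cong:
  assumes chi: "dirichlet_character q chi" and dq: "d dvd q" and triv: "trivial_mod q chi d"
    and m: "coprime m (int q)" "coprime m' (int q)" "[m = m'] (mod int d)"
  shows "chi m = chi m'"
proof -
  obtain u where u: "[m' * u = 1] (mod int q)" using m(2) by (rule cong_solve_coprime_int[THEN exE])
  have cu: "coprime u (int q)"
    using u by (metis coprime_mult_left_iff coprime_1_left cong_imp_coprime cong_sym)
  have "[m * u = m' * u] (mod int d)" using m(3) by (intro cong_mult) auto
  moreover have "[m' * u = 1] (mod int d)"
    using u dq by (meson cong_dvd_modulus int_dvd_int_iff)
  ultimately have "[m * u = 1] (mod int d)" by (rule cong_trans)
  then have "chi (m * u) = 1" using triv m(1) cu by (simp add: trivial_mod_def)
  moreover have "chi (m' * u) = 1"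
    using dirichlet_character_cong[OF chi u] dirichlet_character_one[OF chi] by simp
  ultimately have "chi m * chi u = chi m' * chi u" by (simp add: dirichlet_character_mult[OF chi])
  moreover have "chi u \<noteq> 0" using cu dirichlet_character_nonzero_iff[OF chi] by blast
  ultimately show ?thesis by simp
qed

text \<open>The inducing character evaluates \<open>chi\<close> at a lift that is prime to
  \<open>q\<close>; by \<open>trivial_mod_cong\<close> the value is the same for every lift.\<close>

lemma trivial_mod_induces:
  assumes chi: "dirichlet_character q chi" and dq: "d dvd q" and triv: "trivial_mod q chi d"
  obtains psi where "induces d psi q chi"
proof -
  have q: "q > 0" by (rule dirichlet_character_pos[OF chi])
  have d: "d > 0" using dq q by (simp add: dvd_pos_nat)
  define lift where "lift = (\<lambda>n. SOME m. [m = n] (mod int d) \<and> coprime m (int q))"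
  have lift: "[lift n = n] (mod int d)" "coprime (lift n) (int q)" if cop: "coprime n (int d)" for n
  proof -
    obtain m where "[m = n] (mod int d) \<and> coprime m (int q)"
      using exists_coprime_lift[OF cop dq q] by blast
    then have "[lift n = n] (mod int d) \<and> coprime (lift n) (int q)"
      unfolding lift_def by (rule someI)
    then show "[lift n = n] (mod int d)" "coprime (lift n) (int q)" by auto
  qed
  define psi where "psi = (\<lambda>n. if coprime n (int d) then chi (lift n) else 0)"
  have psi_eq: "psi n = chi m" if "coprime n (int d)" "coprime m (int q)" "[m = n] (mod int d)" for n m
    using trivial_mod_cong[OF chi dq triv lift(2)[OF that(1)] that(2)] lift(1)[OF that(1)] that
    by (simp add: psi_def) (meson cong_sym cong_trans)
  have "dirichlet_character d psi"
    unfolding dirichlet_character_def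
  proof (intro conjI allI)
    fix m n
    show "psi (m * n) = psi m * psi n"
    proof (cases "coprime m (int d) \<and> coprime n (int d)")
      case True
      then have "psi (m * n) = chi (lift m * lift n)"
        using lift by (intro psi_eq) (auto intro: cong_mult)
      then show ?thesis using True by (simp add: psi_def dirichlet_character_mult[OF chi])
    qed (auto simp: psi_def)
    show "psi (m + int d) = psi m"
    proof (cases "coprime m (int d)")
      case True
      then have "psi (m + int d) = chi (lift m)"
        using lift[OF True] by (intro psi_eq) (auto simp: coprime_add_modulus cong_def)
      then show ?thesis using True by (simp add: psi_def)
    qed (simp add: psi_def coprime_add_modulus)
    show "psi m \<noteq> 0 \<longleftrightarrow> coprime m (int d)"
      using lift(2)[of m] dirichlet_character_nonzero_iff[OF chi] by (auto simp: psi_def)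
  qed (use d in simp)
  moreover have "chi n = psi n" if "coprime n (int q)" for n
  proof -
    show ?thesis using psi_eq[OF coprime_int_dvd[OF that dq] that] by simp
  qed
  ultimately show thesis using that[of psi] chi dq by (simp add: induces_def)
qed

lemma induces_trivial_mod:
  assumes "induces d psi q chi"
  shows "trivial_mod q chi d"
  using assms dirichlet_character_cong[of d psi _ 1] dirichlet_character_one[of d psi]
  unfolding induces_def trivial_mod_def by metis

text \<open>Bezout splits the step from 1 to \<open>n\<close> into a multiple of \<open>d1\<close>
  and a multiple of \<open>d2\<close>, so some \<open>m\<close> is congruent to 1 modulo
  \<open>d1\<close> and to \<open>n\<close> modulo \<open>d2\<close>. It may be taken prime to
  \<open>q\<close>, and then \<open>chi m\<close> equals both 1 and \<open>chi n\<close>.\<close>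

lemma trivial_mod_gcd:
  assumes chi: "dirichlet_character q chi"
    and d: "d1 dvd q" "trivial_mod q chi d1" "d2 dvd q" "trivial_mod q chi d2"
  shows "trivial_mod q chi (gcd d1 d2)"
  unfolding trivial_mod_def
proof (intro allI impI)
  fix n assume n: "coprime n (int q)" "[n = 1] (mod int (gcd d1 d2))"
  have q: "q > 0" by (rule dirichlet_character_pos[OF chi])
  obtain t where t: "n - 1 = gcd (int d1) (int d2) * t"
    using n(2) unfolding cong_iff_dvd_diff by (auto simp: gcd_int_int_eq)
  obtain u v where uv: "u * int d1 + v * int d2 = gcd (int d1) (int d2)"
    using bezout_int by blast
  define m0 where "m0 = 1 + u * int d1 * t"
  have m0: "m0 = n - v * int d2 * t" using arg_cong[OF uv, of "\<lambda>x. x * t"] t by (simp add: m0_def algebra_simps)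
  have c1: "[m0 = 1] (mod int d1)" by (simp add: m0_def cong_iff_dvd_diff)
  have c2: "[m0 = n] (mod int d2)" by (simp add: m0 cong_iff_dvd_diff)
  have "coprime m0 (int d1)" using c1 by (metis coprime_1_left cong_imp_coprime cong_sym)
  moreover have "coprime m0 (int d2)"
    using c2 coprime_int_dvd[OF n(1) d(3)] by (metis cong_imp_coprime cong_sym)
  ultimately have "coprime m0 (int d1 * int d2)" by simp
  then have "coprime m0 (int (lcm d1 d2))"
    by (rule coprime_divisors[OF dvd_refl, rotated]) (simp flip: of_nat_mult add: lcm_least)
  then obtain m where m: "[m = m0] (mod int (lcm d1 d2))" "coprime m (int q)"
    using exists_coprime_lift[of m0 "lcm d1 d2" q] d q by (metis lcm_least)
  have "[m = 1] (mod int d1)"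
    using m(1) c1 by (meson cong_dvd_modulus cong_trans dvd_lcm1 int_dvd_int_iff)
  then have "chi m = 1" using d(2) m(2) by (simp add: trivial_mod_def)
  moreover have "[m = n] (mod int d2)"
    using m(1) c2 by (meson cong_dvd_modulus cong_trans dvd_lcm2 int_dvd_int_iff)
  then have "chi m = chi n" by (rule trivial_mod_cong[OF chi d(3,4) m(2) n(1)])
  ultimately show "chi n = 1" by simp
qed

text \<open>If \<open>d\<close> did not divide \<open>e\<close>, their gcd would be a proper divisor
  of \<open>d\<close> from which \<open>psi\<close> is still induced. Thus primitivity, defined by
  the size of the modulus, implies minimality for divisibility.\<close>

lemma primitive_modulus_dvd:
  assumes prim: "primitive_character d psi" and ind: "induces d psi q chi"
    and e: "e dvd q" "trivial_mod q chi e"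
  shows "d dvd e"
proof -
  have psi: "dirichlet_character d psi" and chi: "dirichlet_character q chi" and dq: "d dvd q"
    and agree: "\<And>n. coprime n (int q) \<Longrightarrow> chi n = psi n"
    using ind by (auto simp: induces_def)
  have q: "q > 0" by (rule dirichlet_character_pos[OF chi])
  define g where "g = gcd d e"
  have triv: "trivial_mod q chi g"
    unfolding g_def by (rule trivial_mod_gcd[OF chi dq induces_trivial_mod[OF ind] e])
  have "trivial_mod d psi g"
    unfolding trivial_mod_def
  proof (intro allI impI)
    fix n assume n: "coprime n (int d)" "[n = 1] (mod int g)"
    obtain m where m: "[m = n] (mod int d)" "coprime m (int q)"
      using exists_coprime_lift[OF n(1) dq q] by blast
    have "[m = 1] (mod int g)"
      using m(1) n(2) unfolding g_def by (meson cong_dvd_modulus cong_trans gcd_dvd1 int_dvd_int_iff)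
    then have "chi m = 1" using triv m(2) by (simp add: trivial_mod_def)
    then show "psi n = 1" using agree[OF m(2)] dirichlet_character_cong[OF psi m(1)] by simp
  qed
  then obtain psi' where "induces g psi' d psi"
    using trivial_mod_induces[OF psi, of g] by (auto simp: g_def)
  then have "\<not> g < d" using prim by (auto simp: primitive_character_def)
  moreover have "g \<le> d" using dirichlet_character_pos[OF psi] by (simp add: g_def gcd_le1_nat)
  ultimately have "g = d" by simp
  then show ?thesis unfolding g_def by (metis gcd_dvd2)
qed

text \<open>The two moduli divide each other, and the characters agree on lifts prime to
  \<open>q\<close>. This is what makes the definite description in \<open>inducing_primitive\<close>
  denote.\<close>

lemma primitive_inducing_unique:
  assumes "primitive_character d psi" "induces d psi q chi"
    "primitive_character d' psi'" "induces d' psi' q chi"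
  shows "d = d' \<and> psi = psi'"
proof -
  have "d dvd q" "d' dvd q" using assms by (auto simp: induces_def)
  then have dd: "d = d'"
    using primitive_modulus_dvd[OF assms(1,2), of d'] primitive_modulus_dvd[OF assms(3,4), of d]
      induces_trivial_mod[OF assms(2)] induces_trivial_mod[OF assms(4)] by (simp add: dvd_antisym)
  have ch: "dirichlet_character d psi" "dirichlet_character d psi'" "q > 0"
    and agree: "\<And>n. coprime n (int q) \<Longrightarrow> psi n = psi' n"
    using assms dd dirichlet_character_pos[of q chi] by (auto simp: induces_def)
  have "psi n = psi' n" for n
  proof (cases "coprime n (int d)")
    case True
    obtain m where m: "[m = n] (mod int d)" "coprime m (int q)"
      using exists_coprime_lift[OF True \<open>d dvd q\<close> ch(3)] by blast
    show ?thesis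
      using dirichlet_character_cong[OF ch(1) m(1)] dirichlet_character_cong[OF ch(2) m(1)] agree[OF m(2)]
      by simp
  next
    case False
    then show ?thesis using ch(1,2) dirichlet_character_nonzero_iff by metis
  qed
  then show ?thesis using dd by auto
qed

lemma exists_primitive_inducing:
  assumes chi: "dirichlet_character q chi"
  obtains d psi where "primitive_character d psi" "induces d psi q chi"
proof -
  define Q where "Q = (\<lambda>d. d dvd q \<and> trivial_mod q chi d)"
  define d where "d = (LEAST d. Q d)"
  have "chi n = 1" if "[n = 1] (mod int q)" for n
    using dirichlet_character_cong[OF chi that] dirichlet_character_one[OF chi] by simp
  then have "Q q" by (simp add: Q_def trivial_mod_def)
  then have "Q d" unfolding d_def by (rule LeastI)
  then obtain psi where psi: "induces d psi q chi"
    using trivial_mod_induces[OF chi] unfolding Q_def by metis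
  have "\<not> (\<exists>e phi. e < d \<and> induces e phi d psi)"
  proof
    assume "\<exists>e phi. e < d \<and> induces e phi d psi"
    then obtain e phi where e: "e < d" "induces e phi d psi" by blast
    have "trivial_mod q chi e"
      using induces_trivial_mod[OF e(2)] psi coprime_int_dvd
      unfolding trivial_mod_def induces_def by metis
    moreover have "e dvd q" using e(2) psi unfolding induces_def by (meson dvd_trans)
    ultimately have "Q e" by (simp add: Q_def)
    then show False using e(1) not_less_Least unfolding d_def by blast
  qed
  then have "primitive_character d psi" using psi by (simp add: primitive_character_def induces_def)
  then show thesis using psi that by blast
qed

lemma inducing_primitive_eqI:
  assumes "primitive_character d psi" "induces d psi q chi"
  shows "inducing_primitive q chi = psi"
  unfolding inducing_primitive_def using primitive_inducing_unique assms by blast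

lemma inducing_primitive:
  assumes "dirichlet_character q chi"
  obtains d where "primitive_character d (inducing_primitive q chi)"
    "induces d (inducing_primitive q chi) q chi"
  using exists_primitive_inducing[OF assms] inducing_primitive_eqI by metis

lemma inducing_primitive_eq:
  assumes "dirichlet_character q chi" "coprime n (int q)"
  shows "inducing_primitive q chi n = chi n"
  using inducing_primitive[OF assms(1)] assms(2) unfolding induces_def by metis

lemma norm_inducing_primitive_le:
  assumes "dirichlet_character q chi"
  shows "norm (inducing_primitive q chi n) \<le> 1"
  using inducing_primitive[OF assms] norm_dirichlet_character_le unfolding induces_def by metis

lemma inducing_primitive_nonprincipal:
  assumes chi: "dirichlet_character q chi" "chi \<noteq> principal_character q"
  obtains d where "dirichlet_character d (inducing_primitive q chi)" "d dvd q"
    "inducing_primitive q chi \<noteq> principal_character d"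
proof -
  obtain d where d: "induces d (inducing_primitive q chi) q chi"
    using inducing_primitive[OF chi(1)] by blast
  have "inducing_primitive q chi \<noteq> principal_character d"
  proof
    assume eq: "inducing_primitive q chi = principal_character d"
    have "chi n = principal_character q n" for n
    proof (cases "coprime n (int q)")
      case True
      then show ?thesis
        using d eq coprime_int_dvd[OF True] by (simp add: induces_def principal_character_def)
    next
      case False
      then show ?thesis
        using dirichlet_character_nonzero_iff[OF chi(1), of n] by (simp add: principal_character_def)
    qed
    then show False using chi(2) by auto
  qed
  then show thesis using that d by (auto simp: induces_def)
qed

section \<open>Characters inflated from a divisor of the modulus\<close>

definition extend_character :: "nat \<Rightarrow> (int \<Rightarrow> complex) \<Rightarrow> int \<Rightarrow> complex" where
  "extend_character q psi = (\<lambda>n. if coprime n (int q) then psi n else 0)"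

lemma induces_extend_character:
  assumes "dirichlet_character d psi" "d dvd q" "q > 0"
  shows "induces d psi q (extend_character q psi)"
proof -
  have per: "psi (n + int q) = psi n" for n
    using assms(2) by (intro dirichlet_character_cong[OF assms(1)]) (auto simp: cong_iff_dvd_diff)
  have "psi n \<noteq> 0" if "coprime n (int q)" for n
    using coprime_int_dvd[OF that assms(2)] dirichlet_character_nonzero_iff[OF assms(1)] by blast
  then have "dirichlet_character q (extend_character q psi)"
    using assms(3) per dirichlet_character_mult[OF assms(1)]
    by (auto simp: dirichlet_character_def extend_character_def coprime_add_modulus)
  then show ?thesis using assms by (simp add: induces_def extend_character_def)
qed

text \<open>The value of \<open>psi\<close> reappears even where
  \<open>extend_character q psi\<close> is 0, as at powers of a prime that divides \<open>q\<close>
  but not \<open>d\<close>.\<close>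

lemma inducing_primitive_extend:
  assumes psi: "dirichlet_character d psi" "d dvd q" "q > 0" and n: "coprime n (int d)"
  shows "inducing_primitive q (extend_character q psi) n = psi n"
proof -
  define chi where "chi = extend_character q psi"
  have ind: "induces d psi q chi" unfolding chi_def by (rule induces_extend_character[OF psi])
  obtain e where e: "primitive_character e (inducing_primitive d psi)"
    "induces e (inducing_primitive d psi) d psi"
    using inducing_primitive[OF psi(1)] by blast
  have "induces e (inducing_primitive d psi) q chi"
    using e(2) ind coprime_int_dvd[of _ q d] unfolding induces_def by (metis dvd_trans)
  then have "inducing_primitive q chi = inducing_primitive d psi"
    by (rule inducing_primitive_eqI[OF e(1)])
  then show ?thesis using inducing_primitive_eq[OF psi(1) n] by (simp add: chi_def)
qed

lemma inj_on_extend_character: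
  assumes "d dvd q" "q > 0"
  shows "inj_on (extend_character q) {psi. dirichlet_character d psi}"
proof (rule inj_onI, clarify)
  fix psi phi assume psi: "dirichlet_character d psi" and phi: "dirichlet_character d phi"
    and eq: "extend_character q psi = extend_character q phi"
  have "psi n = phi n" for n
  proof (cases "coprime n (int d)")
    case True
    then show ?thesis
      using inducing_primitive_extend[OF psi assms True] inducing_primitive_extend[OF phi assms True] eq
      by simp
  next
    case False
    then show ?thesis using psi phi dirichlet_character_nonzero_iff by metis
  qed
  then show "psi = phi" by auto
qed

text \<open>
  Only the characters whose conductor is prime to \<open>p\<close> contribute at powers of \<open>p\<close>,
  and these are the ones that come from the modulus \<open>q'\<close>.
\<close>
lemma sum_inducing_primitive_prime_power:
  assumes q: "q = p ^ nu * q'" "q > 0" and p: "prime p" "\<not> p dvd q'" and k: "k \<ge> 1"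
  shows "(\<Sum>chi | dirichlet_character q chi. f chi * inducing_primitive q chi (int p ^ k)) =
    (\<Sum>psi | dirichlet_character q' psi. f (extend_character q psi) * psi (int p ^ k))"
proof -
  define E where "E = extend_character q ` {psi. dirichlet_character q' psi}"
  have dq: "q' dvd q" using q(1) by simp
  have cop: "coprime (int p ^ k) (int q')"
    using p by (metis coprime_int_iff coprime_power_left_iff of_nat_power prime_imp_coprime)
  have sub: "E \<subseteq> {chi. dirichlet_character q chi}"
    using induces_extend_character[OF _ dq q(2)] by (auto simp: E_def induces_def)
  \<comment> \<open>A nonzero value at a power of \<open>p\<close> makes the modulus of the
    primitive character prime to \<open>p\<close>, hence a divisor of \<open>q'\<close>, so that
    \<open>chi\<close> comes from \<open>q'\<close>.\<close>
  have zero: "inducing_primitive q chi (int p ^ k) = 0" if chi: "dirichlet_character q chi" "chi \<notin> E" for chi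
  proof (rule ccontr)
    assume nz: "inducing_primitive q chi (int p ^ k) \<noteq> 0"
    define psi where "psi = inducing_primitive q chi"
    obtain d where d: "induces d psi q chi"
      using inducing_primitive[OF chi(1)] unfolding psi_def by blast
    then have psi: "dirichlet_character d psi" "d dvd q" by (auto simp: induces_def)
    have "coprime (int p ^ k) (int d)"
      using nz dirichlet_character_nonzero_iff[OF psi(1)] by (simp add: psi_def)
    then have "coprime d (p ^ nu)" using k
      by (metis coprime_commute coprime_int_iff coprime_power_left_iff coprime_power_right_iff
          less_one linorder_not_less of_nat_power)
    then have dq': "d dvd q'" using psi(2) q(1) by (simp add: coprime_dvd_mult_right_iff)
    have q': "q' > 0" using q by (cases q') auto
    define phi where "phi = extend_character q' psi"
    have "dirichlet_character q' phi"
      using induces_extend_character[OF psi(1) dq' q'] by (simp add: phi_def induces_def)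
    moreover have "chi n = extend_character q phi n" for n
    proof (cases "coprime n (int q)")
      case True
      then show ?thesis
        using d coprime_int_dvd[OF True dq] by (simp add: induces_def phi_def extend_character_def)
    next
      case False
      then show ?thesis
        using dirichlet_character_nonzero_iff[OF that(1), of n] by (simp add: extend_character_def)
    qed
    then have "chi = extend_character q phi" by auto
    ultimately show False using that(2) by (auto simp: E_def)
  qed
  have "(\<Sum>chi | dirichlet_character q chi. f chi * inducing_primitive q chi (int p ^ k)) =
      (\<Sum>chi\<in>E. f chi * inducing_primitive q chi (int p ^ k))"
    using zero sub by (intro sum.mono_neutral_right finite_dirichlet_characters) auto
  also have "\<dots> = (\<Sum>psi | dirichlet_character q' psi.
      f (extend_character q psi) * inducing_primitive q (extend_character q psi) (int p ^ k))"
    unfolding E_def by (subst sum.reindex[OF inj_on_extend_character[OF dq q(2)]]) simp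
  also have "\<dots> = (\<Sum>psi | dirichlet_character q' psi. f (extend_character q psi) * psi (int p ^ k))"
    using inducing_primitive_extend[OF _ dq q(2) cop] by (intro sum.cong) auto
  finally show ?thesis .
qed

section \<open>Dirichlet series with bounded partial sums\<close>

lemma sum_Suc_powr_le:
  assumes e: "e > (0::real)"
  shows "(\<Sum>n<N. real (Suc n) powr - (1 + e)) \<le> 1 + 1 / e"
proof -
  \<comment> \<open>Mean value theorem for \<open>x powr - e\<close>, so that the sum
    telescopes.\<close>
  have step: "real (Suc (Suc n)) powr - (1 + e) \<le> (real (Suc n) powr - e - real (Suc (Suc n)) powr - e) / e" for n
  proof -
    have "\<exists>z>real (Suc n). z < real (Suc (Suc n)) \<and>
        real (Suc (Suc n)) powr - e - real (Suc n) powr - e = (real (Suc (Suc n)) - real (Suc n)) * (- e * z powr (- e - 1))"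
      by (rule MVT2) (auto intro!: derivative_eq_intros simp: field_simps powr_diff)
    then obtain z where z: "real (Suc n) < z" "z < real (Suc (Suc n))"
      "real (Suc n) powr - e - real (Suc (Suc n)) powr - e = e * z powr (- e - 1)" by (auto simp: algebra_simps)
    have "real (Suc (Suc n)) powr (- e - 1) \<le> z powr (- e - 1)"
      using z e by (intro powr_mono2') auto
    moreover have "- (1 + e) = - e - 1" by simp
    ultimately show ?thesis using z(3) e by (simp only: pos_le_divide_eq mult.commute[of _ e] mult_left_mono)
  qed
  have "(\<Sum>n<Suc N. real (Suc n) powr - (1 + e)) \<le> 1 + (1 - real (Suc N) powr - e) / e" for N
  proof (induction N)
    case (Suc N)
    then show ?case using step[of N] by (simp add: diff_divide_distrib)
  qed simp
  moreover have "1 + (1 - real (Suc N) powr - e) / e \<le> 1 + 1 / e" for N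
    using e by (simp add: divide_right_mono)
  ultimately have "(\<Sum>n<Suc N. real (Suc n) powr - (1 + e)) \<le> 1 + 1 / e" for N by (meson order_trans)
  moreover have "(0::real) \<le> 1 + 1 / e" using e by simp
  ultimately show ?thesis by (cases N) auto
qed

lemma summable_Suc_powr: "e > (0::real) \<Longrightarrow> summable (\<lambda>n. real (Suc n) powr - (1 + e))"
  by (rule summableI_nonneg_bounded[OF _ sum_Suc_powr_le]) auto

lemma suminf_Suc_powr_le: "e > (0::real) \<Longrightarrow> (\<Sum>n. real (Suc n) powr - (1 + e)) \<le> 1 + 1 / e"
  by (rule suminf_le_const[OF summable_Suc_powr sum_Suc_powr_le])

lemma norm_nat_powr: "norm (of_nat (Suc n) powr (s::complex)) = real (Suc n) powr Re s"
proof -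
  have "norm (complex_of_real (real (Suc n)) powr s) = real (Suc n) powr Re s"
    by (subst norm_powr_real_powr) auto
  then show ?thesis by (simp only: of_real_of_nat_eq)
qed

lemma norm_diff_nat_powr_le:
  assumes "Re s > 0"
  shows "norm (of_nat (Suc n) powr - s - of_nat (Suc (Suc n)) powr - s) \<le> norm s * real (Suc n) powr - (1 + Re s)"
proof -
  define a :: real where "a = real (Suc n)"
  have a: "a \<ge> 1" by (simp add: a_def)
  define S where "S = closed_segment (complex_of_real a) (complex_of_real (a + 1))"
  have real_pt: "\<exists>x\<ge>a. z = complex_of_real x" if "z \<in> S" for z
  proof -
    from that obtain u where "0 \<le> u" "z = (1 - u) *\<^sub>R complex_of_real a + u *\<^sub>R complex_of_real (a + 1)"
      unfolding S_def in_segment by blast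
    then have "z = complex_of_real (a + u)" "a + u \<ge> a" by (simp_all add: scaleR_conv_of_real algebra_simps)
    then show ?thesis by blast
  qed
  have "norm (complex_of_real a powr - s - complex_of_real (a + 1) powr - s)
      \<le> (norm s * a powr - (1 + Re s)) * norm (complex_of_real a - complex_of_real (a + 1))"
  proof (rule field_differentiable_bound[where S = S and f' = "\<lambda>z. - s * z powr (- s - 1)"])
    fix z assume "z \<in> S"
    then obtain x where x: "x \<ge> a" "z = complex_of_real x" using real_pt by blast
    then have "z \<notin> \<real>\<^sub>\<le>\<^sub>0" using a by (auto simp: complex_nonpos_Reals_iff)
    then show "((\<lambda>z. z powr - s) has_field_derivative - s * z powr (- s - 1)) (at z within S)"
      by (rule has_field_derivative_at_within[OF has_field_derivative_powr])
    have "norm (z powr (- s - 1)) = x powr (- Re s - 1)"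
      using x a by (subst norm_powr_real_powr) auto
    also have "\<dots> \<le> a powr (- Re s - 1)" using x a assms by (intro powr_mono2') auto
    also have "- Re s - 1 = - (1 + Re s)" by simp
    finally show "norm (- s * z powr (- s - 1)) \<le> norm s * a powr - (1 + Re s)"
      unfolding norm_mult norm_minus_cancel by (rule mult_left_mono) simp
  qed (auto simp: S_def)
  moreover have "norm (complex_of_real a - complex_of_real (a + 1)) = 1" by simp
  moreover have "complex_of_real (a + 1) = of_nat (Suc (Suc n))" "complex_of_real a = of_nat (Suc n)"
    by (simp_all add: a_def)
  ultimately show ?thesis by (simp only: a_def mult_1_right)
qed

section \<open>Abel summation and holomorphy\<close>

lemma sum_by_parts:
  fixes a u :: "nat \<Rightarrow> 'a::comm_ring_1"
  shows "(\<Sum>n<Suc N. a n * u n) =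
    (\<Sum>n<Suc N. (\<Sum>k\<le>n. a k) * (u n - u (Suc n))) + (\<Sum>k\<le>N. a k) * u (Suc N)"
  by (induction N) (simp_all add: algebra_simps)

definition dirichlet_series :: "(nat \<Rightarrow> complex) \<Rightarrow> complex \<Rightarrow> complex" where
  "dirichlet_series a s = (\<Sum>n. a n / of_nat (Suc n) powr s)"

context
  fixes a :: "nat \<Rightarrow> complex" and B :: real
  assumes bounded_partial_sums: "\<And>n. norm (\<Sum>k\<le>n. a k) \<le> B"
begin

private lemma B_nonneg: "B \<ge> 0"
  using bounded_partial_sums[of 0] norm_ge_zero order_trans by blast

text \<open>Terms after summation by parts. They decay like \<open>n powr - (1 + Re s)\<close>, so
  their series converges absolutely for \<open>Re s > 0\<close>, where the original series may
  converge only conditionally.\<close>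

private definition abel_term :: "nat \<Rightarrow> complex \<Rightarrow> complex" where
  "abel_term n s = (\<Sum>k\<le>n. a k) * (of_nat (Suc n) powr - s - of_nat (Suc (Suc n)) powr - s)"

private lemma norm_term_le:
  assumes "Re s > 0"
  shows "norm (abel_term n s) \<le> B * norm s * real (Suc n) powr - (1 + Re s)"
  using mult_mono[OF bounded_partial_sums[of n] norm_diff_nat_powr_le[OF assms, of n]] B_nonneg
  by (simp add: abel_term_def norm_mult mult.assoc del: of_nat_Suc)

private lemma summable_bound:
  assumes "Re s > 0"
  shows "summable (\<lambda>n. B * norm s * real (Suc n) powr - (1 + Re s))"
  by (intro summable_mult summable_Suc_powr assms)

private lemma summable_term:
  assumes "Re s > 0"
  shows "summable (\<lambda>n. abel_term n s)"
  by (rule summable_comparison_test'[OF summable_bound[OF assms], of 0]) (use norm_term_le[OF assms] in auto)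

lemma dirichlet_series_sums:
  assumes s: "Re s > 0"
  shows "(\<lambda>n. a n / of_nat (Suc n) powr s) sums (\<Sum>n. abel_term n s)"
proof -
  define u where "u = (\<lambda>n. of_nat (Suc n) powr - s)"
  have "(\<lambda>N. real (Suc (Suc N)) powr - Re s) \<longlonglongrightarrow> 0"
    using s by real_asymp
  then have lim: "(\<lambda>N. B * real (Suc (Suc N)) powr - Re s) \<longlonglongrightarrow> 0" by (rule tendsto_mult_right_zero)
  have bound: "norm ((\<Sum>k\<le>N. a k) * u (Suc N)) \<le> B * real (Suc (Suc N)) powr - Re s" for N
    using mult_right_mono[OF bounded_partial_sums[of N], of "real (Suc (Suc N)) powr - Re s"]
      norm_nat_powr[of "Suc N" "-s"]
    by (simp add: u_def norm_mult del: of_nat_Suc)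
  have "(\<lambda>N. (\<Sum>k\<le>N. a k) * u (Suc N)) \<longlonglongrightarrow> 0"
    by (rule Lim_null_comparison[OF always_eventually lim]) (use bound in blast)
  moreover have "(\<lambda>N. \<Sum>n<Suc N. abel_term n s) \<longlonglongrightarrow> (\<Sum>n. abel_term n s)"
    using summable_LIMSEQ[OF summable_term[OF s]] by (rule LIMSEQ_Suc)
  ultimately have "(\<lambda>N. (\<Sum>n<Suc N. abel_term n s) + (\<Sum>k\<le>N. a k) * u (Suc N)) \<longlonglongrightarrow> (\<Sum>n. abel_term n s) + 0"
    by (intro tendsto_add)
  moreover have "(\<Sum>n<Suc N. abel_term n s) + (\<Sum>k\<le>N. a k) * u (Suc N) = (\<Sum>n<Suc N. a n / of_nat (Suc n) powr s)" for N
    using sum_by_parts[of a u N] by (simp only: abel_term_def u_def powr_minus divide_inverse)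
  ultimately have "(\<lambda>N. \<Sum>n<Suc N. a n / of_nat (Suc n) powr s) \<longlonglongrightarrow> (\<Sum>n. abel_term n s)" by simp
  then show ?thesis unfolding sums_def by (rule LIMSEQ_imp_Suc)
qed

lemma dirichlet_series_eq_term:
  "Re s > 0 \<Longrightarrow> dirichlet_series a s = (\<Sum>n. abel_term n s)"
  unfolding dirichlet_series_def by (rule sums_unique[OF dirichlet_series_sums, symmetric])

lemma sums_dirichlet_series:
  "Re s > 0 \<Longrightarrow> (\<lambda>n. a n / of_nat (Suc n) powr s) sums dirichlet_series a s"
  using dirichlet_series_sums dirichlet_series_eq_term by simp

text \<open>Crude, but linear in the bound \<open>B\<close> for the partial sums, which is
  \<open>q\<close> for a nonprincipal character; only the logarithm of this estimate enters
  later.\<close>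

lemma norm_dirichlet_series_le:
  assumes s: "Re s > 0"
  shows "norm (dirichlet_series a s) \<le> B * norm s * (1 + 1 / Re s)"
proof -
  have "norm (\<Sum>n. abel_term n s) \<le> (\<Sum>n. B * norm s * real (Suc n) powr - (1 + Re s))"
    by (rule norm_suminf_le[OF norm_term_le[OF s] summable_bound[OF s]])
  also have "\<dots> = B * norm s * (\<Sum>n. real (Suc n) powr - (1 + Re s))"
    by (rule suminf_mult[OF summable_Suc_powr[OF s]])
  also have "\<dots> \<le> B * norm s * (1 + 1 / Re s)"
    using B_nonneg by (intro mult_left_mono suminf_Suc_powr_le s) auto
  finally show ?thesis by (simp add: dirichlet_series_eq_term[OF s])
qed

lemma holomorphic_dirichlet_series: "dirichlet_series a holomorphic_on {s. Re s > 0}"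
proof -
  have "(\<lambda>s. \<Sum>n. abel_term n s) holomorphic_on {s. Re s > 0}"
  proof (rule holomorphic_uniform_sequence[where f = "\<lambda>N s. \<Sum>n<N. abel_term n s"])
    show "open {s. Re s > 0}" by (rule open_halfspace_Re_gt)
    show "(\<lambda>s. \<Sum>n<N. abel_term n s) holomorphic_on {s. Re s > 0}" for N
      unfolding abel_term_def by (intro holomorphic_intros)
    fix x assume x: "x \<in> {s. Re s > 0}"
    define d where "d = Re x / 2"
    have d: "d > 0" using x by (simp add: d_def)
    have near: "Re y \<ge> d \<and> norm y \<le> norm x + d" if "y \<in> cball x d" for y
    proof -
      have "norm (x - y) \<le> d" using that by (simp add: dist_norm)
      then have "\<bar>Re (x - y)\<bar> \<le> d" "norm y \<le> norm x + d"
        using abs_Re_le_cmod[of "x - y"] norm_triangle_ineq2[of y x] by (auto simp: norm_minus_commute)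
      then show ?thesis unfolding d_def minus_complex.sel by linarith
    qed
    have "uniform_limit (cball x d) (\<lambda>N s. \<Sum>n<N. abel_term n s) (\<lambda>s. \<Sum>n. abel_term n s) sequentially"
    proof (rule Weierstrass_m_test)
      show "summable (\<lambda>n. B * (norm x + d) * real (Suc n) powr - (1 + d))"
        by (intro summable_mult summable_Suc_powr d)
      fix n y assume "y \<in> cball x d"
      then have y: "Re y \<ge> d" "norm y \<le> norm x + d" using near by auto
      then have "norm (abel_term n y) \<le> B * norm y * real (Suc n) powr - (1 + Re y)"
        using d by (intro norm_term_le) auto
      also have "\<dots> \<le> B * (norm x + d) * real (Suc n) powr - (1 + d)"
        using y B_nonneg d by (intro mult_mono powr_mono mult_nonneg_nonneg) auto
      finally show "norm (abel_term n y) \<le> B * (norm x + d) * real (Suc n) powr - (1 + d)" .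
    qed
    moreover have "cball x d \<subseteq> {s. Re s > 0}" using near d by force
    ultimately show "\<exists>d>0. cball x d \<subseteq> {s. Re s > 0} \<and>
        uniform_limit (cball x d) (\<lambda>N s. \<Sum>n<N. abel_term n s) (\<lambda>s. \<Sum>n. abel_term n s) sequentially"
      using d by blast
  qed
  then show ?thesis
    by (rule holomorphic_transform) (simp add: dirichlet_series_eq_term)
qed

end

section \<open>L-series of characters on the half plane to the right of 0\<close>

lemma sum_lessThan_add: "(\<Sum>k<m + n. f k) = (\<Sum>k<m. f k) + (\<Sum>k<n. f (m + k))"
  for f :: "nat \<Rightarrow> 'a::comm_monoid_add"
  by (induction n) (simp_all add: add.assoc)

lemma norm_sum_periodic_le:
  fixes f :: "nat \<Rightarrow> complex"
  assumes q: "q > 0" and per: "\<And>k. f (q + k) = f k" and zero: "(\<Sum>k<q. f k) = 0"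
    and M: "\<And>k. norm (f k) \<le> M"
  shows "norm (\<Sum>k<n. f k) \<le> M * real q"
proof (induction n rule: less_induct)
  case (less n)
  have M0: "M \<ge> 0" using M[of 0] norm_ge_zero order_trans by blast
  show ?case
  proof (cases "n < q")
    case True
    have "norm (\<Sum>k<n. f k) \<le> real n * M" using sum_norm_bound[of "{..<n}" f M] M by simp
    also have "\<dots> \<le> real q * M" using True M0 by (intro mult_right_mono) auto
    finally show ?thesis by (simp add: mult.commute)
  next
    case False
    then have "n = q + (n - q)" by simp
    then have "(\<Sum>k<n. f k) = (\<Sum>k<n - q. f k)"
      using sum_lessThan_add[of f q "n - q"] zero per by simp
    then show ?thesis using less[of "n - q"] False q by simp
  qed
qed

lemma sum_periodic_shift:
  fixes f :: "nat \<Rightarrow> complex"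
  assumes "f q = f 0"
  shows "(\<Sum>k<q. f (Suc k)) = (\<Sum>k<q. f k)"
  using sum.lessThan_Suc_shift[of f q] assms by (simp add: add.commute)

abbreviation char_coeff :: "(int \<Rightarrow> complex) \<Rightarrow> nat \<Rightarrow> complex" where
  "char_coeff chi n \<equiv> chi (int (Suc n))"

abbreviation char_series :: "(int \<Rightarrow> complex) \<Rightarrow> complex \<Rightarrow> complex" where
  "char_series chi \<equiv> dirichlet_series (char_coeff chi)"

lemma sum_char_coeff:
  assumes chi: "dirichlet_character q chi"
  shows "(\<Sum>k<q. char_coeff chi k) = (if chi = principal_character q then of_nat (totient q) else 0)"
proof -
  have "(\<Sum>k<q. chi (int (Suc k))) = (\<Sum>k<q. chi (int k))"
    using dirichlet_character_cong[OF chi, of "int q" 0]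
    by (intro sum_periodic_shift[where f = "\<lambda>k. chi (int k)"]) (simp add: cong_def)
  also have "\<dots> = (\<Sum>m\<in>int ` {0..<q}. chi m)" by (simp add: sum.reindex atLeast0LessThan)
  also have "\<dots> = (\<Sum>m\<in>{0..<int q}. chi m)" by (simp only: image_int_atLeastLessThan of_nat_0)
  finally show ?thesis using sum_dirichlet_character[OF chi] by simp
qed

lemma norm_sum_char_coeff_le:
  assumes chi: "dirichlet_character q chi" "chi \<noteq> principal_character q"
  shows "norm (\<Sum>k\<le>n. char_coeff chi k) \<le> real q"
proof -
  have "norm (\<Sum>k<Suc n. char_coeff chi k) \<le> 1 * real q"
  proof (rule norm_sum_periodic_le)
    show "char_coeff chi (q + k) = char_coeff chi k" for k
      by (rule dirichlet_character_cong[OF chi(1)]) (simp add: cong_iff_dvd_diff)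
    show "(\<Sum>k<q. char_coeff chi k) = 0" using sum_char_coeff[OF chi(1)] chi(2) by simp
    show "norm (char_coeff chi k) \<le> 1" for k by (rule norm_dirichlet_character_le[OF chi(1)])
    show "q > 0" by (rule dirichlet_character_pos[OF chi(1)])
  qed
  then show ?thesis by (simp only: lessThan_Suc_atMost mult_1)
qed

text \<open>The convergent series is itself a continuation to \<open>Re s > 0\<close>, so the domain
  with \<open>c = 0\<close> is admissible in the definition, punctured or not.\<close>

lemma Dirichlet_L_eq_series:
  assumes chi: "dirichlet_character q chi" "chi \<noteq> principal_character q" and s: "Re s > 0"
  shows "Dirichlet_L chi s = char_series chi s"
proof (rule Dirichlet_L_eqI[of 0])
  have "continuation_domain 0 s \<subseteq> {s. Re s > 0}" by (auto simp: continuation_domain_def)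
  then show "dirichlet_continuation chi (continuation_domain 0 s) (char_series chi)"
    using holomorphic_dirichlet_series[OF norm_sum_char_coeff_le[OF chi]]
      sums_dirichlet_series[OF norm_sum_char_coeff_le[OF chi]]
    unfolding dirichlet_continuation_def has_dirichlet_series_def
    by (auto intro: holomorphic_on_subset)
qed (use s in simp)

text \<open>
  The coefficients of \<open>(1 - 2\<^bsup>1-s\<^esup>) L(s, \<chi>\<^sub>0)\<close>: multiplying by the first factor removes the pole.
\<close>
definition alternating_coeff :: "(int \<Rightarrow> complex) \<Rightarrow> nat \<Rightarrow> complex" where
  "alternating_coeff chi n = char_coeff chi n - (if odd n then 2 * char_coeff chi (n div 2) else 0)"

text \<open>The alternating coefficients have period \<open>2 * q\<close>, sum 0 over a period and
  size at most 3.\<close>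

lemma norm_sum_alternating_coeff_le:
  assumes chi: "dirichlet_character q chi"
  shows "norm (\<Sum>k\<le>n. alternating_coeff chi k) \<le> 6 * real q"
proof -
  have q: "q > 0" by (rule dirichlet_character_pos[OF chi])
  have double: "(\<Sum>k<2 * m. if odd k then 2 * char_coeff chi (k div 2) else 0) = 2 * (\<Sum>k<m. char_coeff chi k)" for m
    by (induction m) (simp_all add: distrib_left)
  have per: "char_coeff chi (q + k) = char_coeff chi k" for k
    by (rule dirichlet_character_cong[OF chi]) (simp add: cong_iff_dvd_diff)
  have "norm (\<Sum>k<Suc n. alternating_coeff chi k) \<le> 3 * real (2 * q)"
  proof (rule norm_sum_periodic_le)
    show "alternating_coeff chi (2 * q + k) = alternating_coeff chi k" for k
    proof -
      have "char_coeff chi (2 * q + k) = char_coeff chi k"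
        using per[of k] per[of "q + k"] by (simp only: mult_2 add.assoc)
      moreover have "(2 * q + k) div 2 = q + k div 2" by simp
      ultimately show ?thesis using per[of "k div 2"] by (simp only: alternating_coeff_def even_add even_mult_iff) simp
    qed
    have "(\<Sum>k<2 * q. char_coeff chi k) = 2 * (\<Sum>k<q. char_coeff chi k)"
      using sum_lessThan_add[of "char_coeff chi" q q] per by (simp only: mult_2)
    then show "(\<Sum>k<2 * q. alternating_coeff chi k) = 0"
      using double[of q] by (simp add: alternating_coeff_def sum_subtractf)
    fix k
    have "norm (alternating_coeff chi k) \<le> norm (char_coeff chi k) + norm (if odd k then 2 * char_coeff chi (k div 2) else 0)"
      unfolding alternating_coeff_def by (rule norm_triangle_ineq4)
    also have "\<dots> \<le> 1 + 2"
      using norm_dirichlet_character_le[OF chi] by (intro add_mono) (auto simp: norm_mult)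
    finally show "norm (alternating_coeff chi k) \<le> 3" by simp
  qed (use q in simp)
  then show ?thesis by (simp add: lessThan_Suc_atMost)
qed

lemma dirichlet_series_alternating:
  assumes chi: "dirichlet_character q chi" and s: "Re s > 1"
    and L: "(\<lambda>n. char_coeff chi n / of_nat (Suc n) powr s) sums l"
  shows "dirichlet_series (alternating_coeff chi) s = (1 - 2 powr (1 - s)) * l"
proof -
  define f where "f = (\<lambda>n. (if odd n then 2 * char_coeff chi (n div 2) else 0) / of_nat (Suc n) powr s)"
  \<comment> \<open>Indices are one less than the integers they stand for, so the odd index
    \<open>2 * n + 1\<close> belongs to the even integer \<open>2 * (n + 1)\<close>.\<close>
  have "f (2 * n + 1) = 2 powr (1 - s) * (char_coeff chi n / of_nat (Suc n) powr s)" for n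
  proof -
    have "complex_of_nat (Suc (2 * n + 1)) = of_real 2 * of_real (real (Suc n))" by simp
    then have "of_nat (Suc (2 * n + 1)) powr s = 2 powr s * of_nat (Suc n) powr s"
      by (simp only: powr_times_real of_real_numeral of_real_of_nat_eq) (subst powr_times_real, auto)
    then show ?thesis by (simp add: f_def powr_diff del: of_nat_Suc)
  qed
  then have "(\<lambda>n. f (2 * n + 1)) sums (2 powr (1 - s) * l)" using sums_mult[OF L] by simp
  moreover have "strict_mono (\<lambda>n::nat. 2 * n + 1)" by (auto simp: strict_mono_def)
  moreover have "f n = 0" if "n \<notin> range (\<lambda>n. 2 * n + 1)" for n
    using that by (auto simp: f_def elim!: oddE)
  ultimately have "f sums (2 powr (1 - s) * l)" by (subst (asm) sums_mono_reindex) auto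
  then have "(\<lambda>n. char_coeff chi n / of_nat (Suc n) powr s - f n) sums (l - 2 powr (1 - s) * l)"
    by (intro sums_diff L)
  moreover have "char_coeff chi n / of_nat (Suc n) powr s - f n = alternating_coeff chi n / of_nat (Suc n) powr s" for n
    by (simp add: f_def alternating_coeff_def diff_divide_distrib)
  ultimately have "(\<lambda>n. alternating_coeff chi n / of_nat (Suc n) powr s) sums (l - 2 powr (1 - s) * l)" by simp
  then show ?thesis unfolding dirichlet_series_def by (simp add: sums_iff left_diff_distrib)
qed

section \<open>The logarithmic derivative to the right of the line 1\<close>

text \<open>Regroups a double sum by the product \<open>N\<close> of the two indices. Pairs
  containing 0 are dropped, because infinitely many of them share the product 0.\<close>

lemma has_sum_divisors:
  fixes f :: "nat \<times> nat \<Rightarrow> 'a::{comm_monoid_add,uniform_space,uniform_topological_group_add}"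
  assumes sum: "(f has_sum T) (UNIV \<times> UNIV)" and zero: "\<And>m n. m = 0 \<or> n = 0 \<Longrightarrow> f (m, n) = 0"
  shows "((\<lambda>N. \<Sum>d | d dvd N. f (N div d, d)) has_sum T) {1..}"
proof -
  have "f p = 0" if "p \<notin> {1..} \<times> {1..}" for p
    using that zero[of "fst p" "snd p"] by (cases p) (auto simp: Suc_le_eq)
  then have "(f has_sum T) ({1..} \<times> {1..}) \<longleftrightarrow> (f has_sum T) (UNIV \<times> UNIV)"
    by (intro has_sum_cong_neutral) auto
  with sum have "(f has_sum T) ({1..} \<times> {1..})" by blast
  also have "(f has_sum T) ({1..} \<times> {1..}) \<longleftrightarrow>
      ((\<lambda>(N, d). f (N div d, d)) has_sum T) (Sigma {1..} (\<lambda>N. {d. d dvd N}))"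
    by (rule has_sum_reindex_bij_witness[of _ "\<lambda>(N, d). (N div d, d)" "\<lambda>(m, n). (m * n, n)"])
      (auto simp: Suc_le_eq dvd_pos_nat dvd_div_eq_0_iff intro!: Nat.gr0I)
  finally have "((\<lambda>(N, d). f (N div d, d)) has_sum T) (Sigma {1..} (\<lambda>N. {d. d dvd N}))" .
  then show ?thesis
  proof (rule has_sum_Sigma')
    fix N :: nat assume "N \<in> {1..}"
    then show "((\<lambda>d. case (N, d) of (N, d) \<Rightarrow> f (N div d, d)) has_sum (\<Sum>d | d dvd N. f (N div d, d))) {d. d dvd N}"
      using finite_divisors_nat[of N] by (auto intro!: has_sum_finiteI)
  qed
qed

lemma has_sum_product:
  fixes f g :: "nat \<Rightarrow> complex"
  assumes "summable (\<lambda>n. norm (f n))" "summable (\<lambda>n. norm (g n))" "f sums a" "g sums b"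
  shows "((\<lambda>(m, n). f m * g n) has_sum (a * b)) (UNIV \<times> UNIV)"
proof (rule has_sum_SigmaI)
  have g: "(g has_sum b) UNIV" and f: "(f has_sum a) UNIV"
    using assms norm_summable_imp_has_sum by blast+
  show "((\<lambda>y. case (x, y) of (m, n) \<Rightarrow> f m * g n) has_sum (f x * b)) UNIV" for x
    using has_sum_cmult_right[OF g, of "f x"] by simp
  show "((\<lambda>x. f x * b) has_sum (a * b)) UNIV" by (rule has_sum_cmult_left[OF f])
  have ng: "((\<lambda>n. norm (g n)) has_sum (\<Sum>n. norm (g n))) UNIV"
    by (rule sums_nonneg_imp_has_sum) (use assms(2) in \<open>auto intro: summable_sums\<close>)
  have nf: "((\<lambda>n. norm (f n)) has_sum (\<Sum>n. norm (f n))) UNIV"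
    by (rule sums_nonneg_imp_has_sum) (use assms(1) in \<open>auto intro: summable_sums\<close>)
  have "(\<lambda>(m, n). norm (f m) * norm (g n)) summable_on (UNIV \<times> UNIV)"
  proof (rule summable_on_SigmaI)
    show "((\<lambda>y. case (x, y) of (m, n) \<Rightarrow> norm (f m) * norm (g n)) has_sum (norm (f x) * (\<Sum>n. norm (g n)))) UNIV" for x
      using has_sum_cmult_right[OF ng, of "norm (f x)"] by simp
    show "(\<lambda>x. norm (f x) * (\<Sum>n. norm (g n))) summable_on UNIV"
      using has_sum_cmult_left[OF nf] unfolding summable_on_def by blast
  qed auto
  then have "(\<lambda>p. norm (case p of (m, n) \<Rightarrow> f m * g n)) summable_on (UNIV \<times> UNIV)"
    by (simp add: case_prod_unfold norm_mult)
  then show "(\<lambda>(m, n). f m * g n) summable_on (UNIV \<times> UNIV)" by (rule abs_summable_summable)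
qed

text \<open>Growth below every positive power, rather than boundedness, so that the class is closed
  under multiplication by logarithms, that is, under differentiation of the series.\<close>

definition subpolynomial :: "(nat \<Rightarrow> complex) \<Rightarrow> bool" where
  "subpolynomial c \<longleftrightarrow> (\<forall>e>0. \<exists>C\<ge>0. \<forall>n. norm (c n) \<le> C * real (Suc n) powr e)"

context
  fixes c :: "nat \<Rightarrow> complex"
  assumes growth: "subpolynomial c"
begin

private lemma norm_coeff_div_le:
  assumes d: "d > 0"
  shows "\<exists>C\<ge>0. \<forall>n s. Re s \<ge> 1 + d \<longrightarrow> norm (c n / of_nat (Suc n) powr s) \<le> C * real (Suc n) powr - (1 + d / 2)"
proof -
  obtain C where C: "C \<ge> 0" "\<And>n. norm (c n) \<le> C * real (Suc n) powr (d / 2)"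
    using growth half_gt_zero[OF d] unfolding subpolynomial_def by blast
  have "norm (c n / of_nat (Suc n) powr s) \<le> C * real (Suc n) powr - (1 + d / 2)" if s: "Re s \<ge> 1 + d" for n s
  proof -
    define x where "x = real (Suc n)"
    have x: "x \<ge> 1" by (simp add: x_def)
    have "norm (c n / of_nat (Suc n) powr s) = norm (c n) * x powr - Re s"
      by (simp add: norm_mult norm_inverse norm_nat_powr x_def powr_minus divide_inverse del: of_nat_Suc)
    also have "\<dots> \<le> (C * x powr (d / 2)) * x powr - (1 + d)"
      using C(2)[of n] x s d C(1) by (intro mult_mono powr_mono) (auto simp: x_def)
    also have "\<dots> = C * x powr (d / 2 + - (1 + d))" by (simp only: powr_add mult.assoc)
    also have "d / 2 + - (1 + d) = - (1 + d / 2)" by simp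
    finally show ?thesis by (simp only: x_def)
  qed
  then show ?thesis using C(1) by blast
qed

lemma summable_norm_subpolynomial_series:
  assumes s: "Re s > 1"
  shows "summable (\<lambda>n. norm (c n / of_nat (Suc n) powr s))"
proof -
  obtain C where C: "\<And>n. norm (c n / of_nat (Suc n) powr s) \<le> C * real (Suc n) powr - (1 + (Re s - 1) / 2)"
    using norm_coeff_div_le[of "Re s - 1"] s by auto
  show ?thesis
  proof (rule summable_comparison_test')
    show "summable (\<lambda>n. C * real (Suc n) powr - (1 + (Re s - 1) / 2))"
      using s by (intro summable_mult summable_Suc_powr) simp
    show "norm (norm (c n / of_nat (Suc n) powr s)) \<le> C * real (Suc n) powr - (1 + (Re s - 1) / 2)" for n
      using C[of n] by (simp only: real_norm_def abs_norm_cancel)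
  qed
qed

lemma subpolynomial_series_sums:
  "Re s > 1 \<Longrightarrow> (\<lambda>n. c n / of_nat (Suc n) powr s) sums dirichlet_series c s"
  unfolding dirichlet_series_def
  by (rule summable_sums[OF summable_norm_cancel[OF summable_norm_subpolynomial_series]])

lemma has_field_derivative_subpolynomial_series:
  assumes s: "Re s > 1"
  shows "(dirichlet_series c has_field_derivative - dirichlet_series (\<lambda>n. of_real (ln (real (Suc n))) * c n) s) (at s)"
proof -
  define S where "S = {s. Re s > 1}"
  define f' where "f' = (\<lambda>n s. - (of_real (ln (real (Suc n))) * c n / of_nat (Suc n) powr s))"
  have "\<exists>g g'. \<forall>x\<in>S. ((\<lambda>n. c n / of_nat (Suc n) powr x) sums g x) \<and> ((\<lambda>n. f' n x) sums g' x) \<and>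
      (g has_field_derivative g' x) (at x)"
  proof (rule series_and_derivative_comparison_local)
    show "open S" unfolding S_def by (rule open_halfspace_Re_gt)
  next
    fix n x
    have "complex_of_nat (Suc n) \<noteq> 0" by (rule of_nat_neq_0)
    then have "((\<lambda>z. of_nat (Suc n) powr z) has_field_derivative
        Ln (of_nat (Suc n)) * of_nat (Suc n) powr - x) (at (- x))"
      by (rule has_field_derivative_powr_right)
    from DERIV_cmult[OF DERIV_chain2[OF this DERIV_minus[OF DERIV_ident]], of "c n"]
    have "((\<lambda>s. c n * of_nat (Suc n) powr - s) has_field_derivative
        c n * (Ln (of_nat (Suc n)) * of_nat (Suc n) powr - x * - 1)) (at x)" .
    moreover have "Ln (of_nat (Suc n)) = complex_of_real (ln (real (Suc n)))"
      by (metis Ln_of_real of_nat_0_less_iff of_real_of_nat_eq zero_less_Suc)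
    ultimately show "((\<lambda>s. c n / of_nat (Suc n) powr s) has_field_derivative f' n x) (at x)"
      by (simp add: f'_def powr_minus divide_inverse mult_ac del: of_nat_Suc)
  next
    fix x assume "x \<in> S"
    define d where "d = (Re x - 1) / 2"
    have d: "d > 0" using \<open>x \<in> S\<close> by (simp add: S_def d_def)
    obtain C where C: "\<And>n y. Re y \<ge> 1 + d \<Longrightarrow> norm (c n / of_nat (Suc n) powr y) \<le> C * real (Suc n) powr - (1 + d / 2)"
      using norm_coeff_div_le[OF d] by blast
    have "norm (c n / of_nat (Suc n) powr y) \<le> C * real (Suc n) powr - (1 + d / 2)"
      if "y \<in> ball x d \<inter> S" for n y
    proof (rule C)
      have "norm (x - y) < d" using that by (simp add: dist_norm)
      then have "\<bar>Re x - Re y\<bar> < d" using abs_Re_le_cmod[of "x - y"] by simp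
      then have "Re x - Re y < d" by linarith
      then show "1 + d \<le> Re y" by (simp add: d_def field_simps)
    qed
    moreover have "summable (\<lambda>n. C * real (Suc n) powr - (1 + d / 2))"
      using d by (intro summable_mult summable_Suc_powr) simp
    ultimately show "\<exists>d h. 0 < d \<and> summable h \<and>
        (\<forall>\<^sub>F n in sequentially. \<forall>y\<in>ball x d \<inter> S. norm (c n / of_nat (Suc n) powr y) \<le> h n)"
      using d by (intro exI[of _ d] exI[of _ "\<lambda>n. C * real (Suc n) powr - (1 + d / 2)"] conjI always_eventually) blast+
  qed
  then obtain g g' where g: "\<And>x. x \<in> S \<Longrightarrow> (\<lambda>n. c n / of_nat (Suc n) powr x) sums g x"
    "\<And>x. x \<in> S \<Longrightarrow> (\<lambda>n. f' n x) sums g' x" "\<And>x. x \<in> S \<Longrightarrow> (g has_field_derivative g' x) (at x)" by blast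
  have "s \<in> S" using s by (simp add: S_def)
  have "g' s = - dirichlet_series (\<lambda>n. of_real (ln (real (Suc n))) * c n) s"
    using sums_minus[OF g(2)[OF \<open>s \<in> S\<close>]] by (simp add: f'_def dirichlet_series_def sums_iff)
  moreover have "(dirichlet_series c has_field_derivative g' s) (at s)"
  proof (rule has_field_derivative_transform_within_open[OF g(3)[OF \<open>s \<in> S\<close>]])
    show "open S" unfolding S_def by (rule open_halfspace_Re_gt)
    show "g x = dirichlet_series c x" if "x \<in> S" for x
      using g(1)[OF that] by (simp add: dirichlet_series_def sums_iff)
  qed (use \<open>s \<in> S\<close> in simp)
  ultimately show ?thesis by simp
qed

lemma holomorphic_subpolynomial_series: "dirichlet_series c holomorphic_on {s. Re s > 1}"
  using has_field_derivative_subpolynomial_series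
  by (subst holomorphic_on_open[OF open_halfspace_Re_gt]) auto

end

section \<open>The von Mangoldt series as a logarithmic derivative\<close>

abbreviation mangoldt_coeff :: "(int \<Rightarrow> complex) \<Rightarrow> nat \<Rightarrow> complex" where
  "mangoldt_coeff chi n \<equiv> char_coeff chi n * mangoldt (Suc n)"

abbreviation mangoldt_series :: "(int \<Rightarrow> complex) \<Rightarrow> complex \<Rightarrow> complex" where
  "mangoldt_series chi \<equiv> dirichlet_series (mangoldt_coeff chi)"

lemma subpolynomial_char_coeff:
  assumes "dirichlet_character q chi"
  shows "subpolynomial (char_coeff chi)"
  unfolding subpolynomial_def
proof (intro allI impI)
  fix e :: real assume "e > 0"
  have "norm (char_coeff chi n) \<le> 1 * real (Suc n) powr e" for n
  proof -
    have "(1::real) \<le> real (Suc n) powr e" using \<open>e > 0\<close> by (intro ge_one_powr_ge_zero) auto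
    then show ?thesis using norm_dirichlet_character_le[OF assms, of "int (Suc n)"] by linarith
  qed
  then show "\<exists>C\<ge>0. \<forall>n. norm (char_coeff chi n) \<le> C * real (Suc n) powr e" using zero_le_one by blast
qed

text \<open>Half of the exponent \<open>e\<close> absorbs the logarithm, the other half bounds
  \<open>c\<close>.\<close>

lemma subpolynomial_ln_mult:
  assumes "subpolynomial c" and le: "\<And>n. norm (b n) \<le> ln (real (Suc n)) * norm (c n)"
  shows "subpolynomial b"
  unfolding subpolynomial_def
proof (intro allI impI)
  fix e :: real assume e: "e > 0"
  obtain C where C: "C \<ge> 0" "\<And>n. norm (c n) \<le> C * real (Suc n) powr (e / 2)"
    using assms(1) half_gt_zero[OF e] unfolding subpolynomial_def by blast
  have "norm (b n) \<le> (2 / e * C) * real (Suc n) powr e" for n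
  proof -
    define u where "u = real (Suc n) powr (e / 2)"
    have u: "u \<ge> 0" "u * u = real (Suc n) powr e" by (simp_all add: u_def flip: powr_add)
    have "ln (real (Suc n)) \<le> u / (e / 2)" unfolding u_def using e by (intro ln_powr_bound) auto
    moreover have "norm (c n) \<le> C * u" using C(2) by (simp add: u_def)
    ultimately have "ln (real (Suc n)) * norm (c n) \<le> (u / (e / 2)) * (C * u)"
      using e u(1) by (intro mult_mono) auto
    also have "\<dots> = (2 / e * C) * (u * u)" by simp
    also note u(2)
    finally show ?thesis using le[of n] by linarith
  qed
  moreover have "2 / e * C \<ge> 0" using e C(1) by simp
  ultimately show "\<exists>C\<ge>0. \<forall>n. norm (b n) \<le> C * real (Suc n) powr e" by blast
qed

lemma norm_mangoldt_coeff_le: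
  assumes "norm (chi (int (Suc n))) \<le> 1"
  shows "norm (mangoldt_coeff chi n) \<le> ln (real (Suc n))"
proof -
  have "norm (mangoldt_coeff chi n) \<le> 1 * mangoldt (Suc n)"
    unfolding norm_mult using assms by (intro mult_mono) (auto simp: mangoldt_nonneg)
  also have "\<dots> \<le> ln (real (Suc n))" using mangoldt_le[of "Suc n"] by simp
  finally show ?thesis .
qed

lemma subpolynomial_mangoldt_coeff:
  assumes "dirichlet_character q chi"
  shows "subpolynomial (mangoldt_coeff chi)"
proof (rule subpolynomial_ln_mult)
  show "subpolynomial (char_coeff (principal_character 1))"
    by (rule subpolynomial_char_coeff[OF dirichlet_character_principal]) simp
  show "norm (mangoldt_coeff chi n) \<le> ln (real (Suc n)) * norm (char_coeff (principal_character 1) n)" for n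
    using norm_mangoldt_coeff_le[of chi n] norm_dirichlet_character_le[OF assms, of "int (Suc n)"]
    by (simp add: principal_character_def del: of_nat_Suc)
qed

text \<open>The product of the two series has the coefficients of \<open>chi\<close> times the
  logarithm, because \<open>chi\<close> is completely multiplicative and the von Mangoldt function
  sums to the logarithm over divisors.\<close>

lemma has_field_derivative_char_series:
  assumes chi: "dirichlet_character q chi" and s: "Re s > 1"
  shows "(char_series chi has_field_derivative
    - char_series chi s * mangoldt_series chi s) (at s)"
proof -
  define v where "v = (\<lambda>n. chi (int n) / of_nat n powr s)"
  have v_mult: "v (m * n) = v m * v n" for m n
    using powr_times_real[of "of_nat m" "of_nat n" s]
    by (simp add: v_def dirichlet_character_mult[OF chi])
  have "v 0 = 0" by (simp add: v_def)
  define g where "g = (\<lambda>n. v n * mangoldt n)"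
  have shift_v: "v (Suc n) = char_coeff chi n / of_nat (Suc n) powr s"
    and shift_g: "g (Suc n) = mangoldt_coeff chi n / of_nat (Suc n) powr s" for n
    by (simp_all add: v_def g_def)
  have "summable (\<lambda>n. norm (v (Suc n)))" "(\<lambda>n. v (Suc n)) sums char_series chi s"
    unfolding shift_v using subpolynomial_char_coeff[OF chi] s
    by (intro summable_norm_subpolynomial_series subpolynomial_series_sums; simp del: of_nat_Suc)+
  then have v: "summable (\<lambda>n. norm (v n))" "v sums char_series chi s"
    using \<open>v 0 = 0\<close> by (simp_all add: summable_Suc_iff[of "\<lambda>n. norm (v n)"] sums_Suc_iff)
  have "summable (\<lambda>n. norm (g (Suc n)))" "(\<lambda>n. g (Suc n)) sums mangoldt_series chi s"
    unfolding shift_g using subpolynomial_mangoldt_coeff[OF chi] s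
    by (intro summable_norm_subpolynomial_series subpolynomial_series_sums; simp del: of_nat_Suc)+
  moreover have "g 0 = 0" by (simp add: g_def)
  ultimately have g: "summable (\<lambda>n. norm (g n))" "g sums mangoldt_series chi s"
    by (simp_all add: summable_Suc_iff[of "\<lambda>n. norm (g n)"] sums_Suc_iff)
  define T where "T = char_series chi s * mangoldt_series chi s"
  have "((\<lambda>(m, n). v m * g n) has_sum T) (UNIV \<times> UNIV)"
    unfolding T_def by (rule has_sum_product[OF v(1) g(1) v(2) g(2)])
  then have "((\<lambda>N. \<Sum>d | d dvd N. case (N div d, d) of (m, n) \<Rightarrow> v m * g n) has_sum T) {1..}"
    by (rule has_sum_divisors) (auto simp: \<open>v 0 = 0\<close> g_def)
  moreover have "(\<Sum>d | d dvd N. case (N div d, d) of (m, n) \<Rightarrow> v m * g n) = v N * of_real (ln (real N))"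
    if "N \<in> {1..}" for N
  proof -
    have "(\<Sum>d | d dvd N. case (N div d, d) of (m, n) \<Rightarrow> v m * g n) = (\<Sum>d | d dvd N. v N * mangoldt d)"
    proof (intro sum.cong refl)
      fix d assume "d \<in> {d. d dvd N}"
      then have "v N = v (N div d) * v d" by (metis dvd_div_mult_self mem_Collect_eq v_mult)
      then show "(case (N div d, d) of (m, n) \<Rightarrow> v m * g n) = v N * mangoldt d" by (simp add: g_def)
    qed
    also have "\<dots> = v N * of_real (ln (real N))"
      using that by (simp add: mangoldt_sum flip: sum_distrib_left)
    finally show ?thesis .
  qed
  ultimately have "((\<lambda>N. v N * of_real (ln (real N))) has_sum T) {1..}"
    by (subst (asm) has_sum_cong) auto
  then have "((\<lambda>N. v N * of_real (ln (real N))) has_sum T) UNIV"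
    by (rule has_sum_cong_neutral[THEN iffD1, rotated -1]) (auto simp: not_le \<open>v 0 = 0\<close>)
  then have "(\<lambda>N. v N * of_real (ln (real N))) sums T" by (rule has_sum_imp_sums)
  then have "(\<lambda>N. v (Suc N) * of_real (ln (real (Suc N)))) sums T"
    using \<open>v 0 = 0\<close> sums_Suc_iff[of "\<lambda>N. v N * of_real (ln (real N))" T] by simp
  then have "dirichlet_series (\<lambda>n. of_real (ln (real (Suc n))) * char_coeff chi n) s = T"
    unfolding dirichlet_series_def shift_v by (simp add: sums_iff mult.commute del: of_nat_Suc)
  moreover have "(char_series chi has_field_derivative
      - dirichlet_series (\<lambda>n. of_real (ln (real (Suc n))) * char_coeff chi n) s) (at s)"
    using subpolynomial_char_coeff[OF chi] s by (intro has_field_derivative_subpolynomial_series) auto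
  ultimately show ?thesis by (simp add: T_def)
qed

lemma char_series_sums:
  assumes chi: "dirichlet_character q chi" and s: "Re s > 1"
  shows "(\<lambda>n. char_coeff chi n / of_nat (Suc n) powr s) sums char_series chi s"
  using subpolynomial_series_sums[OF subpolynomial_char_coeff[OF chi] s] .

text \<open>Telescoping, started at the exact first term 1/4. What matters is that the bound lies
  below 1: it keeps every L-series on the line \<open>Re s = 2\<close> away from 0.\<close>

lemma sum_Suc_powr_minus2_le: "(\<Sum>n<N. real (Suc (Suc n)) powr - 2) \<le> 3 / 4"
proof -
  have "(\<Sum>n<Suc N. real (Suc (Suc n)) powr - 2) \<le> 3 / 4 - 1 / real (Suc (Suc N))" for N
  proof (induction N)
    case 0
    then show ?case by (simp add: powr_minus divide_simps)
  next
    case (Suc N)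
    define m where "m = real (Suc (Suc N))"
    have m: "m > 0" "real (Suc (Suc (Suc N))) = m + 1" by (simp_all add: m_def)
    have "(m + 1) powr - 2 = 1 / ((m + 1) * (m + 1))"
      using m(1) by (simp add: powr_minus powr_numeral divide_inverse power2_eq_square)
    also have "\<dots> \<le> 1 / (m * (m + 1))" using m(1) by (intro divide_left_mono mult_right_mono) auto
    also have "\<dots> = 1 / m - 1 / (m + 1)" using m(1) by (simp add: divide_simps)
    finally have "(m + 1) powr - 2 \<le> 1 / m - 1 / (m + 1)" .
    then show ?case using Suc.IH unfolding sum.lessThan_Suc[of _ "Suc N"] m(2) m_def[symmetric] by linarith
  qed
  moreover have "(3::real) / 4 - 1 / real (Suc (Suc N)) \<le> 3 / 4" for N by simp
  ultimately have "(\<Sum>n<Suc N. real (Suc (Suc n)) powr - 2) \<le> 3 / 4" for N by (meson order_trans)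
  then show ?thesis by (cases N) auto
qed

lemma norm_char_series_ge:
  assumes chi: "dirichlet_character q chi" and s: "Re s = 2"
  shows "norm (char_series chi s) \<ge> 1 / 4"
proof -
  define f where "f = (\<lambda>n. char_coeff chi n / of_nat (Suc n) powr s)"
  have f: "f sums char_series chi s"
    unfolding f_def using s by (intro char_series_sums[OF chi]) simp
  have f0: "f 0 = 1" using dirichlet_character_one[OF chi] by (simp add: f_def)
  have le: "norm (f (Suc n)) \<le> real (Suc (Suc n)) powr - 2" for n
  proof -
    have "norm (f (Suc n)) = norm (char_coeff chi (Suc n)) * real (Suc (Suc n)) powr - 2"
      by (simp add: f_def norm_mult norm_inverse norm_nat_powr s powr_minus divide_inverse del: of_nat_Suc)
    also have "\<dots> \<le> 1 * real (Suc (Suc n)) powr - 2"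
      by (intro mult_right_mono norm_dirichlet_character_le[OF chi]) simp
    finally show ?thesis by simp
  qed
  have summ: "summable (\<lambda>n. real (Suc (Suc n)) powr - 2)"
    by (rule summableI_nonneg_bounded[OF _ sum_Suc_powr_minus2_le]) simp
  have "norm (\<Sum>n. f (Suc n)) \<le> (\<Sum>n. real (Suc (Suc n)) powr - 2)"
    by (rule norm_suminf_le[OF le summ])
  also have "\<dots> \<le> 3 / 4" by (rule suminf_le_const[OF summ sum_Suc_powr_minus2_le])
  finally have "norm (\<Sum>n. f (Suc n)) \<le> 3 / 4" .
  moreover have "(\<Sum>n. f (Suc n)) = char_series chi s - 1"
    using suminf_split_head[of f] f f0 by (simp add: sums_iff)
  moreover have "norm (char_series chi s) \<ge> 1 - norm (char_series chi s - 1)"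
    by (metis norm_minus_commute norm_one norm_triangle_sub diff_le_eq add.commute)
  ultimately show ?thesis by simp
qed

text \<open>The logarithmic derivative is holomorphic, so the series is a constant multiple of an exponential.\<close>
lemma char_series_nonzero:
  assumes chi: "dirichlet_character q chi" and s: "Re s > 1"
  shows "char_series chi s \<noteq> 0"
proof
  assume zero: "char_series chi s = 0"
  define S where "S = {s. Re s > 1}"
  have S: "convex S" "open S" unfolding S_def by (rule convex_halfspace_Re_gt, rule open_halfspace_Re_gt)
  have "mangoldt_series chi holomorphic_on S"
    unfolding S_def by (intro holomorphic_subpolynomial_series subpolynomial_mangoldt_coeff[OF chi])
  then obtain P where P: "\<And>x. x \<in> S \<Longrightarrow> (P has_field_derivative mangoldt_series chi x) (at x within S)"
    using holomorphic_convex_primitive'[OF S] by blast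
  define G where "G = (\<lambda>z. char_series chi z * exp (P z))"
  have "(G has_field_derivative 0) (at x within S)" if "x \<in> S" for x
    unfolding G_def
    using P[OF that] has_field_derivative_at_within[OF has_field_derivative_char_series[OF chi], of x S] that
    by (auto intro!: derivative_eq_intros simp: S_def)
  then obtain c where c: "\<And>x. x \<in> S \<Longrightarrow> G x = c"
    using has_field_derivative_zero_constant[OF S(1)] by blast
  have "G s = 0" by (simp only: G_def zero mult_zero_left)
  moreover have "G s = G 2" using c s by (simp add: S_def)
  ultimately have "G 2 = 0" by simp
  then have "char_series chi 2 = 0" unfolding G_def by (metis mult_eq_0_iff exp_not_eq_zero)
  then show False using norm_char_series_ge[OF chi, of 2] by simp
qed

section \<open>Nonvanishing on the line 1\<close>

lemma sum_divisors_prime_power_mult: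
  fixes r :: "nat \<Rightarrow> 'a::comm_semiring_1"
  assumes mult: "\<And>m n. r (m * n) = r m * r n" and one: "r 1 = 1" and p: "prime p" "\<not> p dvd m" and m: "m > 0"
  shows "(\<Sum>d | d dvd p ^ k * m. r d) = (\<Sum>i\<le>k. r p ^ i) * (\<Sum>d | d dvd m. r d)"
proof -
  have r_pow: "r (p ^ i) = r p ^ i" for i by (induction i) (use one mult in auto)
  have p0: "p > 0" using p(1) prime_gt_0_nat by blast
  have no: "\<not> p dvd d" if "d dvd m" for d using that p(2) dvd_trans by blast
  have aux: "i = j \<and> d = e" if "p ^ i * d = p ^ j * e" "\<not> p dvd d" "\<not> p dvd e" "i \<le> j" for i j d e
  proof -
    have "p ^ i * d = p ^ i * (p ^ (j - i) * e)" using that by (simp add: flip: power_add mult.assoc)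
    then have d: "d = p ^ (j - i) * e" using p0 by simp
    have "j - i = 0"
    proof (rule ccontr)
      assume "j - i \<noteq> 0"
      then have "p dvd p ^ (j - i)" by (simp add: dvd_power)
      then show False using d that(2) by simp
    qed
    then show ?thesis using d that(4) by simp
  qed
  have inj: "inj_on (\<lambda>(i, d). p ^ i * d) ({..k} \<times> {d. d dvd m})"
  proof (rule inj_onI, clarify)
    fix i d j e assume "d dvd m" "e dvd m" and eq: "p ^ i * d = p ^ j * e"
    then have "\<not> p dvd d" "\<not> p dvd e" using no by auto
    then show "i = j \<and> d = e" using aux[OF eq] aux[OF eq[symmetric]] by (cases "i \<le> j") auto
  qed
  have img: "(\<lambda>(i, d). p ^ i * d) ` ({..k} \<times> {d. d dvd m}) = {d. d dvd p ^ k * m}"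
  proof (intro equalityI subsetI)
    fix x assume "x \<in> (\<lambda>(i, d). p ^ i * d) ` ({..k} \<times> {d. d dvd m})"
    then show "x \<in> {d. d dvd p ^ k * m}" by (auto intro!: mult_dvd_mono le_imp_power_dvd)
  next
    fix x assume "x \<in> {d. d dvd p ^ k * m}"
    then obtain b c where "x = b * c" "b dvd p ^ k" "c dvd m" using division_decomp by blast
    moreover from this obtain i where "i \<le> k" "b = p ^ i" using divides_primepow_nat[OF p(1)] by blast
    ultimately show "x \<in> (\<lambda>(i, d). p ^ i * d) ` ({..k} \<times> {d. d dvd m})" by (auto intro!: rev_image_eqI[of "(i, c)"])
  qed
  have "(\<Sum>d | d dvd p ^ k * m. r d) = (\<Sum>(i, d)\<in>{..k} \<times> {d. d dvd m}. r p ^ i * r d)"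
    unfolding img[symmetric] by (subst sum.reindex[OF inj]) (simp add: case_prod_unfold mult r_pow)
  also have "\<dots> = (\<Sum>i\<le>k. r p ^ i) * (\<Sum>d | d dvd m. r d)"
    by (simp add: sum_product sum.cartesian_product)
  finally show ?thesis .
qed

lemma sum_powers_sign:
  fixes x :: real
  assumes "x \<in> {-1, 0, 1}"
  shows "(\<Sum>i\<le>k. x ^ i) \<ge> 0" "even k \<Longrightarrow> (\<Sum>i\<le>k. x ^ i) \<ge> 1"
proof -
  have neg: "(\<Sum>i\<le>k. (- 1 :: real) ^ i) = (if even k then 1 else 0)" by (induction k) auto
  have zero: "(\<Sum>i\<le>k. (0 :: real) ^ i) = 1" by (induction k) auto
  show "(\<Sum>i\<le>k. x ^ i) \<ge> 0" "even k \<Longrightarrow> (\<Sum>i\<le>k. x ^ i) \<ge> 1"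
    using assms neg zero by auto
qed

text \<open>Induction by splitting off one full prime power, whose factor is a sum of powers of -1,
  0 or 1.\<close>

lemma sum_divisors_real_character_nonneg:
  fixes r :: "nat \<Rightarrow> real"
  assumes mult: "\<And>m n. r (m * n) = r m * r n" and one: "r 1 = 1" and val: "\<And>n. r n \<in> {-1, 0, 1}"
  shows "n > 0 \<Longrightarrow> (\<Sum>d | d dvd n. r d) \<ge> 0"
proof (induction n rule: less_induct)
  case (less n)
  show ?case
  proof (cases "n = 1")
    case False
    then obtain p where p: "prime p" "p dvd n" using prime_factor_nat by blast
    define k where "k = multiplicity p n"
    obtain m where m: "n = p ^ k * m" "\<not> p dvd m"
      by (rule multiplicity_decompose'[of n p]) (use less.prems p(1) that in \<open>auto simp: k_def\<close>)
    have "k > 0" using p less.prems by (simp add: k_def prime_multiplicity_gt_zero_iff)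
    then have "p ^ k > 1" using prime_gt_1_nat[OF p(1)] by (metis one_less_power)
    moreover have m0: "m > 0" using m less.prems by (cases m) auto
    ultimately have "m < n" using m(1) by simp
    then have "(\<Sum>d | d dvd m. r d) \<ge> 0" using less.IH m0 by blast
    then show ?thesis
      unfolding m(1) sum_divisors_prime_power_mult[OF mult one p(1) m(2) m0]
      using sum_powers_sign(1)[OF val] by (intro mult_nonneg_nonneg) auto
  qed (use one in simp)
qed

text \<open>Arithmetic-geometric mean on the terms \<open>i\<close> and \<open>m - 1 - i\<close>,
  whose product is \<open>(y ^ (m - 1))\<^sup>2\<close>.\<close>

lemma sum_powers_ge:
  fixes y :: real
  assumes "0 \<le> y"
  shows "(\<Sum>i<m. (y\<^sup>2) ^ i) \<ge> real m * y ^ (m - 1)"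
proof -
  have "(\<Sum>i<m. 2 * y ^ (m - 1)) \<le> (\<Sum>i<m. (y\<^sup>2) ^ i + (y\<^sup>2) ^ (m - Suc i))"
  proof (rule sum_mono)
    fix i assume "i \<in> {..<m}"
    then have i: "i + (m - Suc i) = m - 1" by auto
    have "0 \<le> (y ^ i - y ^ (m - Suc i))\<^sup>2" by simp
    also have "\<dots> = (y\<^sup>2) ^ i + (y\<^sup>2) ^ (m - Suc i) - 2 * (y ^ i * y ^ (m - Suc i))"
      by (simp add: power2_diff mult.commute flip: power_mult)
    also have "y ^ i * y ^ (m - Suc i) = y ^ (m - 1)" by (simp only: i flip: power_add)
    finally show "2 * y ^ (m - 1) \<le> (y\<^sup>2) ^ i + (y\<^sup>2) ^ (m - Suc i)" by simp
  qed
  moreover have "(\<Sum>i<m. (y\<^sup>2) ^ (m - Suc i)) = (\<Sum>i<m. (y\<^sup>2) ^ i)"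
    by (rule sum.nat_diff_reindex)
  ultimately show ?thesis by (simp add: sum.distrib)
qed

text \<open>
  Monsky's argument: if the value at \<open>1\<close> vanished, the Lambert series of \<open>r\<close> would stay bounded
  as \<open>x\<close> tends to \<open>1\<close>, because it differs from a multiple of the vanishing series by a
  series with monotone weights; but its power series has nonnegative coefficients, infinitely
  many of which are at least \<open>1\<close>.
\<close>
lemma real_character_series_nonzero:
  fixes r :: "nat \<Rightarrow> real"
  assumes mult: "\<And>m n. r (m * n) = r m * r n" and one: "r 1 = 1" and val: "\<And>n. r n \<in> {-1, 0, 1}"
    and bounded: "\<And>n. \<bar>\<Sum>k\<le>n. r (Suc k)\<bar> \<le> B"
  shows "\<not> (\<lambda>n. r (Suc n) / real (Suc n)) sums 0"
proof
  assume zero: "(\<lambda>n. r (Suc n) / real (Suc n)) sums 0"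
  have abs_r: "\<bar>r n\<bar> \<le> 1" for n using val[of n] by auto
  have lower: "(\<Sum>j<J. (y\<^sup>2) ^ (4 ^ j)) \<le> B" if y: "0 < y" "y < 1" for y J
  proof -
    \<comment> \<open>A square, so that the geometric mean of 1 and \<open>x ^ (m - 1)\<close> is
      the integral power \<open>y ^ (m - 1)\<close>.\<close>
    define x where "x = y\<^sup>2"
    have x: "0 < x" "x < 1" using y by (simp_all add: x_def power_less_one_iff)
    define s where "s = (\<lambda>m. \<Sum>i<m. x ^ i)"
    have one_minus: "1 - x ^ m = (1 - x) * s m" for m unfolding s_def by (rule one_diff_power_eq)
    have s_pos: "s m > 0" if "m > 0" for m
      unfolding s_def using x that by (intro sum_pos) auto
    \<comment> \<open>The Lambert weight at \<open>Suc n\<close> is subtracted from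
      \<open>1 / (Suc n * (1 - x))\<close>, to which it is asymptotic as \<open>x\<close> tends to
      1. Summed against \<open>r\<close>, the latter gives 0 by the assumption to be
      refuted.\<close>
    define b where "b = (\<lambda>n. 1 / (real (Suc n) * (1 - x)) - x ^ Suc n / (1 - x ^ Suc n))"
    have b_eq: "b n = (1 / real (Suc n) - x ^ Suc n / s (Suc n)) / (1 - x)" for n
      unfolding b_def one_minus by (simp add: diff_divide_distrib mult.commute del: of_nat_Suc power_Suc)
    have b_nonneg: "b n \<ge> 0" for n
    proof -
      have "(\<Sum>i<Suc n. x ^ Suc n) \<le> s (Suc n)"
        unfolding s_def using x by (intro sum_mono power_decreasing) auto
      then have "x ^ Suc n * real (Suc n) \<le> s (Suc n)" by (simp add: mult.commute del: of_nat_Suc power_Suc)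
      then have "x ^ Suc n / s (Suc n) \<le> 1 / real (Suc n)"
        using s_pos[of "Suc n"] by (simp add: divide_simps del: of_nat_Suc power_Suc)
      then show ?thesis using x by (simp add: b_eq del: of_nat_Suc power_Suc)
    qed
    \<comment> \<open>Monotonicity amounts to
      \<open>m * Suc m * x ^ m \<le> s m * s (Suc m)\<close>, which follows from
      \<open>sum_powers_ge\<close> with a factor \<open>y\<close> to spare.\<close>
    have b_mono: "b n \<ge> b (Suc n)" for n
    proof -
      define m where "m = Suc n"
      have sm: "s m > 0" "s (Suc m) > 0" using s_pos by (simp_all add: m_def)
      have "real m * real (Suc m) * x ^ m \<le> (real m * y ^ (m - 1)) * (real (Suc m) * y ^ (Suc m - 1))"
      proof -
        have "x ^ m = y ^ (2 * m)" by (simp add: x_def flip: power_mult)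
        also have "\<dots> \<le> y ^ ((m - 1) + (Suc m - 1))" using y by (intro power_decreasing) auto
        also have "\<dots> = y ^ (m - 1) * y ^ (Suc m - 1)" by (rule power_add)
        finally have "real m * real (Suc m) * x ^ m \<le> real m * real (Suc m) * (y ^ (m - 1) * y ^ (Suc m - 1))"
          by (intro mult_left_mono) auto
        then show ?thesis by (simp only: mult_ac)
      qed
      also have "\<dots> \<le> s m * s (Suc m)"
        using sum_powers_ge[of y m] sum_powers_ge[of y "Suc m"] y
        unfolding s_def x_def by (intro mult_mono) (auto intro!: sum_nonneg)
      finally have "x ^ m / (s m * s (Suc m)) \<le> 1 / (real m * real (Suc m))"
        using sm by (simp add: divide_simps m_def mult_ac del: of_nat_Suc power_Suc)
      moreover have "x ^ m / s m - x ^ Suc m / s (Suc m) = x ^ m / (s m * s (Suc m))"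
      proof -
        have "s (Suc m) = 1 + x * s m" by (simp add: s_def sum.lessThan_Suc_shift sum_distrib_left del: sum.lessThan_Suc)
        then have "x ^ m * s (Suc m) - x ^ Suc m * s m = x ^ m" by (simp add: algebra_simps)
        then show ?thesis using sm by (simp add: divide_simps)
      qed
      moreover have "1 / real m - 1 / real (Suc m) = 1 / (real m * real (Suc m))"
        by (simp add: m_def field_simps)
      ultimately have "1 / real (Suc m) - x ^ Suc m / s (Suc m) \<le> 1 / real m - x ^ m / s m" by linarith
      then show ?thesis using x unfolding b_eq m_def by (intro divide_right_mono) auto
    qed
    have b0: "b 0 = 1" using x by (simp add: b_def field_simps)
    \<comment> \<open>Abel summation: \<open>b\<close> decreases from \<open>b 0 = 1\<close> and
      stays nonnegative, so the bound on the partial sums of \<open>r\<close> is inherited.\<close>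
    have partial: "\<bar>\<Sum>n<Suc N. r (Suc n) * b n\<bar> \<le> B" for N
    proof -
      have "\<bar>\<Sum>n<Suc N. r (Suc n) * b n\<bar> \<le>
          (\<Sum>n<Suc N. \<bar>(\<Sum>k\<le>n. r (Suc k)) * (b n - b (Suc n))\<bar>) + \<bar>(\<Sum>k\<le>N. r (Suc k)) * b (Suc N)\<bar>"
        by (subst sum_by_parts, rule order_trans[OF abs_triangle_ineq add_right_mono[OF sum_abs]])
      also have "\<dots> \<le> (\<Sum>n<Suc N. B * (b n - b (Suc n))) + B * b (Suc N)"
        using b_mono b_nonneg bounded unfolding abs_mult
        by (intro add_mono sum_mono mult_mono) (auto intro: order_trans[OF abs_ge_zero bounded])
      also have "(\<Sum>n<Suc N. B * (b n - b (Suc n))) = B * (b 0 - b (Suc N))"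
        by (simp only: flip: sum_distrib_left sum_lessThan_telescope')
      finally show ?thesis using b0 by (simp add: algebra_simps)
    qed
    define g where "g = (\<lambda>n. r n * (x ^ n / (1 - x ^ n)))"
    have g_le: "\<bar>g n\<bar> \<le> x ^ n / (1 - x)" if "n > 0" for n
    proof -
      have "x ^ n \<le> x" using power_decreasing[of 1 n x] x that by simp
      then have le: "x ^ n / (1 - x ^ n) \<le> x ^ n / (1 - x)" using x by (intro divide_left_mono mult_pos_pos) auto
      have nn: "0 \<le> x ^ n / (1 - x ^ n)" using x \<open>x ^ n \<le> x\<close> by auto
      show ?thesis
        unfolding g_def abs_mult abs_of_nonneg[OF nn]
        using mult_mono[OF abs_r[of n] le zero_le_one nn] by (simp only: mult_1_left)
    qed
    have summ_bound: "summable (\<lambda>n. x ^ n / (1 - x))" using x by (intro summable_divide summable_geometric) auto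
    have g0: "g 0 = 0" by (simp add: g_def)
    have summ_g: "summable (\<lambda>n. \<bar>g n\<bar>)"
      by (rule summable_comparison_test'[OF summ_bound, of 1]) (use g_le in auto)
    define A where "A = (\<Sum>n. g n)"
    have g_sums: "g sums A" unfolding A_def by (rule summable_sums[OF summable_rabs_cancel[OF summ_g]])
    then have "(\<lambda>n. g (Suc n)) sums A" using sums_Suc_iff[of g A] g0 by simp
    then have "(\<lambda>n. r (Suc n) / real (Suc n) * (1 / (1 - x)) - g (Suc n)) sums (0 * (1 / (1 - x)) - A)"
      by (intro sums_diff sums_mult2 zero)
    moreover have "r (Suc n) / real (Suc n) * (1 / (1 - x)) - g (Suc n) = r (Suc n) * b n" for n
      by (simp add: g_def b_def right_diff_distrib)
    ultimately have "(\<lambda>n. r (Suc n) * b n) sums - A" by simp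
    then have "(\<lambda>N. \<Sum>n<Suc N. r (Suc n) * b n) \<longlonglongrightarrow> - A" unfolding sums_def by (rule LIMSEQ_Suc)
    then have "\<bar>- A\<bar> \<le> B" by (rule LIMSEQ_le_const2[OF tendsto_rabs]) (use partial in blast)
    define h where "h = (\<lambda>n k. if k = 0 then 0 else (x ^ n) ^ k)"
    have h: "(h n has_sum (x ^ n / (1 - x ^ n))) UNIV" if "n > 0" for n
    proof (rule sums_nonneg_imp_has_sum)
      have xn: "0 < x ^ n" "x ^ n < 1" using x that by (simp_all add: power_less_one_iff)
      have "(\<lambda>k. x ^ n * (x ^ n) ^ k) sums (x ^ n * (1 / (1 - x ^ n)))"
        using xn by (intro sums_mult geometric_sums) auto
      then have "(\<lambda>k. h n (Suc k)) sums (x ^ n / (1 - x ^ n))" by (simp add: h_def)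
      moreover have "h n 0 = 0" by (simp add: h_def)
      ultimately show "h n sums (x ^ n / (1 - x ^ n))" using sums_Suc_iff[of "h n" "x ^ n / (1 - x ^ n)"] by simp
      show "h n k \<ge> 0" for k using x by (simp add: h_def)
    qed
    \<comment> \<open>The geometric expansion of every Lambert term. Collecting equal exponents
      \<open>n * k = N\<close> yields a power series in \<open>x\<close> whose coefficients are the
      divisor sums of \<open>r\<close>.\<close>
    define f where "f = (\<lambda>(n, k). if n = 0 then 0 else r n * h n k)"
    have f_row: "((\<lambda>k. f (n, k)) has_sum g n) UNIV" for n
      using has_sum_cmult_right[OF h[of n], of "r n"] g0 by (cases "n = 0") (auto simp: f_def g_def)
    have "(\<lambda>p. \<bar>f p\<bar>) summable_on (UNIV \<times> UNIV)"
    proof (rule summable_on_SigmaI)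
      show "((\<lambda>k. \<bar>f (n, k)\<bar>) has_sum \<bar>g n\<bar>) UNIV" for n
      proof (cases "n = 0")
        case False
        then have "x ^ n < 1" using x by (simp add: power_less_one_iff)
        then have "\<bar>g n\<bar> = \<bar>r n\<bar> * (x ^ n / (1 - x ^ n))" using x by (simp add: g_def abs_mult)
        moreover have "\<bar>f (n, k)\<bar> = \<bar>r n\<bar> * h n k" for k using x False by (simp add: f_def h_def abs_mult)
        ultimately show ?thesis using has_sum_cmult_right[OF h[of n], of "\<bar>r n\<bar>"] False by simp
      qed (use g0 in \<open>simp add: f_def\<close>)
      show "(\<lambda>n. \<bar>g n\<bar>) summable_on UNIV"
        using summ_g by (subst summable_on_UNIV_nonneg_real_iff) auto
    qed auto
    then have "f summable_on (UNIV \<times> UNIV)" by (rule abs_summable_summable[of f, unfolded real_norm_def])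
    moreover have "(g has_sum A) UNIV" using norm_summable_imp_has_sum[of g A] summ_g g_sums by simp
    ultimately have "(f has_sum A) (UNIV \<times> UNIV)" using has_sum_SigmaI[OF f_row] by blast
    then have hs: "((\<lambda>N. \<Sum>d | d dvd N. f (N div d, d)) has_sum A) {1..}"
      by (rule has_sum_divisors) (auto simp: f_def h_def)
    have coeff: "(\<Sum>d | d dvd N. f (N div d, d)) = (\<Sum>d | d dvd N. r d) * x ^ N" if "N \<in> {1..}" for N
    proof -
      have "(\<Sum>d | d dvd N. f (N div d, d)) = (\<Sum>d | d dvd N. r (N div d) * x ^ N)"
      proof (intro sum.cong refl)
        fix d assume "d \<in> {d. d dvd N}"
        then show "f (N div d, d) = r (N div d) * x ^ N"
          using that by (auto simp: f_def h_def dvd_div_eq_0_iff simp flip: power_mult)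
      qed
      also have "\<dots> = (\<Sum>d | d dvd N. r d * x ^ N)"
        by (rule sum.reindex_bij_witness[of _ "\<lambda>d. N div d" "\<lambda>d. N div d"]) (use that in \<open>auto simp: div_div_eq_right\<close>)
      finally show ?thesis by (simp add: sum_distrib_right)
    qed
    have nonneg: "(\<Sum>d | d dvd N. r d) \<ge> 0" if "N \<in> {1..}" for N
      using sum_divisors_real_character_nonneg[OF mult one val] that by auto
    have inj: "inj_on (\<lambda>j. (4::nat) ^ j) {..<J}" by (auto intro!: inj_onI)
    \<comment> \<open>The exponent of 2 in \<open>4 ^ j\<close> is even, so the divisor sum is at
      least 1 whatever the value of \<open>r 2\<close>.\<close>
    have ge1: "(\<Sum>d | d dvd (4::nat) ^ j. r d) \<ge> 1" for j
    proof -
      have "(4::nat) ^ j = 2 ^ (2 * j) * 1" by (simp add: power_mult)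
      then show ?thesis
        using sum_divisors_prime_power_mult[OF mult one, of 2 1 "2 * j"] sum_powers_sign(2)[OF val[of 2], of "2 * j"] one
        by simp
    qed
    have "(\<Sum>j<J. x ^ (4 ^ j)) \<le> (\<Sum>j<J. (\<Sum>d | d dvd (4::nat) ^ j. r d) * x ^ (4 ^ j))"
      using x ge1 by (intro sum_mono) (simp add: mult_le_cancel_right1)
    also have "\<dots> = (\<Sum>j<J. (\<Sum>d | d dvd (4::nat) ^ j. f (4 ^ j div d, d)))"
      by (intro sum.cong refl coeff[symmetric]) simp
    also have "\<dots> = (\<Sum>N\<in>(\<lambda>j. 4 ^ j) ` {..<J}. \<Sum>d | d dvd N. f (N div d, d))"
      by (simp add: sum.reindex[OF inj])
    also have "\<dots> \<le> A"
    proof (rule finite_sum_le_has_sum[OF hs])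
      show "(\<Sum>d | d dvd N. f (N div d, d)) \<ge> 0" if "N \<in> {1..} - (\<lambda>j. 4 ^ j) ` {..<J}" for N
        using coeff[of N] nonneg[of N] that x by simp
    qed auto
    also have "A \<le> B" using \<open>\<bar>- A\<bar> \<le> B\<close> by simp
    finally show ?thesis by (simp only: x_def)
  qed
  \<comment> \<open>More than \<open>B\<close> terms, each of which tends to 1 with
    \<open>y\<close>.\<close>
  define J where "J = nat \<lceil>B\<rceil> + 1"
  have "((\<lambda>y. \<Sum>j<J. (y\<^sup>2) ^ (4 ^ j)) \<longlongrightarrow> (\<Sum>j<J. (1\<^sup>2) ^ (4 ^ j))) (at_left (1::real))"
    by (intro tendsto_intros)
  moreover have "eventually (\<lambda>y. y \<in> {0<..<1}) (at_left (1::real))"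
    by (rule eventually_at_left_real) simp
  then have "eventually (\<lambda>y. (\<Sum>j<J. (y\<^sup>2) ^ (4 ^ j)) \<le> B) (at_left (1::real))"
    by (rule eventually_mono) (use lower in auto)
  ultimately have "(\<Sum>j<J. (1\<^sup>2) ^ (4 ^ j)) \<le> B"
    by (rule tendsto_upperbound) (simp add: trivial_limit_at_left_real)
  then show False unfolding J_def by simp linarith
qed

lemma norm_antimono_of_log_deriv:
  fixes Z E :: "complex \<Rightarrow> complex"
  assumes ab: "a \<le> b"
    and deriv: "\<And>x. a \<le> x \<Longrightarrow> x \<le> b \<Longrightarrow> (Z has_field_derivative - Z (of_real x) * E (of_real x)) (at (of_real x))"
    and E: "\<And>x. a \<le> x \<Longrightarrow> x \<le> b \<Longrightarrow> Re (E (of_real x)) \<ge> 0"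
  shows "norm (Z (of_real b)) \<le> norm (Z (of_real a))"
proof -
  define U where "U = (\<lambda>x. Re (Z (of_real x)))"
  define V where "V = (\<lambda>x. Im (Z (of_real x)))"
  \<comment> \<open>The squared modulus has derivative
    \<open>- 2 * g x * Re (E (of_real x))\<close>, and working with it avoids a logarithm of
    \<open>Z\<close>.\<close>
  define g where "g = (\<lambda>x. (U x)\<^sup>2 + (V x)\<^sup>2)"
  have "g b \<le> g a"
  proof (rule DERIV_nonpos_imp_nonincreasing[OF ab])
    fix x assume x: "a \<le> x" "x \<le> b"
    define D where "D = - Z (of_real x) * E (of_real x)"
    have v: "((\<lambda>x. Z (of_real x)) has_vector_derivative D) (at x)"
      unfolding D_def by (rule has_vector_derivative_real_field[OF deriv[OF x]])
    have UV: "(U has_real_derivative Re D) (at x)" "(V has_real_derivative Im D) (at x)"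
      unfolding U_def V_def
      using bounded_linear.has_vector_derivative[OF bounded_linear_Re v]
        bounded_linear.has_vector_derivative[OF bounded_linear_Im v]
      by (simp_all add: has_real_derivative_iff_has_vector_derivative)
    have "(g has_real_derivative 2 * U x * Re D + 2 * V x * Im D) (at x)"
      unfolding g_def by (rule derivative_eq_intros UV refl)+ simp
    moreover have "2 * U x * Re D + 2 * V x * Im D = - 2 * g x * Re (E (of_real x))"
      by (simp add: D_def g_def U_def V_def power2_eq_square algebra_simps)
    moreover have "- 2 * g x * Re (E (of_real x)) \<le> 0"
    proof -
      have "g x \<ge> 0" by (simp add: g_def)
      from mult_nonneg_nonneg[OF this E[OF x]] show ?thesis by linarith
    qed
    ultimately show "\<exists>y. (g has_real_derivative y) (at x) \<and> y \<le> 0" by metis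
  qed
  then show ?thesis by (simp add: g_def U_def V_def cmod_def)
qed

text \<open>With \<open>w\<close> equal to \<open>chi\<close> at n times n^(-it), each term is a
  nonnegative multiple of \<open>3 + 4 * w + w\<^sup>2\<close>, whose real part is
  \<open>2 * (1 + Re w)\<^sup>2\<close> on the unit circle. For n not prime to \<open>q\<close> all
  three contributions vanish.\<close>

lemma trig_combination_nonneg:
  assumes chi: "dirichlet_character q chi" and x: "x > 1"
  shows "Re (3 * mangoldt_series (principal_character q) (of_real x)
    + 4 * mangoldt_series chi (of_real x + \<i> * of_real t)
    + dirichlet_series (mangoldt_coeff (\<lambda>n. chi n * chi n)) (of_real x + \<i> * of_real (2 * t))) \<ge> 0"
proof -
  have q: "q > 0" by (rule dirichlet_character_pos[OF chi])
  have sums: "(\<lambda>n. mangoldt_coeff psi n / of_nat (Suc n) powr s) sums dirichlet_series (mangoldt_coeff psi) s"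
    if "dirichlet_character q psi" "Re s > 1" for psi s
    using subpolynomial_series_sums[OF subpolynomial_mangoldt_coeff[OF that(1)] that(2)] .
  define u where "u = (\<lambda>n. 3 * (mangoldt_coeff (principal_character q) n / of_nat (Suc n) powr of_real x)
    + 4 * (mangoldt_coeff chi n / of_nat (Suc n) powr (of_real x + \<i> * of_real t))
    + mangoldt_coeff (\<lambda>n. chi n * chi n) n / of_nat (Suc n) powr (of_real x + \<i> * of_real (2 * t)))"
  have s0: "Re (of_real x) > 1" "Re (of_real x + \<i> * of_real t) > 1" "Re (of_real x + \<i> * of_real (2 * t)) > 1"
    using x by simp_all
  have hs: "u sums (3 * mangoldt_series (principal_character q) (of_real x)
    + 4 * mangoldt_series chi (of_real x + \<i> * of_real t)
    + dirichlet_series (mangoldt_coeff (\<lambda>n. chi n * chi n)) (of_real x + \<i> * of_real (2 * t)))"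
    unfolding u_def
    by (rule sums_add[OF sums_add[OF sums_mult[OF sums[OF dirichlet_character_principal[OF q] s0(1)]]
      sums_mult[OF sums[OF chi s0(2)]]] sums[OF dirichlet_character_times[OF chi chi] s0(3)]])
  have nonneg: "Re (u n) \<ge> 0" for n
  proof -
    define N where "N = complex_of_nat (Suc n)"
    have N: "N \<noteq> 0" unfolding N_def by (rule of_nat_neq_0)
    define c where "c = chi (int (Suc n))"
    define w where "w = c / N powr (\<i> * of_real t)"
    define l :: real where "l = mangoldt (Suc n) * real (Suc n) powr - x"
    have l: "l \<ge> 0" by (simp add: l_def mangoldt_nonneg)
    have Nx: "inverse (N powr of_real x) = of_real (real (Suc n) powr - x)"
    proof -
      have "N = of_real (real (Suc n))" unfolding N_def by (rule of_real_of_nat_eq[symmetric])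
      then have "N powr of_real x = of_real (real (Suc n) powr x)" by (simp only: powr_of_real of_nat_0_le_iff)
      then show ?thesis by (simp only: powr_minus of_real_inverse)
    qed
    have lam: "complex_of_real l = mangoldt (Suc n) * inverse (N powr of_real x)"
      unfolding l_def Nx by simp
    have p1: "N powr (of_real x + \<i> * of_real t) = N powr of_real x * N powr (\<i> * of_real t)"
      by (rule powr_add)
    have p2: "N powr (of_real x + \<i> * of_real (2 * t)) = N powr of_real x * (N powr (\<i> * of_real t))\<^sup>2"
    proof -
      have "\<i> * complex_of_real (2 * t) = \<i> * of_real t + \<i> * of_real t" by simp
      then show ?thesis by (simp only: powr_add power2_eq_square)
    qed
    have u_eq: "u n = of_real l * (3 * principal_character q (int (Suc n)) + 4 * w + w\<^sup>2)"
    proof -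
      have combine: "3 * (c0 * L / A) + 4 * (c * L / (A * B)) + c * c * L / (A * B\<^sup>2) =
          L * inverse A * (3 * c0 + 4 * (c / B) + (c / B)\<^sup>2)" for c0 c L A B :: complex
        by (simp add: divide_inverse power2_eq_square ring_distribs mult_ac)
      show ?thesis
        unfolding u_def lam w_def N_def[symmetric] c_def[symmetric] p1 p2 by (rule combine)
    qed
    show ?thesis
    proof (cases "coprime (int (Suc n)) (int q)")
      case True
      have "norm (N powr (\<i> * of_real t)) = 1"
        unfolding N_def norm_nat_powr by simp
      then have "norm w = 1"
        using norm_dirichlet_character[OF chi, of "int (Suc n)"] True by (simp add: w_def c_def norm_divide)
      then have "(Re w)\<^sup>2 + (Im w)\<^sup>2 = 1" by (simp add: cmod_def)
      then have "Re (3 + 4 * w + w\<^sup>2) = 2 * (1 + Re w)\<^sup>2"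
        by (simp add: power2_eq_square algebra_simps)
      then have "Re (u n) = l * (2 * (1 + Re w)\<^sup>2)"
        using True by (simp add: u_eq principal_character_def del: of_nat_Suc)
      then show ?thesis using l by simp
    next
      case False
      then have "w = 0" using dirichlet_character_nonzero_iff[OF chi, of "int (Suc n)"] by (simp add: w_def c_def)
      then show ?thesis using False by (simp add: u_eq principal_character_def del: of_nat_Suc)
    qed
  qed
  show ?thesis by (rule sums_le[OF nonneg sums_zero sums_Re[OF hs]])
qed

text \<open>The first zero of this factor off the real axis has height
  \<open>2 * pi / ln 2 > 2\<close>. Heights up to 2 occur because the square of \<open>chi\<close>
  is taken at height \<open>2 * t\<close> with \<open>t\<close> of size at most 1.\<close>

lemma alternating_series_nonzero_factor:
  assumes "t \<noteq> 0" "\<bar>t\<bar> \<le> 2"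
  shows "1 - 2 powr (1 - (1 + \<i> * of_real t)) \<noteq> (0::complex)"
proof
  assume "1 - 2 powr (1 - (1 + \<i> * of_real t)) = (0::complex)"
  then have "exp (- (\<i> * of_real t) * Ln 2) = 1" by (simp add: powr_def)
  moreover have "Ln 2 = complex_of_real (ln 2)" using Ln_of_real[of 2] by simp
  ultimately have "exp (- (\<i> * of_real t) * of_real (ln 2)) = 1" by metis
  then obtain n :: int where n: "- t * ln 2 = of_int (2 * n) * pi" unfolding exp_eq_1 by auto
  have ln2: "0 < ln (2::real)" "ln (2::real) < 1" using ln_less_self[of 2] ln_2_less_1 by simp_all
  have "n \<noteq> 0" using n assms(1) ln2 by auto
  then have "1 \<le> \<bar>real_of_int n\<bar>" by linarith
  then have "2 * pi \<le> \<bar>of_int (2 * n) * pi\<bar>" using pi_gt_zero by (simp add: abs_mult)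
  also have "\<dots> = \<bar>t\<bar> * ln 2" using n[symmetric] ln2 by (simp add: abs_mult)
  also have "\<dots> \<le> 2 * 1" using assms(2) ln2 by (intro mult_mono) auto
  finally show False using pi_ge_two by simp
qed

lemma norm_char_series_le:
  assumes chi: "dirichlet_character q chi" and s: "Re s > 1"
  shows "norm (char_series chi s) \<le> 1 + 1 / (Re s - 1)"
proof -
  have summ: "summable (\<lambda>n. real (Suc n) powr - (1 + (Re s - 1)))" using s by (intro summable_Suc_powr) simp
  have "norm (char_coeff chi n / of_nat (Suc n) powr s) \<le> real (Suc n) powr - (1 + (Re s - 1))" for n
  proof -
    have "norm (char_coeff chi n / of_nat (Suc n) powr s) = norm (char_coeff chi n) * real (Suc n) powr - Re s"
      by (simp add: divide_inverse norm_mult norm_inverse norm_nat_powr powr_minus del: of_nat_Suc)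
    also have "\<dots> \<le> 1 * real (Suc n) powr - Re s"
      by (intro mult_right_mono norm_dirichlet_character_le[OF chi]) simp
    finally show ?thesis by simp
  qed
  then have "norm (char_series chi s) \<le> (\<Sum>n. real (Suc n) powr - (1 + (Re s - 1)))"
    unfolding dirichlet_series_def by (rule norm_suminf_le[OF _ summ])
  also have "\<dots> \<le> 1 + 1 / (Re s - 1)" using s by (intro suminf_Suc_powr_le) simp
  finally show ?thesis .
qed

lemma tendsto_horizontal:
  assumes "isCont f (1 + \<i> * of_real t)"
  shows "((\<lambda>x. f (of_real x + \<i> * of_real t)) \<longlongrightarrow> f (1 + \<i> * of_real t)) (at_right (1::real))"
proof (rule isCont_tendsto_compose[OF assms])
  have "((\<lambda>x. complex_of_real x + \<i> * of_real t) \<longlongrightarrow> of_real 1 + \<i> * of_real t) (at_right 1)"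
    by (intro tendsto_intros)
  then show "((\<lambda>x. complex_of_real x + \<i> * of_real t) \<longlongrightarrow> 1 + \<i> * of_real t) (at_right 1)" by simp
qed

text \<open>A finite limit at the line is all that is required of the factor that belongs to the
  square of a character. For a principal character off the real axis it comes from the alternating
  series.\<close>

lemma char_series_limit:
  assumes chi: "dirichlet_character q chi" and t: "\<bar>t\<bar> \<le> 2"
    and nontriv: "chi \<noteq> principal_character q \<or> t \<noteq> 0"
  shows "\<exists>l. ((\<lambda>x. char_series chi (of_real x + \<i> * of_real t)) \<longlongrightarrow> l) (at_right 1)"
proof (cases "chi = principal_character q")
  case False
  have "isCont (char_series chi) (1 + \<i> * of_real t)"
    using holomorphic_dirichlet_series[OF norm_sum_char_coeff_le[OF chi False]]
    by (intro continuous_on_interior[OF holomorphic_on_imp_continuous_on])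
      (auto simp: interior_open open_halfspace_Re_gt)
  then show ?thesis using tendsto_horizontal by blast
next
  case True
  then have t0: "t \<noteq> 0" using nontriv by simp
  define D where "D = dirichlet_series (alternating_coeff chi)"
  define u where "u = (\<lambda>s. 1 - 2 powr (1 - s) :: complex)"
  have "isCont D (1 + \<i> * of_real t)"
    unfolding D_def using holomorphic_dirichlet_series[OF norm_sum_alternating_coeff_le[OF chi]]
    by (intro continuous_on_interior[OF holomorphic_on_imp_continuous_on])
      (auto simp: interior_open open_halfspace_Re_gt)
  then have D: "((\<lambda>x. D (of_real x + \<i> * of_real t)) \<longlongrightarrow> D (1 + \<i> * of_real t)) (at_right 1)"
    by (rule tendsto_horizontal)
  have "isCont u (1 + \<i> * of_real t)" unfolding u_def by (intro continuous_intros) auto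
  then have u: "((\<lambda>x. u (of_real x + \<i> * of_real t)) \<longlongrightarrow> u (1 + \<i> * of_real t)) (at_right 1)"
    by (rule tendsto_horizontal)
  have "u (1 + \<i> * of_real t) \<noteq> 0" unfolding u_def by (rule alternating_series_nonzero_factor[OF t0 t])
  from tendsto_divide[OF D u this]
  have lim: "((\<lambda>x. D (of_real x + \<i> * of_real t) / u (of_real x + \<i> * of_real t)) \<longlongrightarrow>
      D (1 + \<i> * of_real t) / u (1 + \<i> * of_real t)) (at_right 1)" .
  have eq: "D (of_real x + \<i> * of_real t) / u (of_real x + \<i> * of_real t) =
      char_series chi (of_real x + \<i> * of_real t)" if "x > 1" for x
  proof -
    define s where "s = of_real x + \<i> * complex_of_real t"
    have s: "Re s > 1" using that by (simp add: s_def)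
    have "norm (2 powr (1 - s)) < 1"
    proof -
      have "norm (complex_of_real 2 powr (1 - s)) = 2 powr Re (1 - s)"
        by (subst norm_powr_real_powr) auto
      also have "\<dots> < 2 powr 0" using s by (intro powr_less_mono) auto
      finally show ?thesis by simp
    qed
    then have "u s \<noteq> 0" by (auto simp: u_def)
    moreover have "D s = u s * char_series chi s"
      unfolding D_def u_def by (rule dirichlet_series_alternating[OF chi s char_series_sums[OF chi s]])
    ultimately show ?thesis unfolding s_def by simp
  qed
  have "eventually (\<lambda>x. D (of_real x + \<i> * of_real t) / u (of_real x + \<i> * of_real t) =
      char_series chi (of_real x + \<i> * of_real t)) (at_right (1::real))"
    by (intro eventually_mono[OF eventually_at_right_less] eq)
  with lim show ?thesis by (auto simp: tendsto_cong)
qed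

text \<open>
  The classical combination of \<open>3\<close>, \<open>4\<close> and \<open>1\<close>: the modulus of the product of the
  three \<open>L\<close>-functions is nonincreasing to the right of \<open>1\<close>, so it cannot tend to \<open>0\<close> there.
\<close>
lemma char_series_nonzero_one_line:
  assumes chi: "dirichlet_character q chi" "chi \<noteq> principal_character q" and t: "\<bar>t\<bar> \<le> 1"
    and nontriv: "(\<lambda>n. chi n * chi n) \<noteq> principal_character q \<or> t \<noteq> 0"
  shows "char_series chi (1 + \<i> * of_real t) \<noteq> 0"
proof
  assume zero: "char_series chi (1 + \<i> * of_real t) = 0"
  define chi0 where "chi0 = principal_character q"
  define chi2 where "chi2 = (\<lambda>n. chi n * chi n)"
  have q: "q > 0" by (rule dirichlet_character_pos[OF chi(1)])
  have chi0: "dirichlet_character q chi0" unfolding chi0_def by (rule dirichlet_character_principal[OF q])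
  have chi2: "dirichlet_character q chi2" unfolding chi2_def by (rule dirichlet_character_times[OF chi(1) chi(1)])
  define L0 where "L0 = char_series chi0"
  define L1 where "L1 = char_series chi"
  define L2 where "L2 = char_series chi2"
  define M0 where "M0 = mangoldt_series chi0"
  define M1 where "M1 = mangoldt_series chi"
  define M2 where "M2 = mangoldt_series chi2"
  define a where "a = \<i> * complex_of_real t"
  define b where "b = \<i> * complex_of_real (2 * t)"
  have Re_ab: "Re a = 0" "Re b = 0" by (simp_all add: a_def b_def)
  define Z where "Z = (\<lambda>s. L0 s ^ 3 * L1 (s + a) ^ 4 * L2 (s + b))"
  define E where "E = (\<lambda>s. 3 * M0 s + 4 * M1 (s + a) + M2 (s + b))"
  have Z_deriv: "(Z has_field_derivative - Z s * E s) (at s)" if s: "Re s > 1" for s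
  proof -
    have d0: "(L0 has_field_derivative - L0 s * M0 s) (at s)"
      unfolding L0_def M0_def by (rule has_field_derivative_char_series[OF chi0 s])
    have d1: "(L1 has_field_derivative - L1 (s + a) * M1 (s + a)) (at (s + a))"
      unfolding L1_def M1_def using s Re_ab by (intro has_field_derivative_char_series[OF chi(1)]) simp
    have d2: "(L2 has_field_derivative - L2 (s + b) * M2 (s + b)) (at (s + b))"
      unfolding L2_def M2_def using s Re_ab by (intro has_field_derivative_char_series[OF chi2]) simp
    have d1': "((\<lambda>s. L1 (s + a)) has_field_derivative - L1 (s + a) * M1 (s + a)) (at s)"
      using d1 by (simp add: DERIV_shift)
    have d2': "((\<lambda>s. L2 (s + b)) has_field_derivative - L2 (s + b) * M2 (s + b)) (at s)"
      using d2 by (simp add: DERIV_shift)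
    show ?thesis
      unfolding Z_def E_def
      by (rule derivative_eq_intros d0 d1' d2' refl)+
        (simp add: algebra_simps power2_eq_square power3_eq_cube power4_eq_xxxx)
  qed
  have lower: "norm (Z 2) \<le> norm (Z (of_real x))" if x: "1 < x" "x \<le> 2" for x
  proof -
    have "norm (Z (of_real 2)) \<le> norm (Z (of_real x))"
    proof (rule norm_antimono_of_log_deriv[where E = E])
      show "(Z has_field_derivative - Z (of_real y) * E (of_real y)) (at (of_real y))" if "x \<le> y" for y
        using that x by (intro Z_deriv) simp
      show "Re (E (of_real y)) \<ge> 0" if "x \<le> y" for y
        using trig_combination_nonneg[OF chi(1), of y t] that x
        by (simp only: E_def M0_def M1_def M2_def chi0_def chi2_def a_def b_def)
    qed (use x in simp)
    then show ?thesis by simp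
  qed
  have "norm (L0 2) \<ge> 1 / 4" unfolding L0_def by (rule norm_char_series_ge[OF chi0]) simp
  moreover have "norm (L1 (2 + a)) \<ge> 1 / 4"
    unfolding L1_def using Re_ab by (intro norm_char_series_ge[OF chi(1)]) simp
  moreover have "norm (L2 (2 + b)) \<ge> 1 / 4"
    unfolding L2_def using Re_ab by (intro norm_char_series_ge[OF chi2]) simp
  ultimately have Z2: "norm (Z 2) > 0" by (auto simp: Z_def)
  have "\<exists>l. ((\<lambda>x. L2 (of_real x + b)) \<longlongrightarrow> l) (at_right 1)"
    unfolding L2_def b_def by (rule char_series_limit[OF chi2]) (use t nontriv in \<open>auto simp: chi2_def\<close>)
  then obtain l2 where l2: "((\<lambda>x. L2 (of_real x + b)) \<longlongrightarrow> l2) (at_right 1)" by blast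
  have "L1 field_differentiable (at (1 + a))"
    unfolding L1_def
    by (rule holomorphic_on_imp_differentiable_at[OF holomorphic_dirichlet_series[OF norm_sum_char_coeff_le[OF chi]]])
      (simp_all add: open_halfspace_Re_gt Re_ab)
  then obtain D where D: "(L1 has_field_derivative D) (at (1 + a))" unfolding field_differentiable_def by blast
  have quot: "((\<lambda>x. L1 (of_real x + a) / (of_real x - 1)) \<longlongrightarrow> D) (at_right (1::real))"
  proof -
    have "((\<lambda>s. (L1 s - L1 (1 + a)) / (s - (1 + a))) \<longlongrightarrow> D) (at (1 + a))"
      using D by (simp add: has_field_derivative_iff)
    moreover have "filterlim (\<lambda>x. complex_of_real x + a) (at (1 + a)) (at_right 1)"
      unfolding filterlim_at
    proof
      show "eventually (\<lambda>x. complex_of_real x + a \<in> UNIV \<and> complex_of_real x + a \<noteq> 1 + a) (at_right 1)"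
        by (rule eventually_mono[OF eventually_at_right_less[of 1]]) simp
      have "((\<lambda>x. complex_of_real x + a) \<longlongrightarrow> of_real 1 + a) (at_right 1)" by (intro tendsto_intros)
      then show "((\<lambda>x. complex_of_real x + a) \<longlongrightarrow> 1 + a) (at_right 1)" by simp
    qed
    ultimately have "((\<lambda>x. (L1 (of_real x + a) - L1 (1 + a)) / (of_real x + a - (1 + a))) \<longlongrightarrow> D) (at_right 1)"
      by (rule filterlim_compose)
    moreover have "L1 (1 + a) = 0" using zero by (simp add: L1_def a_def)
    ultimately show ?thesis by simp
  qed
  \<comment> \<open>\<open>L0 ^ 3\<close> grows at most like the inverse cube of
    \<open>x - 1\<close>, while the assumed zero makes \<open>L1 ^ 4\<close> of order
    \<open>(x - 1) ^ 4\<close>; one factor \<open>x - 1\<close> is left over.\<close>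
  have le: "norm (Z 2) \<le> 2 ^ 3 * norm (L1 (of_real x + a) / (of_real x - 1)) ^ 4 * norm (L2 (of_real x + b)) * (x - 1)"
    if x: "x \<in> {1<..<2}" for x :: real
  proof -
    have "norm (L0 (of_real x)) \<le> 1 + 1 / (x - 1)"
      using norm_char_series_le[OF chi0, of "of_real x"] x by (simp add: L0_def)
    also have "1 + 1 / (x - 1) = x / (x - 1)" using x by (simp add: divide_simps)
    also have "\<dots> \<le> 2 / (x - 1)" using x by (intro divide_right_mono) auto
    finally have "norm (L0 (of_real x)) ^ 3 \<le> (2 / (x - 1)) ^ 3" by (intro power_mono) auto
    then have "norm (Z (of_real x)) \<le> (2 / (x - 1)) ^ 3 * norm (L1 (of_real x + a)) ^ 4 * norm (L2 (of_real x + b))"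
      unfolding Z_def norm_mult norm_power by (intro mult_right_mono) auto
    moreover have "norm (complex_of_real x - 1) = x - 1"
      using x by (metis greaterThanLessThan_iff less_imp_le abs_of_nonneg diff_ge_0_iff_ge norm_of_real of_real_1 of_real_diff)
    moreover have "(2 / d) ^ 3 * u ^ 4 * v = 2 ^ 3 * (u / d) ^ 4 * v * d" if "d > 0" for u v d :: real
      using that by (simp add: power3_eq_cube power4_eq_xxxx divide_simps)
    from this[of "x - 1"] have "(2 / (x - 1)) ^ 3 * u ^ 4 * v = 2 ^ 3 * (u / (x - 1)) ^ 4 * v * (x - 1)" for u v
      using x by simp
    ultimately show ?thesis using lower[of x] x by (simp add: norm_divide)
  qed
  have "((\<lambda>x. 2 ^ 3 * norm (L1 (of_real x + a) / (of_real x - 1)) ^ 4 * norm (L2 (of_real x + b)) * (x - 1))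
      \<longlongrightarrow> 2 ^ 3 * norm D ^ 4 * norm l2 * (1 - 1)) (at_right (1::real))"
    by (intro tendsto_intros quot l2)
  then have "norm (Z 2) \<le> 2 ^ 3 * norm D ^ 4 * norm l2 * (1 - 1)"
  proof (rule tendsto_lowerbound)
    have "eventually (\<lambda>x. x \<in> {1<..<2}) (at_right (1::real))" by (rule eventually_at_right_real) simp
    then show "eventually (\<lambda>x. norm (Z 2) \<le> 2 ^ 3 * norm (L1 (of_real x + a) / (of_real x - 1)) ^ 4 * norm (L2 (of_real x + b)) * (x - 1)) (at_right (1::real))"
      by (rule eventually_mono) (rule le)
  qed simp
  then show False using Z2 by simp
qed

text \<open>The case excluded from \<open>char_series_nonzero_one_line\<close>: there the square of
  \<open>chi\<close> would contribute a pole at 1 that consumes the spare factor.\<close>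

lemma char_series_nonzero_real:
  assumes chi: "dirichlet_character q chi" "chi \<noteq> principal_character q"
    and real: "(\<lambda>n. chi n * chi n) = principal_character q"
  shows "char_series chi 1 \<noteq> 0"
proof
  assume zero: "char_series chi 1 = 0"
  define r where "r = (\<lambda>n. Re (chi (int n)))"
  have "chi n \<in> {-1, 0, 1}" for n
  proof -
    have "(chi n)\<^sup>2 = 1 \<or> (chi n)\<^sup>2 = 0"
      using fun_cong[OF real, of n] by (auto simp: principal_character_def power2_eq_square split: if_splits)
    then show ?thesis by (auto simp: power2_eq_1_iff)
  qed
  then have val: "r n \<in> {-1, 0, 1}" "chi (int n) = of_real (r n)" for n
    unfolding r_def by (metis insert_iff singletonD uminus_complex.simps(1) zero_complex.simps(1) one_complex.simps(1),
      metis (no_types, lifting) insert_iff singletonD of_real_0 of_real_1 of_real_minus uminus_complex.simps(1) zero_complex.simps(1) one_complex.simps(1))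
  have "\<not> (\<lambda>n. r (Suc n) / real (Suc n)) sums 0"
  proof (rule real_character_series_nonzero)
    show "r (m * n) = r m * r n" for m n
    proof -
      have "complex_of_real (r (m * n)) = of_real (r m * r n)"
        unfolding of_real_mult val(2)[symmetric] by (simp add: dirichlet_character_mult[OF chi(1)])
      then show ?thesis by (simp only: of_real_eq_iff)
    qed
    show "r 1 = 1" using dirichlet_character_one[OF chi(1)] by (simp add: r_def)
    show "r n \<in> {-1, 0, 1}" for n by (rule val(1))
    show "\<bar>\<Sum>k\<le>n. r (Suc k)\<bar> \<le> real q" for n
    proof -
      have "(\<Sum>k\<le>n. char_coeff chi k) = of_real (\<Sum>k\<le>n. r (Suc k))" unfolding val(2) of_real_sum ..
      then show ?thesis using norm_sum_char_coeff_le[OF chi, of n] by (simp only: norm_of_real)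
    qed
  qed
  moreover have "(\<lambda>n. char_coeff chi n / of_nat (Suc n) powr 1) sums 0"
    using sums_dirichlet_series[OF norm_sum_char_coeff_le[OF chi], of 1] zero by simp
  then have "(\<lambda>n. complex_of_real (r (Suc n) / real (Suc n))) sums of_real 0"
    unfolding val(2) by (simp del: of_nat_Suc)
  then have "(\<lambda>n. r (Suc n) / real (Suc n)) sums 0" by (simp only: sums_of_real_iff)
  ultimately show False by blast
qed

section \<open>The logarithmic derivative at 1\<close>

text \<open>The map w / (2A - w) sends the half plane Re w < A into the unit disk and fixes 0, so
  the Schwarz lemma bounds its composition with \<open>g\<close>; solving for \<open>g\<close> gives
  the estimate.\<close>

lemma Borel_Caratheodory:
  assumes g: "g holomorphic_on ball c R" "g c = 0" and Re_g: "\<And>z. z \<in> ball c R \<Longrightarrow> Re (g z) < A"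
    and r: "r < R" and z: "z \<in> cball c r"
  shows "norm (g z) \<le> 2 * A * r / (R - r)"
proof -
  have R: "R > 0" and r0: "r \<ge> 0" using z r by (auto intro: order_trans[OF zero_le_dist] le_less_trans)
  have A: "A > 0" using Re_g[of c] R g(2) by simp
  have in_ball: "c + of_real R * w \<in> ball c R" if "norm w < 1" for w
    using that R by (simp add: dist_norm norm_mult)
  define h where "h = (\<lambda>w. g (c + of_real R * w) / (2 * of_real A - g (c + of_real R * w)))"
  have less: "norm (g z) < norm (2 * of_real A - g z)" if "z \<in> ball c R" for z
  proof -
    have "(norm (2 * of_real A - g z))\<^sup>2 - (norm (g z))\<^sup>2 = 4 * A * (A - Re (g z))"
      unfolding cmod_power2 by (simp add: power2_eq_square algebra_simps)
    also have "\<dots> > 0" using A Re_g[OF that] by simp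
    finally show ?thesis by (simp add: power2_less_imp_less)
  qed
  have h_le: "norm (h w) \<le> norm w" if "norm w < 1" for w
  proof (rule Schwarz_Lemma(1))
    have nz: "2 * of_real A - g (c + of_real R * w) \<noteq> 0" if "w \<in> ball 0 1" for w
      using less[OF in_ball, of w] that by auto
    have "(\<lambda>w. g (c + of_real R * w)) holomorphic_on ball 0 1"
      by (rule holomorphic_on_compose_gen[OF _ g(1), of "\<lambda>w. c + of_real R * w", unfolded o_def])
        (use in_ball in \<open>auto intro!: holomorphic_intros\<close>)
    then show "h holomorphic_on ball 0 1"
      unfolding h_def using nz by (intro holomorphic_intros) auto
    show "h 0 = 0" by (simp add: h_def g(2))
    show "norm (h w) < 1" if "norm w < 1" for w
      using less[OF in_ball[OF that]] unfolding h_def norm_divide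
      by (subst divide_less_eq_1_pos) (auto intro: le_less_trans[OF norm_ge_zero])
  qed (rule that)
  define w where "w = (z - c) / of_real R"
  have zw: "z = c + of_real R * w" using R by (simp add: w_def)
  have w: "norm w \<le> r / R" using z R by (simp add: w_def norm_divide dist_norm norm_minus_commute divide_right_mono)
  also have "r / R < 1" using r R by simp
  finally have w1: "norm w < 1" .
  have zb: "z \<in> ball c R" unfolding zw by (rule in_ball[OF w1])
  have "norm (g z) = norm (h w) * norm (2 * of_real A - g z)"
    using less[OF zb] unfolding h_def zw norm_divide by auto
  also have "\<dots> \<le> (r / R) * (2 * A + norm (g z))"
  proof (intro mult_mono)
    show "norm (h w) \<le> r / R" using h_le[OF w1] w by linarith
    show "norm (2 * of_real A - g z) \<le> 2 * A + norm (g z)"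
      using norm_triangle_ineq4[of "2 * of_real A" "g z"] A by (simp add: norm_mult)
  qed (use r0 R in auto)
  finally have "norm (g z) * R \<le> r * (2 * A + norm (g z))" using R by (simp add: field_simps)
  then have "norm (g z) * (R - r) \<le> 2 * A * r" by (simp add: algebra_simps)
  then show ?thesis using r by (simp add: pos_le_divide_eq)
qed

section \<open>Taylor expansion of the logarithmic derivative at 2\<close>

lemma subpolynomial_ln_power_mult:
  assumes "subpolynomial c"
  shows "subpolynomial (\<lambda>n. of_real (ln (real (Suc n))) ^ j * c n)"
proof (induction j)
  case (Suc j)
  have "\<bar>ln (real (Suc n))\<bar> = ln (real (Suc n))" for n by simp
  then show ?case
    by (intro subpolynomial_ln_mult[OF Suc]) (simp add: norm_mult mult.assoc del: of_nat_Suc)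
qed (use assms in simp)

lemma higher_deriv_dirichlet_series:
  assumes "subpolynomial c" "Re s > 1"
  shows "(deriv ^^ j) (dirichlet_series c) s =
    (- 1) ^ j * dirichlet_series (\<lambda>n. of_real (ln (real (Suc n))) ^ j * c n) s"
proof -
  show ?thesis using assms(2)
  proof (induction j arbitrary: s)
    case (Suc j)
    define G where "G = (\<lambda>s. (- 1) ^ j * dirichlet_series (\<lambda>n. of_real (ln (real (Suc n))) ^ j * c n) s)"
    have "eventually (\<lambda>z. (deriv ^^ j) (dirichlet_series c) z = G z) (nhds s)"
      using eventually_nhds_in_open[OF open_halfspace_Re_gt[of 1], of s] Suc.prems
      by (auto elim!: eventually_mono simp: Suc.IH G_def)
    then have "(deriv ^^ Suc j) (dirichlet_series c) s = deriv G s" by (simp add: deriv_cong_ev)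
    also have "(G has_field_derivative (- 1) ^ j *
        (- dirichlet_series (\<lambda>n. of_real (ln (real (Suc n))) * (of_real (ln (real (Suc n))) ^ j * c n)) s)) (at s)"
      unfolding G_def by (rule DERIV_cmult[OF has_field_derivative_subpolynomial_series[OF subpolynomial_ln_power_mult[OF assms(1)] Suc.prems]])
    then have "deriv G s = (- 1) ^ j *
        (- dirichlet_series (\<lambda>n. of_real (ln (real (Suc n))) * (of_real (ln (real (Suc n))) ^ j * c n)) s)"
      by (rule DERIV_imp_deriv)
    also have "\<dots> = (- 1) ^ Suc j * dirichlet_series (\<lambda>n. of_real (ln (real (Suc n))) ^ Suc j * c n) s"
      by (simp add: mult.assoc del: of_nat_Suc)
    finally show ?case .
  qed simp
qed

text \<open>The probability that a Poisson variable of mean \<open>ln n\<close> is at most \<open>J\<close>.\<close>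
definition poisson_weight :: "nat \<Rightarrow> nat \<Rightarrow> real" where
  "poisson_weight J n = (\<Sum>j\<le>J. ln (real n) ^ j / fact j) / real n"

lemma char_series_nonzero_GRH:
  assumes GRH and chi: "dirichlet_character q chi" "chi \<noteq> principal_character q"
    and s: "Re s > 1 / 2" "Re s = 1 \<Longrightarrow> \<bar>Im s\<bar> \<le> 1"
  shows "char_series chi s \<noteq> 0"
proof -
  consider "Re s > 1" | "Re s = 1" | "Re s < 1" by linarith
  then show ?thesis
  proof cases
    case 1
    then show ?thesis by (rule char_series_nonzero[OF chi(1)])
  next
    case 2
    then have s_eq: "s = 1 + \<i> * of_real (Im s)" by (simp add: complex_eq_iff)
    show ?thesis
    proof (cases "(\<lambda>n. chi n * chi n) = principal_character q \<and> Im s = 0")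
      case True
      then have "s = 1" using 2 by (simp add: complex_eq_iff)
      then show ?thesis using char_series_nonzero_real[OF chi] True by simp
    next
      case False
      then have "char_series chi (1 + \<i> * of_real (Im s)) \<noteq> 0"
        by (intro char_series_nonzero_one_line[OF chi s(2)[OF 2]]) auto
      then show ?thesis using s_eq by simp
    qed
  next
    case 3
    show ?thesis
    proof
      assume "char_series chi s = 0"
      then have "Dirichlet_L chi s = 0" using Dirichlet_L_eq_series[OF chi, of s] s(1) by simp
      then have "Re s = 1 / 2" using \<open>GRH\<close> chi(1) s(1) 3 unfolding GRH_def by force
      then show False using s(1) by simp
    qed
  qed
qed

lemma log_derivative_one_approx:
  assumes GRH and chi: "dirichlet_character q chi" "chi \<noteq> principal_character q"
  shows "norm (deriv (Dirichlet_L chi) 1 / Dirichlet_L chi 1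
    + (\<Sum>n. mangoldt_coeff chi n / of_nat (Suc n) * of_real (poisson_weight J (Suc n))))
    \<le> 1440 * ln (37 * real q) * (8 / 9) ^ J"
proof -
  define F where "F = char_series chi"
  define M where "M = mangoldt_series chi"
  define A where "A = ln (37 * real q)"
  \<comment> \<open>Radius 11/8 keeps the disk in \<open>Re s > 5/8\<close> and, since
    \<open>(11/8)\<^sup>2 - 1 < 1\<close>, makes it meet the line \<open>Re s = 1\<close> only at
    heights below 1.\<close>
  define D where "D = ball (2::complex) (11 / 8)"
  have q: "real q \<ge> 1" using dirichlet_character_pos[OF chi(1)] by simp
  have D: "open D" "convex D" "1 \<in> D" "2 \<in> D" by (simp_all add: D_def dist_norm)
  have Re_D: "Re s > 5 / 8" "norm s \<le> 27 / 8" "Re s = 1 \<Longrightarrow> \<bar>Im s\<bar> \<le> 1" if "s \<in> D" for s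
  proof -
    have n: "norm (s - 2) < 11 / 8" using that by (simp add: D_def dist_norm norm_minus_commute)
    then show "Re s > 5 / 8" using abs_Re_le_cmod[of "s - 2"] by simp
    show "norm s \<le> 27 / 8" using n norm_triangle_ineq[of "s - 2" 2] by simp
    assume "Re s = 1"
    have "(norm (s - 2))\<^sup>2 < (11 / 8)\<^sup>2" using n by (intro power_strict_mono) auto
    then have "(Im s)\<^sup>2 < 1" using \<open>Re s = 1\<close> unfolding cmod_power2 by (simp add: power2_eq_square)
    then show "\<bar>Im s\<bar> \<le> 1" by (meson abs_square_le_1 less_imp_le)
  qed
  have F_hol: "F holomorphic_on {s. Re s > 0}"
    unfolding F_def by (rule holomorphic_dirichlet_series[OF norm_sum_char_coeff_le[OF chi]])
  have "D \<subseteq> {s. Re s > 0}" using Re_D(1) by force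
  then have F_D: "F holomorphic_on D" using F_hol by (rule holomorphic_on_subset[rotated])
  have F_nz: "F s \<noteq> 0" if "s \<in> D" for s
    unfolding F_def using Re_D[OF that] by (intro char_series_nonzero_GRH[OF \<open>GRH\<close> chi]) auto
  obtain g0 where g0: "g0 holomorphic_on D" "\<And>s. s \<in> D \<Longrightarrow> exp (g0 s) = F s"
    using holomorphic_logarithm_exists[OF D(2,1) F_D F_nz D(4)] by blast
  define g where "g = (\<lambda>s. g0 s - g0 2)"
  have g_hol: "g holomorphic_on D" unfolding g_def by (intro holomorphic_intros g0(1))
  \<comment> \<open>\<open>37 * q\<close> exceeds the quotient of the upper bound
    \<open>9 * q\<close> on the disk by the lower bound 1/4 at 2.\<close>
  have Re_g: "Re (g s) < A" if "s \<in> D" for s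
  proof -
    have "norm (F s) \<le> real q * norm s * (1 + 1 / Re s)"
      unfolding F_def using Re_D(1)[OF that]
      by (intro norm_dirichlet_series_le[OF norm_sum_char_coeff_le[OF chi]]) simp
    also have "\<dots> \<le> real q * (27 / 8) * (1 + 8 / 5)"
      using Re_D(1,2)[OF that] by (intro mult_mono add_mono) (auto simp: divide_simps)
    also have "\<dots> \<le> 9 * real q" by simp
    finally have "exp (Re (g0 s)) \<le> 9 * real q" using g0(2)[OF that] by (metis norm_exp_eq_Re)
    moreover have "exp (Re (g0 2)) \<ge> 1 / 4"
      using norm_char_series_ge[OF chi(1), of 2] g0(2)[OF D(4)] by (simp add: F_def flip: norm_exp_eq_Re)
    ultimately have "exp (Re (g0 s)) / exp (Re (g0 2)) \<le> 9 * real q / (1 / 4)" by (intro frac_le) auto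
    also have "\<dots> < 37 * real q" using q by simp
    finally have "exp (Re (g s)) < exp A" using q by (simp add: g_def A_def exp_diff)
    then show ?thesis by simp
  qed
  have g2: "g 2 = 0" by (simp add: g_def)
  have A: "A > 0" using Re_g[OF D(4)] g2 by simp
  \<comment> \<open>\<open>2 * A * (5/4) / (11/8 - 5/4) = 20 * A\<close>.\<close>
  have g_le: "norm (g s) \<le> 20 * A" if "s \<in> cball 2 (5 / 4)" for s
    using Borel_Caratheodory[of g 2 "11 / 8" A "5 / 4" s] g_hol g2 Re_g that by (simp add: D_def)
  define G where "G = deriv g"
  have G_hol: "G holomorphic_on D" unfolding G_def by (rule holomorphic_deriv[OF g_hol D(1)])
  \<comment> \<open>Cauchy's inequality on circles of radius 1/8, which reach from the disk of
    radius 9/8 to that of radius 5/4.\<close>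
  have G_le: "norm (G s) \<le> 160 * A" if s: "s \<in> cball 2 (9 / 8)" for s
  proof -
    have sub: "cball s (1 / 8) \<subseteq> cball 2 (5 / 4)" using s by (simp add: cball_subset_cball_iff dist_commute)
    also have "\<dots> \<subseteq> D" by (auto simp: D_def)
    finally have subD: "cball s (1 / 8) \<subseteq> D" .
    have "norm ((deriv ^^ 1) g s) \<le> fact 1 * (20 * A) / (1 / 8) ^ 1"
    proof (rule Cauchy_inequality)
      show "g holomorphic_on ball s (1 / 8)"
        using g_hol subD ball_subset_cball by (meson holomorphic_on_subset order_trans)
      show "continuous_on (cball s (1 / 8)) g"
        using g_hol subD by (meson holomorphic_on_imp_continuous_on continuous_on_subset)
      show "norm (g x) \<le> 20 * A" if "norm (s - x) = 1 / 8" for x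
      proof (rule g_le)
        have "x \<in> cball s (1 / 8)" using that by (simp add: dist_norm)
        then show "x \<in> cball 2 (5 / 4)" using sub by blast
      qed
    qed simp
    then show ?thesis by (simp add: G_def)
  qed
  \<comment> \<open>Taylor terms of \<open>G\<close> around 2, evaluated at 1; distance 1 against
    radius 9/8 gives the ratio 8/9.\<close>
  define t where "t = (\<lambda>n. (deriv ^^ n) G 2 / fact n * (1 - 2) ^ n)"
  have t_le: "norm (t n) \<le> 160 * A * (8 / 9) ^ n" for n
  proof -
    have subD: "cball 2 (9 / 8) \<subseteq> D" by (auto simp: D_def)
    have "norm ((deriv ^^ n) G 2) \<le> fact n * (160 * A) / (9 / 8) ^ n"
    proof (rule Cauchy_inequality)
      show "G holomorphic_on ball 2 (9 / 8)"
        using G_hol subD ball_subset_cball by (meson holomorphic_on_subset order_trans)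
      show "continuous_on (cball 2 (9 / 8)) G"
        using G_hol subD by (meson holomorphic_on_imp_continuous_on continuous_on_subset)
      show "norm (G x) \<le> 160 * A" if "norm (2 - x) = 9 / 8" for x
        using that by (intro G_le) (simp add: dist_norm)
    qed simp
    then show ?thesis by (simp add: t_def norm_mult norm_divide norm_power power_divide field_simps)
  qed
  have t_sums: "t sums G 1"
    unfolding t_def by (rule holomorphic_power_series[of G 2 "11 / 8"]) (use G_hol D in \<open>auto simp: D_def\<close>)
  \<comment> \<open>The geometric tail contributes the factor 9 that turns 160 into 1440.\<close>
  have tail: "norm (G 1 - (\<Sum>n\<le>J. t n)) \<le> 1440 * A * (8 / 9) ^ J"
  proof -
    have shifted: "(\<lambda>n. t (n + Suc J)) sums (G 1 - (\<Sum>n<Suc J. t n))"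
      by (rule sums_split_initial_segment[OF t_sums])
    have geo: "(\<lambda>n. 160 * A * (8 / 9) ^ Suc J * (8 / 9) ^ n) sums (160 * A * (8 / 9) ^ Suc J * (1 / (1 - 8 / 9)))"
      by (intro sums_mult geometric_sums) simp
    have "norm (\<Sum>n. t (n + Suc J)) \<le> (\<Sum>n. 160 * A * (8 / 9) ^ Suc J * (8 / 9) ^ n)"
      using t_le[of "_ + Suc J"] geo by (intro norm_suminf_le) (auto simp: power_add mult_ac sums_iff)
    then have "norm (G 1 - (\<Sum>n<Suc J. t n)) \<le> 160 * A * (8 / 9) ^ Suc J * (1 / (1 - 8 / 9))"
      using shifted geo by (simp only: sums_iff)
    also have "\<dots> \<le> 1440 * A * (8 / 9) ^ J" using A by simp
    finally show ?thesis by (simp only: lessThan_Suc_atMost)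
  qed
  have F_deriv: "deriv F s = F s * G s" if "s \<in> D" for s
  proof -
    have "(g has_field_derivative G s) (at s)"
      unfolding G_def by (rule holomorphic_derivI[OF g_hol D(1) that])
    then have "((\<lambda>s. exp (g s) * exp (g0 2)) has_field_derivative exp (g s) * exp (g0 2) * G s) (at s)"
      by (auto intro!: derivative_eq_intros)
    moreover have "exp (g z) * exp (g0 2) = F z" if "z \<in> D" for z
      using g0(2)[OF that] by (simp add: g_def flip: exp_add)
    ultimately have "(F has_field_derivative F s * G s) (at s)"
      using that D(1) by (metis (no_types, lifting) has_field_derivative_transform_within_open)
    then show ?thesis by (rule DERIV_imp_deriv)
  qed
  have G_eq: "G s = - M s" if "s \<in> D" "Re s > 1" for s
  proof -
    have "deriv F s = - F s * M s"
      unfolding F_def M_def by (rule DERIV_imp_deriv[OF has_field_derivative_char_series[OF chi(1) that(2)]])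
    then show ?thesis using F_deriv[OF that(1)] F_nz[OF that(1)] by (metis mult_minus_left mult_minus_right mult_left_cancel)
  qed
  have M_hol: "M holomorphic_on {s. Re s > 1}"
    unfolding M_def by (rule holomorphic_subpolynomial_series[OF subpolynomial_mangoldt_coeff[OF chi(1)]])
  define c where "c = (\<lambda>j n. of_real (ln (real (Suc n))) ^ j * mangoldt_coeff chi n)"
  \<comment> \<open>The sign \<open>(- 1) ^ j\<close> from differentiating the Dirichlet series
    cancels \<open>(1 - 2) ^ j\<close> from the Taylor step, so the partial sum over
    \<open>j\<close> becomes a truncated exponential series in the logarithm.\<close>
  have t_eq: "t j = - dirichlet_series (c j) 2 / fact j" for j
  proof -
    have "eventually (\<lambda>s. G s = - M s) (nhds 2)"
      using eventually_nhds_in_open[OF open_Int[OF D(1) open_halfspace_Re_gt[of 1]], of 2] D(4)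
      by (auto elim!: eventually_mono intro: G_eq)
    then have "(deriv ^^ j) G 2 = (deriv ^^ j) (\<lambda>s. - M s) 2" by (rule higher_deriv_cong_ev) simp
    also have "\<dots> = - (deriv ^^ j) M 2"
      by (rule higher_deriv_uminus[OF M_hol open_halfspace_Re_gt]) simp
    also have "(deriv ^^ j) M 2 = (- 1) ^ j * dirichlet_series (c j) 2"
      unfolding M_def c_def
      by (rule higher_deriv_dirichlet_series[OF subpolynomial_mangoldt_coeff[OF chi(1)]]) simp
    finally show ?thesis by (simp add: t_def mult_ac flip: power_mult_distrib)
  qed
  have sub_c: "subpolynomial (c j)" for j
    unfolding c_def by (rule subpolynomial_ln_power_mult[OF subpolynomial_mangoldt_coeff[OF chi(1)]])
  have "(\<lambda>n. c j n / of_nat (Suc n) powr 2) sums dirichlet_series (c j) 2" for j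
    by (rule subpolynomial_series_sums[OF sub_c]) simp
  then have "(\<lambda>n. \<Sum>j\<le>J. c j n / of_nat (Suc n) powr 2 / fact j) sums (\<Sum>j\<le>J. dirichlet_series (c j) 2 / fact j)"
    by (intro sums_sum sums_divide)
  moreover have "(\<Sum>j\<le>J. c j n / of_nat (Suc n) powr 2 / fact j) =
      mangoldt_coeff chi n / of_nat (Suc n) * of_real (poisson_weight J (Suc n))" for n
  proof -
    define N where "N = complex_of_nat (Suc n)"
    define l where "l = complex_of_real (ln (real (Suc n)))"
    define mc where "mc = mangoldt_coeff chi n"
    have N2: "N powr 2 = N * N"
      unfolding N_def using powr_nat'[of "complex_of_nat (Suc n)" 2] by (simp add: power2_eq_square del: of_nat_Suc)
    have w: "complex_of_real (poisson_weight J (Suc n)) = (\<Sum>j\<le>J. l ^ j / fact j) / N"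
      by (simp add: poisson_weight_def l_def N_def del: of_nat_Suc)
    have "l ^ j * mc / (N * N) / fact j = mc / N * (l ^ j / fact j / N)" for j
      by (simp add: divide_inverse mult_ac)
    then show ?thesis
      unfolding w c_def N_def[symmetric] l_def[symmetric] mc_def[symmetric] N2 sum_divide_distrib sum_distrib_left
      by (intro sum.cong refl)
  qed
  ultimately have "(\<lambda>n. mangoldt_coeff chi n / of_nat (Suc n) * of_real (poisson_weight J (Suc n))) sums
      (\<Sum>j\<le>J. dirichlet_series (c j) 2 / fact j)" by (simp only:)
  then have "(\<Sum>n. mangoldt_coeff chi n / of_nat (Suc n) * of_real (poisson_weight J (Suc n))) = - (\<Sum>j\<le>J. t j)"
    by (simp add: sums_iff t_eq sum_negf)
  moreover have "deriv (Dirichlet_L chi) 1 / Dirichlet_L chi 1 = G 1"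
  proof -
    have eq: "Dirichlet_L chi s = F s" if "Re s > 0" for s
      unfolding F_def by (rule Dirichlet_L_eq_series[OF chi that])
    have "eventually (\<lambda>s. Dirichlet_L chi s = F s) (nhds 1)"
      using eventually_nhds_in_open[OF open_halfspace_Re_gt[of 0], of 1]
      by (auto elim!: eventually_mono intro: eq)
    then have "deriv (Dirichlet_L chi) 1 = deriv F 1" by (rule deriv_cong_ev) simp
    then show ?thesis using F_deriv[OF D(3)] F_nz[OF D(3)] eq[of 1] by simp
  qed
  ultimately show ?thesis using tail by (simp add: A_def)
qed

section \<open>Weighted sums of the von Mangoldt function\<close>

lemma exp_series_sums: "(\<lambda>j. x ^ j / fact j) sums exp (x::real)"
  using exp_converges[of x] by (simp add: divide_inverse mult.commute)

lemma exp_partial_sum_le: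
  assumes "x \<ge> (0::real)"
  shows "(\<Sum>j\<le>J. x ^ j / fact j) \<le> exp x"
  using sum_le_suminf[OF sums_summable[OF exp_series_sums], of "{..J}" x] assms
    sums_unique[OF exp_series_sums[of x]] by simp

lemma ln_nat_nonneg: "ln (real n) \<ge> 0"
  by (cases "n = 0") auto

lemma poisson_weight_nonneg: "poisson_weight J n \<ge> 0"
  unfolding poisson_weight_def by (intro divide_nonneg_nonneg sum_nonneg) (auto simp: ln_nat_nonneg)

lemma poisson_weight_le_1: "poisson_weight J n \<le> 1"
proof (cases "n = 0")
  case False
  then have "(\<Sum>j\<le>J. ln (real n) ^ j / fact j) \<le> real n"
    using exp_partial_sum_le[OF ln_nat_nonneg[of n], of J] by simp
  then show ?thesis using False by (simp add: poisson_weight_def)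
qed (simp add: poisson_weight_def)

text \<open>Rankin's trick: for \<open>j > J\<close> the factor \<open>2 ^ j * (1/2) ^ J\<close> is
  at least 1, and inserting it bounds the tail of the exponential series by
  \<open>exp (2 * x) * (1/2) ^ J\<close> with \<open>x = ln n\<close>.\<close>

lemma one_minus_poisson_weight_le:
  assumes "n > 0"
  shows "1 - poisson_weight J n \<le> real n * (1 / 2) ^ J"
proof -
  define x where "x = ln (real n)"
  have x: "x \<ge> 0" "exp x = real n" using assms by (simp_all add: x_def)
  define f where "f = (\<lambda>j. x ^ j / fact j)"
  have s1: "(\<lambda>j. f j - (if j \<in> {..J} then f j else 0)) sums (exp x - (\<Sum>j\<le>J. f j))"
    unfolding f_def by (intro sums_diff exp_series_sums sums_If_finite_set) simp
  have s2: "(\<lambda>j. (2 * x) ^ j / fact j * (1 / 2) ^ J) sums (exp (2 * x) * (1 / 2) ^ J)"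
    by (intro sums_mult2 exp_series_sums)
  have le: "f j - (if j \<in> {..J} then f j else 0) \<le> (2 * x) ^ j / fact j * (1 / 2) ^ J" for j
  proof (cases "j \<le> J")
    case False
    have "(1::real) = 2 ^ j * (1 / 2) ^ j" by (simp flip: power_mult_distrib)
    also have "\<dots> \<le> 2 ^ j * (1 / 2) ^ J" using False by (intro mult_left_mono power_decreasing) auto
    finally have "x ^ j / fact j * 1 \<le> x ^ j / fact j * (2 ^ j * (1 / 2) ^ J)"
      using x(1) by (intro mult_left_mono) auto
    then show ?thesis using False by (simp add: f_def power_mult_distrib mult_ac)
  qed (use x(1) in simp)
  have "exp x - (\<Sum>j\<le>J. f j) \<le> exp (2 * x) * (1 / 2) ^ J" by (rule sums_le[OF le s1 s2])
  moreover have "exp (2 * x) = real n * real n" using x(2) by (simp add: exp_double power2_eq_square)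
  moreover have "1 - poisson_weight J n = (exp x - (\<Sum>j\<le>J. f j)) / real n"
    using assms x(2) by (simp add: poisson_weight_def f_def x_def diff_divide_distrib)
  ultimately have "1 - poisson_weight J n \<le> real n * real n * (1 / 2) ^ J / real n"
    by (simp only: divide_right_mono of_nat_0_le_iff)
  then show ?thesis using assms by simp
qed

text \<open>Rankin's trick in the other direction, with \<open>r = J / (J + 1)\<close>: for
  \<open>j \<le> J\<close> the cost \<open>inverse r ^ j\<close> is at most
  \<open>(1 + 1 / J) ^ J \<le> 3\<close>, and the remaining series is at most
  \<open>n powr r\<close>. This \<open>r\<close> gains \<open>1 / (J + 1)\<close> in the exponent at
  bounded cost.\<close>

lemma poisson_weight_decay:
  assumes J: "J \<ge> 1" and n: "n > 0"
  shows "poisson_weight J n \<le> 3 * real n powr - (1 / real (J + 1))"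
proof -
  define x where "x = ln (real n)"
  have x: "x \<ge> 0" using n by (simp add: x_def)
  define r where "r = real J / real (J + 1)"
  have r: "r > 0" "r \<le> 1" using J by (simp_all add: r_def)
  have inv_r: "inverse r ^ J \<le> 3"
  proof -
    have "inverse r = 1 + 1 / real J" using J by (simp add: r_def field_simps)
    also have "\<dots> \<le> exp (1 / real J)" by (rule exp_ge_add_one_self)
    finally have "inverse r ^ J \<le> exp (1 / real J) ^ J" using r by (intro power_mono) auto
    also have "\<dots> = exp 1" using J by (simp flip: exp_of_nat_mult)
    also have "\<dots> \<le> 3" by (rule exp_le)
    finally show ?thesis .
  qed
  have "(\<Sum>j\<le>J. x ^ j / fact j) \<le> (\<Sum>j\<le>J. inverse r ^ J * ((r * x) ^ j / fact j))"
  proof (rule sum_mono)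
    fix j assume "j \<in> {..J}"
    then have "inverse r ^ j \<le> inverse r ^ J" using r by (intro power_increasing) (auto simp: one_le_inverse)
    then have "inverse r ^ j * ((r * x) ^ j / fact j) \<le> inverse r ^ J * ((r * x) ^ j / fact j)"
      using r x by (intro mult_right_mono) auto
    moreover have "inverse r ^ j * (r * x) ^ j = x ^ j"
      unfolding power_mult_distrib[symmetric] using r by (simp flip: mult.assoc)
    ultimately show "x ^ j / fact j \<le> inverse r ^ J * ((r * x) ^ j / fact j)" by simp
  qed
  also have "\<dots> = inverse r ^ J * (\<Sum>j\<le>J. (r * x) ^ j / fact j)" by (simp only: sum_distrib_left)
  also have "\<dots> \<le> 3 * exp (r * x)"
    using inv_r r x by (intro mult_mono exp_partial_sum_le) (auto intro!: sum_nonneg)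
  also have "exp (r * x) = real n powr r" using n by (simp add: powr_def x_def)
  finally have "poisson_weight J n \<le> 3 * real n powr r / real n"
    unfolding poisson_weight_def x_def using n by (intro divide_right_mono) auto
  also have "\<dots> = 3 * (real n powr r * real n powr - 1)" using n by (simp add: powr_minus divide_inverse)
  also have "\<dots> = 3 * real n powr (r + - 1)" by (simp only: powr_add)
  also have "r + - 1 = - (1 / real (J + 1))" by (simp add: r_def field_simps)
  finally show ?thesis .
qed

section \<open>Weighted sums over residue classes\<close>

definition weighted_mangoldt :: "nat \<Rightarrow> nat \<Rightarrow> real" where
  "weighted_mangoldt J n = mangoldt n / real n * poisson_weight J n"

lemma weighted_mangoldt_nonneg: "weighted_mangoldt J n \<ge> 0"
  by (simp add: weighted_mangoldt_def mangoldt_nonneg poisson_weight_nonneg)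

lemma weighted_mangoldt_le: "weighted_mangoldt J n \<le> mangoldt n / real n"
  using mult_left_mono[OF poisson_weight_le_1, of "mangoldt n / real n" J n]
  by (simp add: weighted_mangoldt_def mangoldt_nonneg)

lemma weighted_mangoldt_error: "mangoldt n / real n - weighted_mangoldt J n \<le> mangoldt n * (1 / 2) ^ J"
proof (cases "n = 0")
  case False
  have "mangoldt n / real n - weighted_mangoldt J n = mangoldt n / real n * (1 - poisson_weight J n)"
    by (simp add: weighted_mangoldt_def right_diff_distrib)
  also have "\<dots> \<le> mangoldt n / real n * (real n * (1 / 2) ^ J)"
    using False by (intro mult_left_mono one_minus_poisson_weight_le) (auto simp: mangoldt_nonneg)
  also have "\<dots> = mangoldt n * (1 / 2) ^ J" using False by simp
  finally show ?thesis .
qed (simp add: weighted_mangoldt_def)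

text \<open>Half of the exponent \<open>1 / (J + 1)\<close> pays for the logarithm in the von
  Mangoldt function, at the price of a factor \<open>J + 1\<close>; the other half remains for
  convergence.\<close>

lemma weighted_mangoldt_decay:
  assumes J: "J \<ge> 1" and n: "n > 0"
  shows "weighted_mangoldt J n \<le> 6 * real (J + 1) * real n powr - (1 + 1 / (2 * real (J + 1)))"
proof -
  define e where "e = 1 / (2 * real (J + 1))"
  define x where "x = real n"
  have e: "e > 0" "1 / real (J + 1) = 2 * e" "2 * real (J + 1) = 1 / e" by (simp_all add: e_def field_simps)
  have x: "x \<ge> 1" using n by (simp add: x_def)
  have "mangoldt n \<le> ln x" using mangoldt_le[OF n] by (simp add: x_def)
  also have "\<dots> \<le> x powr e / e" using x e by (intro ln_powr_bound) auto
  finally have "mangoldt n / x \<le> (x powr e / e) / x" using x by (intro divide_right_mono) auto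
  moreover have "poisson_weight J n \<le> 3 * x powr - (2 * e)"
    using poisson_weight_decay[OF J n] by (simp only: e(2) x_def)
  ultimately have "weighted_mangoldt J n \<le> (x powr e / e) / x * (3 * x powr - (2 * e))"
    unfolding weighted_mangoldt_def x_def[symmetric]
    using x e(1) poisson_weight_nonneg[of J n] by (intro mult_mono) auto
  also have "\<dots> = 3 * (1 / e) * (x powr e * (x powr - 1 * x powr - (2 * e)))"
    using x by (simp add: powr_minus divide_inverse mult_ac)
  also have "x powr e * (x powr - 1 * x powr - (2 * e)) = x powr (e + (- 1 + - (2 * e)))"
    by (simp only: powr_add)
  also have "e + (- 1 + - (2 * e)) = - (1 + e)" by simp
  also have "3 * (1 / e) = 6 * real (J + 1)" by (simp add: e_def)
  finally show ?thesis by (simp only: x_def e_def)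
qed

lemma weighted_mangoldt_summable:
  assumes J: "J \<ge> 1"
  shows "weighted_mangoldt J summable_on A"
proof -
  have "summable (\<lambda>n. 6 * real (J + 1) * real (Suc n) powr - (1 + 1 / (2 * real (J + 1))))"
    by (intro summable_mult summable_Suc_powr) simp
  moreover have "norm (weighted_mangoldt J (Suc n)) \<le> 6 * real (J + 1) * real (Suc n) powr - (1 + 1 / (2 * real (J + 1)))" for n
    unfolding real_norm_def abs_of_nonneg[OF weighted_mangoldt_nonneg]
    by (rule weighted_mangoldt_decay[OF J zero_less_Suc])
  ultimately have "summable (\<lambda>n. weighted_mangoldt J (Suc n))" by (rule summable_comparison_test'[of _ 0])
  then have "summable (weighted_mangoldt J)" by (simp only: summable_Suc_iff)
  then have "weighted_mangoldt J summable_on UNIV"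
    by (subst summable_on_UNIV_nonneg_real_iff) (auto intro: weighted_mangoldt_nonneg)
  then show ?thesis by (rule summable_on_subset_banach) simp
qed

abbreviation weighted_sum :: "nat \<Rightarrow> nat set \<Rightarrow> real" where
  "weighted_sum J A \<equiv> infsum (weighted_mangoldt J) A"

lemma weighted_sum_nonneg: "weighted_sum J A \<ge> 0"
  by (rule infsum_nonneg) (rule weighted_mangoldt_nonneg)

lemma weighted_sum_insert:
  assumes "J \<ge> 1" "n \<notin> A"
  shows "weighted_sum J (insert n A) = weighted_mangoldt J n + weighted_sum J A"
  by (rule infsumI[OF has_sum_insert[OF assms(2) has_sum_infsum[OF weighted_mangoldt_summable[OF assms(1)]]]])

text \<open>Elements of one class have distinct quotients by \<open>q\<close>, so the decay estimate
  can be summed over the quotients. This sum is of order \<open>1 / e\<close>, which costs a second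
  factor \<open>J + 1\<close>.\<close>

lemma weighted_sum_residue_class_tail:
  assumes J: "J \<ge> 1" and q: "q > 0"
  shows "weighted_sum J {n. n > q \<and> [int n = x] (mod int q)} \<le> 18 * (real (J + 1))\<^sup>2 / real q"
proof (rule infsum_le_finite_sums[OF weighted_mangoldt_summable[OF J]])
  fix F assume F: "finite F" "F \<subseteq> {n. n > q \<and> [int n = x] (mod int q)}"
  define e where "e = 1 / (2 * real (J + 1))"
  have e: "e > 0" by (simp add: e_def)
  \<comment> \<open>The quotients are at least 1, and the sum over \<open>Suc k\<close> starts
    there.\<close>
  define k where "k = (\<lambda>n. n div q - 1)"
  have F_ge: "n \<ge> q" if "n \<in> F" for n using F(2) that by auto
  have div_pos: "n div q \<ge> 1" if "n \<in> F" for n using F_ge[OF that] q by (simp add: div_greater_zero_iff Suc_le_eq)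
  have inj: "inj_on k F"
  proof (rule inj_onI)
    fix m n assume mn: "m \<in> F" "n \<in> F" "k m = k n"
    then have "m div q = n div q" using div_pos[of m] div_pos[of n] by (simp add: k_def)
    moreover have "[int m = x] (mod int q)" "[int n = x] (mod int q)" using F(2) mn(1,2) by auto
    then have "[int m = int n] (mod int q)" using cong_trans cong_sym by blast
    then have "[m = n] (mod q)" by (simp only: cong_int_iff)
    then have "m mod q = n mod q" by (simp add: cong_def)
    ultimately show "m = n" by (metis div_mult_mod_eq)
  qed
  have le: "weighted_mangoldt J n \<le> 6 * real (J + 1) / real q * real (Suc (k n)) powr - (1 + e)" if n: "n \<in> F" for n
  proof -
    have n0: "n > 0" using F_ge[OF n] q by simp
    have ge: "real q * real (Suc (k n)) \<le> real n"
    proof -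
      have "q * (n div q) \<le> n" by simp
      then have "real (q * (n div q)) \<le> real n" by (simp only: of_nat_le_iff)
      then show ?thesis using div_pos[OF n] by (simp add: k_def)
    qed
    have "real n powr - (1 + e) \<le> (real q * real (Suc (k n))) powr - (1 + e)"
      using ge q e by (intro powr_mono2') auto
    also have "\<dots> = real q powr - (1 + e) * real (Suc (k n)) powr - (1 + e)" by (rule powr_mult)
    also have "\<dots> \<le> real q powr - 1 * real (Suc (k n)) powr - (1 + e)"
      using q e by (intro mult_right_mono powr_mono) auto
    also have "real q powr - 1 = 1 / real q" using q by (simp add: powr_minus divide_inverse)
    finally have "6 * real (J + 1) * real n powr - (1 + e) \<le> 6 * real (J + 1) * (1 / real q * real (Suc (k n)) powr - (1 + e))"
      by (intro mult_left_mono) auto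
    also have "\<dots> = 6 * real (J + 1) / real q * real (Suc (k n)) powr - (1 + e)" by simp
    finally show ?thesis using weighted_mangoldt_decay[OF J n0, folded e_def] by linarith
  qed
  obtain N where N: "k ` F \<subseteq> {..<N}" using finite_imageI[OF F(1), of k] finite_nat_iff_bounded by blast
  have "(\<Sum>n\<in>F. weighted_mangoldt J n) \<le> (\<Sum>n\<in>F. 6 * real (J + 1) / real q * real (Suc (k n)) powr - (1 + e))"
    by (intro sum_mono le)
  also have "\<dots> = 6 * real (J + 1) / real q * (\<Sum>i\<in>k ` F. real (Suc i) powr - (1 + e))"
    by (simp only: sum.reindex[OF inj] o_def sum_distrib_left)
  also have "\<dots> \<le> 6 * real (J + 1) / real q * (\<Sum>i<N. real (Suc i) powr - (1 + e))"
    using N by (intro mult_left_mono sum_mono2) auto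
  also have "\<dots> \<le> 6 * real (J + 1) / real q * (1 + 1 / e)"
    by (intro mult_left_mono sum_Suc_powr_le[OF e]) auto
  also have "\<dots> \<le> 6 * real (J + 1) / real q * (3 * real (J + 1))"
    by (intro mult_left_mono) (auto simp: e_def)
  also have "\<dots> = 18 * (real (J + 1))\<^sup>2 / real q" by (simp add: power2_eq_square algebra_simps)
  finally show "(\<Sum>n\<in>F. weighted_mangoldt J n) \<le> 18 * (real (J + 1))\<^sup>2 / real q" .
qed

text \<open>The class has a single element up to \<open>q\<close>, for which replacing the Poisson
  weight by 1 is cheap; all the others go into the tail.\<close>

lemma weighted_sum_residue_class:
  assumes J: "J \<ge> 1" and q: "q > 1" and x: "coprime x (int q)"
    and r: "1 \<le> r" "r \<le> q" "[int r = x] (mod int q)"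
  shows "\<bar>weighted_sum J {n. [int n = x] (mod int q)} - mangoldt r / real r\<bar>
    \<le> 18 * (real (J + 1))\<^sup>2 / real q + ln (real q) * (1 / 2) ^ J"
proof -
  define R where "R = {n. n > q \<and> [int n = x] (mod int q)}"
  have only: "n = r" if n: "[int n = x] (mod int q)" "n \<le> q" for n
  proof -
    have "n \<noteq> 0"
    proof
      assume "n = 0"
      then have "coprime 0 (int q)" using n(1) x by (metis cong_imp_coprime cong_sym of_nat_0)
      then show False using q by simp
    qed
    have "[int n = int r] (mod int q)" using n(1) r(3) by (meson cong_sym cong_trans)
    then have cong: "[n = r] (mod q)" by (simp only: cong_int_iff)
    show "n = r"
    \<comment> \<open>The modulus \<open>q\<close> reduces to 0 and so is not its own remainder;
      this boundary value is treated apart.\<close>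
    proof (cases "n = q \<or> r = q")
      case True
      then have "n mod q = 0 \<and> r mod q = 0" using cong by (auto simp: cong_def)
      then have "q dvd n" "q dvd r" by auto
      then have "q \<le> n" "q \<le> r" using \<open>n \<noteq> 0\<close> r(1) by (auto intro: dvd_imp_le)
      then show ?thesis using n(2) r(2) by simp
    next
      case False
      then show ?thesis using cong n(2) r(2) by (simp add: cong_def)
    qed
  qed
  have "n = r \<or> n > q" if "[int n = x] (mod int q)" for n using only[OF that] by (meson not_le)
  then have split: "{n. [int n = x] (mod int q)} = insert r R"
    using r(3) unfolding R_def by auto
  have "r \<notin> R" using r(2) by (simp add: R_def)
  then have "weighted_sum J {n. [int n = x] (mod int q)} = weighted_mangoldt J r + weighted_sum J R"
    unfolding split by (rule weighted_sum_insert[OF J])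
  moreover have "weighted_sum J R \<le> 18 * (real (J + 1))\<^sup>2 / real q"
    unfolding R_def using q by (intro weighted_sum_residue_class_tail[OF J]) simp
  moreover have "mangoldt r * (1 / 2) ^ J \<le> ln (real q) * (1 / 2) ^ J"
  proof (rule mult_right_mono)
    have "mangoldt r \<le> ln (real r)" using r(1) by (intro mangoldt_le) simp
    also have "\<dots> \<le> ln (real q)" using r by (intro ln_mono) auto
    finally show "mangoldt r \<le> ln (real q)" .
  qed simp
  ultimately show ?thesis
    using weighted_mangoldt_error[of r J] weighted_mangoldt_le[of J r] weighted_sum_nonneg[of J R] by linarith
qed

section \<open>Weighted sums over powers of one prime\<close>

lemma sum_half_powers_le: "(\<Sum>i<m. (1 / 2 :: real) ^ i) \<le> 2"
proof -
  have "(\<Sum>i<m. (1 / 2 :: real) ^ i) = 2 - 2 * (1 / 2) ^ m" by (induction m) auto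
  then show ?thesis by simp
qed

text \<open>The smallest exponent gives at most \<open>1 / Q\<close>, and each further one at least
  halves the term.\<close>

lemma sum_prime_power_reciprocals_le:
  assumes p: "p \<ge> 2" and K: "finite K" "\<And>k. k \<in> K \<Longrightarrow> Q \<le> p ^ k" and Q: "Q > (0::nat)"
  shows "(\<Sum>k\<in>K. 1 / real p ^ k) \<le> 2 / real Q"
proof (cases "K = {}")
  case False
  define k0 where "k0 = Min K"
  have k0: "k0 \<in> K" "\<And>k. k \<in> K \<Longrightarrow> k0 \<le> k" using K(1) False by (simp_all add: k0_def)
  have inj: "inj_on (\<lambda>k. k - k0) K" using k0(2) by (intro inj_onI) (metis le_add_diff_inverse)
  obtain m where m: "(\<lambda>k. k - k0) ` K \<subseteq> {..<m}"
    using finite_imageI[OF K(1)] finite_nat_iff_bounded by blast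
  have "(\<Sum>k\<in>K. 1 / real p ^ k) \<le> (\<Sum>k\<in>K. 1 / real Q * (1 / 2) ^ (k - k0))"
  proof (rule sum_mono)
    fix k assume k: "k \<in> K"
    have "1 / real p ^ k = 1 / real p ^ k0 * (1 / real p) ^ (k - k0)"
      using k0(2)[OF k] by (simp add: power_divide flip: power_add)
    also have "\<dots> \<le> 1 / real Q * (1 / 2) ^ (k - k0)"
    proof (intro mult_mono power_mono)
      have "real Q \<le> real (p ^ k0)" using K(2)[OF k0(1)] by (simp only: of_nat_le_iff)
      then show "1 / real p ^ k0 \<le> 1 / real Q" using Q p by (intro divide_left_mono) auto
      show "1 / real p \<le> 1 / 2" using p by (intro divide_left_mono) auto
    qed auto
    finally show "1 / real p ^ k \<le> 1 / real Q * (1 / 2) ^ (k - k0)" .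
  qed
  also have "\<dots> = 1 / real Q * (\<Sum>i\<in>(\<lambda>k. k - k0) ` K. (1 / 2) ^ i)"
    by (simp add: sum.reindex[OF inj] sum_distrib_left)
  also have "\<dots> \<le> 1 / real Q * (\<Sum>i<m. (1 / 2) ^ i)"
    using m by (intro mult_left_mono sum_mono2) auto
  also have "\<dots> \<le> 1 / real Q * 2" by (intro mult_left_mono sum_half_powers_le) auto
  finally show ?thesis by simp
qed simp

lemma weighted_sum_prime_powers_le:
  assumes J: "J \<ge> 1" and p: "prime p" and K: "\<And>k. k \<in> K \<Longrightarrow> k \<ge> 1 \<and> Q \<le> p ^ k" and Q: "Q > (0::nat)"
  shows "weighted_sum J ((\<lambda>k. p ^ k) ` K) \<le> 2 * ln (real p) / real Q"
proof (rule infsum_le_finite_sums[OF weighted_mangoldt_summable[OF J]])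
  fix F assume F: "finite F" "F \<subseteq> (\<lambda>k. p ^ k) ` K"
  then obtain K' where K': "K' \<subseteq> K" "finite K'" "F = (\<lambda>k. p ^ k) ` K'" using finite_subset_image by meson
  have p1: "p > 1" using prime_gt_1_nat[OF p] .
  have inj: "inj_on (\<lambda>k. p ^ k) K'" using p1 by (auto intro!: inj_onI simp: power_inject_exp)
  have "(\<Sum>n\<in>F. weighted_mangoldt J n) = (\<Sum>k\<in>K'. weighted_mangoldt J (p ^ k))"
    unfolding K'(3) by (simp add: sum.reindex[OF inj])
  also have "\<dots> \<le> (\<Sum>k\<in>K'. ln (real p) * (1 / real p ^ k))"
  proof (rule sum_mono)
    fix k assume "k \<in> K'"
    then have "k > 0" using K(1)[of k] K'(1) by auto
    then show "weighted_mangoldt J (p ^ k) \<le> ln (real p) * (1 / real p ^ k)"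
      using weighted_mangoldt_le[of J "p ^ k"] p by simp
  qed
  also have "\<dots> = ln (real p) * (\<Sum>k\<in>K'. 1 / real p ^ k)" by (simp only: sum_distrib_left)
  also have "\<dots> \<le> ln (real p) * (2 / real Q)"
    using p1 K K' Q by (intro mult_left_mono sum_prime_power_reciprocals_le) auto
  finally show "(\<Sum>n\<in>F. weighted_mangoldt J n) \<le> 2 * ln (real p) / real Q" by (simp add: mult.commute)
qed

lemma prime_power_cong_1_ge:
  assumes p: "p > 1" and k: "k > 0" and cong: "[int p ^ k = 1] (mod int Q)"
  shows "Q \<le> p ^ k"
proof -
  have "int Q dvd int p ^ k - 1" using cong by (simp add: cong_iff_dvd_diff)
  moreover have "int p ^ k > 1" using p k by (intro one_less_power) auto
  ultimately have "int Q \<le> int p ^ k - 1" by (intro zdvd_imp_le) auto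
  then have "int Q \<le> int (p ^ k)" by simp
  then show ?thesis by (simp only: of_nat_le_iff)
qed

definition prime_power_class :: "nat \<Rightarrow> nat \<Rightarrow> int \<Rightarrow> nat set" where
  "prime_power_class p Q x = (\<lambda>k. p ^ k) ` {k. k \<ge> 1 \<and> [int p ^ k = x] (mod int Q)}"

lemma weighted_sum_prime_power_class_1:
  assumes "J \<ge> 1" "prime p" "Q > 0"
  shows "weighted_sum J (prime_power_class p Q 1) \<le> 2 * ln (real p) / real Q"
  unfolding prime_power_class_def using assms prime_gt_1_nat[OF assms(2)]
  by (intro weighted_sum_prime_powers_le) (auto intro: prime_power_cong_1_ge)

text \<open>If \<open>e\<close> is the least exponent and \<open>k\<close> a later one, then
  \<open>p ^ (k - e)\<close> is congruent to 1, so \<open>p ^ k\<close> is at least \<open>Q\<close>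
  and all later powers are bounded by a geometric series. The value 0 for empty \<open>E\<close>
  matches the convention for an infinite index in \<open>h_term\<close>.\<close>

lemma weighted_sum_prime_power_class:
  fixes x :: int
  assumes J: "J \<ge> 1" and p: "prime p" "\<not> p dvd Q" and Q: "Q > 0"
  defines "E \<equiv> {e. e \<ge> 1 \<and> [int p ^ e = x] (mod int Q)}"
  shows "\<bar>weighted_sum J (prime_power_class p Q x) - (if E = {} then 0 else ln (real p) / real p ^ (LEAST e. e \<in> E))\<bar>
    \<le> 2 * ln (real p) / real Q + ln (real p) * (1 / 2) ^ J"
proof (cases "E = {}")
  case True
  have "ln (real p) \<ge> 0" using prime_ge_1_nat[OF p(1)] by simp
  then show ?thesis using True unfolding prime_power_class_def E_def[symmetric] by simp
next
  case False
  have p1: "p > 1" using prime_gt_1_nat[OF p(1)] .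
  define e where "e = (LEAST e. e \<in> E)"
  have e: "e \<in> E" "\<And>k. k \<in> E \<Longrightarrow> e \<le> k"
    unfolding e_def using False by (auto intro: LeastI_ex Least_le)
  define K where "K = E - {e}"
  have "E = insert e K" using e(1) by (auto simp: K_def)
  then have split: "prime_power_class p Q x = insert (p ^ e) ((\<lambda>k. p ^ k) ` K)"
    unfolding prime_power_class_def E_def[symmetric] by simp
  have notin: "p ^ e \<notin> (\<lambda>k. p ^ k) ` K" using p1 by (auto simp: K_def power_inject_exp)
  have "weighted_sum J (prime_power_class p Q x) = weighted_mangoldt J (p ^ e) + weighted_sum J ((\<lambda>k. p ^ k) ` K)"
    unfolding split by (rule weighted_sum_insert[OF J notin])
  moreover have "weighted_sum J ((\<lambda>k. p ^ k) ` K) \<le> 2 * ln (real p) / real Q"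
  proof (rule weighted_sum_prime_powers_le[OF J p(1) _ Q])
    fix k assume k: "k \<in> K"
    then have kE: "k \<in> E" "k > e" using e(2)[of k] by (auto simp: K_def)
    have cong: "[int p ^ e * int p ^ (k - e) = int p ^ e * 1] (mod int Q)"
    proof -
      have "int p ^ e * int p ^ (k - e) = int p ^ k" using kE(2) by (simp flip: power_add)
      moreover have "[int p ^ k = int p ^ e] (mod int Q)"
        using kE(1) e(1) by (auto simp: E_def intro: cong_trans cong_sym)
      ultimately show ?thesis by simp
    qed
    have "coprime (int p ^ e) (int Q)"
      using p by (metis coprime_int_iff coprime_power_left_iff of_nat_power prime_imp_coprime)
    then have "[int p ^ (k - e) = 1] (mod int Q)" using cong by (rule cong_mult_lcancel[THEN iffD1])
    then have "Q \<le> p ^ (k - e)" using p1 kE(2) by (intro prime_power_cong_1_ge) auto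
    also have "\<dots> \<le> p ^ k" using p1 by (intro power_increasing) auto
    finally show "k \<ge> 1 \<and> Q \<le> p ^ k" using kE by (auto simp: E_def)
  qed
  moreover have "mangoldt (p ^ e) = ln (real p)" using p(1) e(1) by (simp add: E_def)
  ultimately show ?thesis
    using weighted_mangoldt_error[of "p ^ e" J] weighted_mangoldt_le[of J "p ^ e"]
      weighted_sum_nonneg[of J "(\<lambda>k. p ^ k) ` K"] False by (simp add: e_def[symmetric])
qed

section \<open>The asymptotic formula\<close>

lemma has_sum_finite_sum:
  fixes f :: "'i \<Rightarrow> 'a \<Rightarrow> 'b::topological_comm_monoid_add"
  assumes "finite I" "\<And>i. i \<in> I \<Longrightarrow> (f i has_sum s i) A"
  shows "((\<lambda>x. \<Sum>i\<in>I. f i x) has_sum (\<Sum>i\<in>I. s i)) A"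
  using assms by (induction I rule: finite_induct) (auto intro!: has_sum_add)

lemma coprime_of_cong_mult:
  fixes x :: int
  assumes "[x * b = a] (mod m)" "coprime a m"
  shows "coprime x m"
  using assms by (metis cong_imp_coprime cong_sym coprime_mult_left_iff)

lemma mutual_quotients_inverse:
  fixes a b x y m :: int
  assumes "coprime a m" "coprime b m" "[x * b = a] (mod m)" "[y * a = b] (mod m)"
  shows "[x * y = 1] (mod m)"
proof -
  have "[(a * b) * (x * y) = (a * b) * 1] (mod m)"
    using cong_mult[OF assms(3,4)] by (simp add: mult_ac)
  moreover have "coprime (a * b) m" using assms by simp
  ultimately show ?thesis by (metis cong_mult_lcancel)
qed

text \<open>The squared norm equals \<open>2 - psi x - psi y\<close>. After multiplication by
  \<open>psi n\<close>, orthogonality detects \<open>n\<close> congruent to 1 or to an inverse of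
  \<open>x\<close> or \<open>y\<close>, and these two are inverse to each other. The modulus
  \<open>m\<close> is free because the lemma serves both \<open>q\<close> and its part prime to
  \<open>p\<close>.\<close>

lemma sum_character_difference:
  fixes a b n x y :: int
  assumes m: "m > 0" and cop: "coprime a (int m)" "coprime b (int m)" "coprime n (int m)"
    and x: "[x * b = a] (mod int m)" and y: "[y * a = b] (mod int m)"
  shows "(\<Sum>psi | dirichlet_character m psi. of_real ((norm (psi a - psi b))\<^sup>2) * psi n) =
    of_real (real (totient m) *
      (2 * of_bool [n = 1] (mod int m) - of_bool [n = x] (mod int m) - of_bool [n = y] (mod int m)))"
proof -
  define C where "C = {psi. dirichlet_character m psi}"
  have cx: "coprime x (int m)" and cy: "coprime y (int m)"
    using coprime_of_cong_mult[OF x cop(1)] coprime_of_cong_mult[OF y cop(2)] .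
  have xy: "[x * y = 1] (mod int m)" by (rule mutual_quotients_inverse[OF cop(1,2) x y])
  have n_x: "[x * n = 1] (mod int m) \<longleftrightarrow> [n = y] (mod int m)"
  proof -
    have "[x * n = 1] (mod int m) \<longleftrightarrow> [x * n = x * y] (mod int m)" using xy by (meson cong_sym cong_trans)
    also have "\<dots> \<longleftrightarrow> [n = y] (mod int m)" by (rule cong_mult_lcancel[OF cx])
    finally show ?thesis .
  qed
  have n_y: "[y * n = 1] (mod int m) \<longleftrightarrow> [n = x] (mod int m)"
  proof -
    have "[y * n = 1] (mod int m) \<longleftrightarrow> [y * n = y * x] (mod int m)" using xy by (metis cong_sym cong_trans mult.commute)
    also have "\<dots> \<longleftrightarrow> [n = x] (mod int m)" by (rule cong_mult_lcancel[OF cy])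
    finally show ?thesis .
  qed
  have term_eq: "of_real ((norm (psi a - psi b))\<^sup>2) * psi n = 2 * psi n - psi (x * n) - psi (y * n)" if "psi \<in> C" for psi
  proof -
    have psi: "dirichlet_character m psi" using that by (simp add: C_def)
    have one: "psi a * cnj (psi a) = 1" "psi b * cnj (psi b) = 1" using cnj_dirichlet_character[OF psi] cop by auto
    have a: "psi a = psi x * psi b" and b: "psi b = psi y * psi a"
      using dirichlet_character_cong[OF psi x] dirichlet_character_cong[OF psi y]
      by (simp_all add: dirichlet_character_mult[OF psi])
    have "psi a * cnj (psi b) = psi x * (psi b * cnj (psi b))" by (subst a) (simp add: mult_ac)
    then have ab: "psi a * cnj (psi b) = psi x" using one by simp
    have "psi b * cnj (psi a) = psi y * (psi a * cnj (psi a))" by (subst b) (simp add: mult_ac)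
    then have ba: "psi b * cnj (psi a) = psi y" using one by simp
    have "of_real ((norm (psi a - psi b))\<^sup>2) = (psi a - psi b) * cnj (psi a - psi b)" by (rule complex_norm_square)
    also have "\<dots> = psi a * cnj (psi a) + psi b * cnj (psi b) - psi a * cnj (psi b) - psi b * cnj (psi a)"
      by (simp add: algebra_simps)
    also have "\<dots> = 2 - psi x - psi y" by (simp add: one ab ba)
    finally show ?thesis by (simp add: left_diff_distrib dirichlet_character_mult[OF psi])
  qed
  have "(\<Sum>psi\<in>C. of_real ((norm (psi a - psi b))\<^sup>2) * psi n) =
      2 * (\<Sum>psi\<in>C. psi n) - (\<Sum>psi\<in>C. psi (x * n)) - (\<Sum>psi\<in>C. psi (y * n))"
    by (simp only: term_eq sum_subtractf sum_distrib_left cong: sum.cong)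
  also have "\<dots> = 2 * (if [n = 1] (mod int m) then of_nat (totient m) else 0)
      - (if [n = y] (mod int m) then of_nat (totient m) else 0)
      - (if [n = x] (mod int m) then of_nat (totient m) else 0)"
    unfolding C_def using cop(3) cx cy
    by (simp only: dirichlet_character_orthogonality[OF m] coprime_mult_left_iff n_x n_y simp_thms)
  also have "\<dots> = of_real (real (totient m) *
      (2 * of_bool [n = 1] (mod int m) - of_bool [n = x] (mod int m) - of_bool [n = y] (mod int m)))"
    by (simp add: of_bool_def algebra_simps)
  finally show ?thesis by (simp only: C_def)
qed

section \<open>Quotients, least residues and the terms h\<close>

lemma residue_quotient_cong:
  assumes "coprime b (int q)"
  shows "[residue_quotient q a b * b = a] (mod int q)"
  using cong_mult[OF cong_refl cong_modular_inverse2[OF assms], of a]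
  by (simp add: residue_quotient_def mult.assoc)

lemma least_positive_residue:
  assumes q: "q > 0"
  shows "1 \<le> least_positive_residue q x" "least_positive_residue q x \<le> q"
    "[int (least_positive_residue q x) = x] (mod int q)"
proof -
  define r where "r = (if x mod int q = 0 then q else nat (x mod int q))"
  have r: "r \<ge> 1 \<and> [int r = x] (mod int q)" "r \<le> q"
  proof -
    have b: "0 \<le> x mod int q" "x mod int q < int q" using q by simp_all
    have "r \<ge> 1 \<and> [int r = x] (mod int q) \<and> r \<le> q"
    proof (cases "x mod int q = 0")
      case True
      then show ?thesis using q by (simp add: r_def cong_def)
    next
      case False
      then have ir: "int r = x mod int q" using b(1) by (simp add: r_def)
      then have "int r > 0" "int r < int q" using b False by linarith+
      moreover have "[int r = x] (mod int q)" by (simp add: ir cong_def)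
      ultimately show ?thesis by simp
    qed
    then show "r \<ge> 1 \<and> [int r = x] (mod int q)" "r \<le> q" by auto
  qed
  from LeastI[of "\<lambda>r. r \<ge> 1 \<and> [int r = x] (mod int q)", OF r(1)]
  show "1 \<le> least_positive_residue q x" "[int (least_positive_residue q x) = x] (mod int q)"
    unfolding least_positive_residue_def by auto
  have "least_positive_residue q x \<le> r"
    unfolding least_positive_residue_def by (rule Least_le) (rule r(1))
  then show "least_positive_residue q x \<le> q" using r(2) by simp
qed

definition least_power_term :: "nat \<Rightarrow> nat \<Rightarrow> int \<Rightarrow> real" where
  "least_power_term p Q y = (let E = {e. e \<ge> 1 \<and> [int p ^ e = y] (mod int Q)}
     in if E = {} then 0 else ln (real p) / real p ^ (LEAST e. e \<in> E))"

lemma Inf_enat_image: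
  assumes "E \<noteq> {}"
  shows "Inf (enat ` E) = enat (LEAST e. e \<in> E)"
proof (rule antisym)
  have "(LEAST e. e \<in> E) \<in> E" using assms by (auto intro: LeastI_ex)
  then show "Inf (enat ` E) \<le> enat (LEAST e. e \<in> E)" by (intro Inf_lower) simp
  show "enat (LEAST e. e \<in> E) \<le> Inf (enat ` E)" by (rule Inf_greatest) (auto intro: Least_le)
qed

text \<open>The index is defined through the inverse of its argument, so the term at
  \<open>x\<close> is governed by the powers of \<open>p\<close> congruent to \<open>y\<close>. An
  inverse modulo \<open>q\<close> remains one modulo the divisor \<open>Q\<close>.\<close>

lemma h_term_eq:
  fixes x y :: int and p q :: nat
  assumes xy: "[x * y = 1] (mod int q)" and q: "q > 0"
  defines "Q \<equiv> q div p ^ multiplicity p q"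
  shows "h_term q p x = 1 / real (totient (p ^ multiplicity p q)) * least_power_term p Q y"
proof -
  have cx: "coprime x (int q)" using xy by (metis cong_imp_coprime cong_sym coprime_1_left coprime_mult_left_iff)
  have "[x * modular_inverse (int q) x = x * y] (mod int q)"
    using cong_modular_inverse1[OF cx] xy by (meson cong_sym cong_trans)
  then have inv: "[modular_inverse (int q) x = y] (mod int q)" using cx by (metis cong_mult_lcancel)
  have "q = Q * p ^ multiplicity p q" unfolding Q_def using multiplicity_dvd[of p q] by simp
  then have "int Q dvd int q" by (metis dvd_triv_left int_dvd_int_iff)
  with inv have inv': "[modular_inverse (int q) x = y] (mod int Q)" by (rule cong_dvd_modulus)
  define E where "E = {e. e \<ge> 1 \<and> [int p ^ e = y] (mod int Q)}"
  have "{e. e \<ge> 1 \<and> [int p ^ e = modular_inverse (int q) x] (mod int Q)} = E"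
    unfolding E_def using inv' by (meson cong_sym cong_trans)
  then have e_ind: "e_index q p x = Inf (enat ` E)" unfolding e_index_def Q_def[symmetric] by simp
  show ?thesis
  proof (cases "E = {}")
    case True
    then have "e_index q p x = \<infinity>" using e_ind by (simp add: Inf_enat_def)
    moreover have "least_power_term p Q y = 0"
      unfolding least_power_term_def E_def[symmetric] Let_def using True by simp
    ultimately show ?thesis by (simp add: h_term_def)
  next
    case False
    then have "e_index q p x = enat (LEAST e. e \<in> E)" using e_ind Inf_enat_image by simp
    then show ?thesis using False unfolding h_term_def least_power_term_def E_def[symmetric] Let_def by simp
  qed
qed

text \<open>The primes are among the divisors over which the von Mangoldt function sums to
  \<open>ln q\<close>.\<close>

lemma sum_ln_prime_divisors_le:
  assumes "q > (0::nat)"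
  shows "(\<Sum>p | prime p \<and> p dvd q. ln (real p)) \<le> ln (real q)"
proof -
  have "(\<Sum>p | prime p \<and> p dvd q. ln (real p)) = (\<Sum>p | prime p \<and> p dvd q. mangoldt p)"
    by (intro sum.cong) auto
  also have "\<dots> \<le> (\<Sum>d | d dvd q. mangoldt d)"
    using finite_divisors_nat[OF assms] by (intro sum_mono2) (auto simp: mangoldt_nonneg)
  also have "\<dots> = ln (real q)" using mangoldt_sum[of q, where 'a = real] assms by simp
  finally show ?thesis .
qed

lemma has_sum_weighted_character:
  fixes psi :: "int \<Rightarrow> complex"
  assumes J: "J \<ge> 1" and le: "\<And>n. norm (psi n) \<le> 1"
  shows "((\<lambda>n. psi (int n) * of_real (weighted_mangoldt J n)) has_sum
    (\<Sum>n. mangoldt_coeff psi n / of_nat (Suc n) * of_real (poisson_weight J (Suc n)))) UNIV"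
proof (rule norm_summable_imp_has_sum)
  define f where "f = (\<lambda>n. psi (int n) * of_real (weighted_mangoldt J n))"
  have "summable (weighted_mangoldt J)"
    by (rule summable_on_imp_summable[OF weighted_mangoldt_summable[OF J]])
  moreover have "norm (norm (f n)) \<le> weighted_mangoldt J n" for n
    using mult_right_mono[OF le[of "int n"] weighted_mangoldt_nonneg[of J n]] weighted_mangoldt_nonneg[of J n]
    by (simp add: f_def norm_mult)
  ultimately have summ: "summable (\<lambda>n. norm (f n))" by (rule summable_comparison_test'[of _ 0])
  then show "summable (\<lambda>n. norm (psi (int n) * of_real (weighted_mangoldt J n)))" by (simp only: f_def)
  \<comment> \<open>Division by 0 yields 0, so a sum over all naturals equals the one over positive
    integers.\<close>
  have f0: "f 0 = 0" by (simp add: f_def weighted_mangoldt_def)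
  have "f sums (\<Sum>n. f n)" by (rule summable_sums[OF summable_norm_cancel[OF summ]])
  then have "(\<lambda>n. f (Suc n)) sums (\<Sum>n. f n)" using sums_Suc_iff[of f "\<Sum>n. f n"] f0 by simp
  moreover have "f (Suc n) = mangoldt_coeff psi n / of_nat (Suc n) * of_real (poisson_weight J (Suc n))" for n
    by (simp add: f_def weighted_mangoldt_def del: of_nat_Suc)
  ultimately have "(\<Sum>n. f n) = (\<Sum>n. mangoldt_coeff psi n / of_nat (Suc n) * of_real (poisson_weight J (Suc n)))"
    by (simp only: sums_iff)
  with \<open>f sums (\<Sum>n. f n)\<close>
  show "(\<lambda>n. psi (int n) * of_real (weighted_mangoldt J n)) sums
    (\<Sum>n. mangoldt_coeff psi n / of_nat (Suc n) * of_real (poisson_weight J (Suc n)))" by (simp only: f_def)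
qed

lemma has_sum_weighted_indicator:
  assumes "J \<ge> 1"
  shows "((\<lambda>n. weighted_mangoldt J n * of_bool (n \<in> A)) has_sum weighted_sum J A) UNIV"
proof -
  have "((\<lambda>n. weighted_mangoldt J n * of_bool (n \<in> A)) has_sum weighted_sum J A) UNIV \<longleftrightarrow>
      (weighted_mangoldt J has_sum weighted_sum J A) A"
    by (rule has_sum_cong_neutral) auto
  then show ?thesis using has_sum_infsum[OF weighted_mangoldt_summable[OF assms]] by blast
qed

section \<open>Evaluation of the character sums\<close>

context
  fixes q :: nat and a b :: int
  assumes q: "q > 1" and cop: "coprime a (int q)" "coprime b (int q)"
begin

private definition x where "x = residue_quotient q a b"
private definition y where "y = residue_quotient q b a"
private definition P where "P = {p. prime p \<and> p dvd q}"
private definition Q where "Q = (\<lambda>p. q div p ^ multiplicity p q)"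
private definition residue_class where "residue_class = (\<lambda>z. {n. [int n = z] (mod int q)})"
private definition v where "v = (\<lambda>chi::int \<Rightarrow> complex. (norm (chi a - chi b))\<^sup>2)"

private lemma xb: "[x * b = a] (mod int q)" and ya: "[y * a = b] (mod int q)"
  unfolding x_def y_def by (rule residue_quotient_cong[OF cop(2)], rule residue_quotient_cong[OF cop(1)])

private lemma cop_xy: "coprime x (int q)" "coprime y (int q)"
  using coprime_of_cong_mult[OF xb cop(1)] coprime_of_cong_mult[OF ya cop(2)] .

private lemma xy: "[x * y = 1] (mod int q)"
  by (rule mutual_quotients_inverse[OF cop xb ya])

private lemma not_coprime_of_P:
  assumes p: "p \<in> P" "p dvd n"
  shows "\<not> coprime (int n) (int q)"
proof
  assume "coprime (int n) (int q)"
  then have "coprime n q" by simp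
  moreover have "p dvd q" "prime p" using p(1) by (simp_all add: P_def)
  ultimately show False using p(2) by (meson coprime_common_divisor not_prime_unit)
qed

private lemma finite_P: "finite P"
  unfolding P_def using finite_divisors_nat[of q] q by (auto intro: finite_subset[rotated])

text \<open>The last estimate rests on \<open>p ^ nu \<le> 2 * totient (p ^ nu)\<close>, where
  \<open>p = 2\<close> is extremal. It turns errors of size \<open>1 / Q p\<close>, once divided by
  \<open>totient (p ^ nu)\<close>, into errors of order \<open>1 / q\<close>.\<close>

private lemma Q:
  assumes "p \<in> P"
  shows "prime p" "q = p ^ multiplicity p q * Q p" "\<not> p dvd Q p" "Q p > 0" "multiplicity p q > 0"
    "totient q = totient (p ^ multiplicity p q) * totient (Q p)"
    "real q \<le> 2 * real (totient (p ^ multiplicity p q)) * real (Q p)"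
proof -
  show p: "prime p" using assms by (simp add: P_def)
  show eq: "q = p ^ multiplicity p q * Q p" unfolding Q_def using multiplicity_dvd[of p q] by simp
  show ndvd: "\<not> p dvd Q p"
    unfolding Q_def using multiplicity_decompose[of q p] q p not_prime_unit by auto
  show "Q p > 0" using eq q by (cases "Q p") auto
  show pos: "multiplicity p q > 0" using assms q p by (simp add: P_def prime_multiplicity_gt_zero_iff)
  have "coprime (p ^ multiplicity p q) (Q p)" using ndvd p by (simp add: prime_imp_coprime)
  then show "totient q = totient (p ^ multiplicity p q) * totient (Q p)"
    by (metis eq totient_mult_coprime)
  have "p ^ multiplicity p q = p ^ (multiplicity p q - 1) * p" using pos by (cases "multiplicity p q") auto
  also have "\<dots> \<le> p ^ (multiplicity p q - 1) * (2 * (p - 1))"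
    using prime_ge_2_nat[OF p] by (intro mult_left_mono) auto
  also have "\<dots> = 2 * totient (p ^ multiplicity p q)" using totient_prime_power[OF p pos] by simp
  finally have "p ^ multiplicity p q * Q p \<le> 2 * totient (p ^ multiplicity p q) * Q p"
    by (rule mult_right_mono) simp
  then have "real (p ^ multiplicity p q * Q p) \<le> real (2 * totient (p ^ multiplicity p q) * Q p)"
    by (simp only: of_nat_le_iff)
  then show "real q \<le> 2 * real (totient (p ^ multiplicity p q)) * real (Q p)"
    by (simp only: eq[symmetric] of_nat_mult of_nat_numeral)
qed

text \<open>The intended value of the character sum at prime powers. There at most one part is
  nonzero: the first if \<open>n\<close> is prime to \<open>q\<close>, otherwise the summand of the
  prime that divides both \<open>n\<close> and \<open>q\<close>.\<close>

private definition coefficient :: "nat \<Rightarrow> real" where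
  "coefficient n = real (totient q) *
      (2 * of_bool (n \<in> residue_class 1) - of_bool (n \<in> residue_class x) - of_bool (n \<in> residue_class y)) +
    (\<Sum>p\<in>P. real (totient (Q p)) *
      (2 * of_bool (n \<in> prime_power_class p (Q p) 1) - of_bool (n \<in> prime_power_class p (Q p) x)
        - of_bool (n \<in> prime_power_class p (Q p) y)))"

private lemma in_prime_power_class:
  assumes "n \<in> prime_power_class p m z" "prime p"
  obtains k where "k \<ge> 1" "n = p ^ k"
  using assms unfolding prime_power_class_def by auto

private lemma character_sum_coprime:
  assumes n: "coprime (int n) (int q)"
  shows "(\<Sum>chi | dirichlet_character q chi. of_real (v chi) * inducing_primitive q chi (int n)) = of_real (coefficient n)"
proof -
  have "n \<notin> prime_power_class p (Q p) z" if p: "p \<in> P" for p z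
  proof
    assume "n \<in> prime_power_class p (Q p) z"
    then obtain k where "k \<ge> 1" "n = p ^ k" using Q(1)[OF p] by (rule in_prime_power_class)
    then have "p dvd n" by (simp add: dvd_power)
    then show False using not_coprime_of_P[OF p] n by blast
  qed
  then have zero: "(\<Sum>p\<in>P. real (totient (Q p)) *
      (2 * of_bool (n \<in> prime_power_class p (Q p) 1) - of_bool (n \<in> prime_power_class p (Q p) x)
        - of_bool (n \<in> prime_power_class p (Q p) y))) = 0"
    by (intro sum.neutral) auto
  have "(\<Sum>chi | dirichlet_character q chi. of_real (v chi) * inducing_primitive q chi (int n)) =
      (\<Sum>chi | dirichlet_character q chi. of_real (v chi) * chi (int n))"
    using inducing_primitive_eq[OF _ n] by (intro sum.cong) auto
  also have "\<dots> = of_real (coefficient n)"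
    unfolding v_def coefficient_def zero residue_class_def mem_Collect_eq add_0_right
    using q by (intro sum_character_difference cop n xb ya) simp
  finally show ?thesis .
qed

private lemma character_sum_prime_power:
  assumes p: "p \<in> P" and k: "k \<ge> 1"
  shows "(\<Sum>chi | dirichlet_character q chi. of_real (v chi) * inducing_primitive q chi (int (p ^ k))) =
    of_real (coefficient (p ^ k))"
proof -
  note Qp = Q[OF p]
  define n where "n = p ^ k"
  have p_dvd: "p dvd n" using k by (simp add: n_def dvd_power)
  have not_cop: "\<not> coprime (int n) (int q)" by (rule not_coprime_of_P[OF p p_dvd])
  have "n \<notin> residue_class z" if "coprime z (int q)" for z
    using not_cop that unfolding residue_class_def by (metis cong_imp_coprime cong_sym mem_Collect_eq)
  then have no_class: "n \<notin> residue_class 1" "n \<notin> residue_class x" "n \<notin> residue_class y"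
    using cop_xy by simp_all
  have other: "n \<notin> prime_power_class r (Q r) z" if r: "r \<in> P" "r \<noteq> p" for r z
  proof
    assume "n \<in> prime_power_class r (Q r) z"
    then obtain j where "j \<ge> 1" "n = r ^ j" using Q(1)[OF r(1)] by (rule in_prime_power_class)
    then have "p dvd r ^ j" using p_dvd by simp
    then have "p dvd r" using Qp(1) prime_dvd_power by blast
    then show False using r Qp(1) Q(1)[OF r(1)] primes_dvd_imp_eq by blast
  qed
  have own: "n \<in> prime_power_class p (Q p) z \<longleftrightarrow> [int n = z] (mod int (Q p))" for z
  proof
    assume "n \<in> prime_power_class p (Q p) z"
    then show "[int n = z] (mod int (Q p))" unfolding prime_power_class_def by auto
  next
    assume "[int n = z] (mod int (Q p))"
    then show "n \<in> prime_power_class p (Q p) z"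
      unfolding prime_power_class_def n_def using k by auto
  qed
  have coeff: "coefficient n = real (totient (Q p)) *
      (2 * of_bool [int n = 1] (mod int (Q p)) - of_bool [int n = x] (mod int (Q p)) - of_bool [int n = y] (mod int (Q p)))"
  proof -
    have "(\<Sum>r\<in>P - {p}. real (totient (Q r)) *
        (2 * of_bool (n \<in> prime_power_class r (Q r) 1) - of_bool (n \<in> prime_power_class r (Q r) x)
          - of_bool (n \<in> prime_power_class r (Q r) y))) = 0"
      using other by (intro sum.neutral) auto
    then show ?thesis
      unfolding coefficient_def sum.remove[OF finite_P p] own using no_class by simp
  qed
  have dvd: "Q p dvd q" using Qp(2) by (metis dvd_triv_right)
  have cop_Q: "coprime a (int (Q p))" "coprime b (int (Q p))"
    using cop coprime_int_dvd[OF _ dvd] by auto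
  have cop_n: "coprime (int n) (int (Q p))"
    using Qp(1,3) by (metis coprime_int_iff coprime_power_left_iff n_def prime_imp_coprime)
  have cong_Q: "[x * b = a] (mod int (Q p))" "[y * a = b] (mod int (Q p))"
    using xb ya dvd by (meson cong_dvd_modulus int_dvd_int_iff)+
  have "(\<Sum>chi | dirichlet_character q chi. of_real (v chi) * inducing_primitive q chi (int (p ^ k))) =
      (\<Sum>psi | dirichlet_character (Q p) psi. of_real (v (extend_character q psi)) * psi (int p ^ k))"
    using sum_inducing_primitive_prime_power[OF Qp(2) _ Qp(1,3) k, of "\<lambda>chi. of_real (v chi)"] q by simp
  also have "\<dots> = (\<Sum>psi | dirichlet_character (Q p) psi. of_real ((norm (psi a - psi b))\<^sup>2) * psi (int n))"
    using cop by (simp add: v_def extend_character_def n_def)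
  also have "\<dots> = of_real (coefficient n)"
    unfolding coeff by (rule sum_character_difference[OF Qp(4) cop_Q cop_n cong_Q])
  finally show ?thesis by (simp only: n_def)
qed

text \<open>Where \<open>n\<close> shares a factor with \<open>q\<close> without being a prime
  power, \<open>coefficient n\<close> may differ from the character sum, but there the von Mangoldt
  function is 0.\<close>

private lemma weighted_character_sum:
  "of_real (weighted_mangoldt J n) * (\<Sum>chi | dirichlet_character q chi. of_real (v chi) * inducing_primitive q chi (int n))
    = complex_of_real (weighted_mangoldt J n * coefficient n)"
proof (cases "coprime (int n) (int q) \<or> \<not> primepow n")
  case True
  then show ?thesis
  proof
    assume "\<not> primepow n"
    then show ?thesis by (simp add: weighted_mangoldt_def mangoldt_def)
  qed (simp add: character_sum_coprime)
next
  case False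
  then obtain p k where p: "prime p" "k > 0" "n = p ^ k" unfolding primepow_def by auto
  then have "\<not> coprime p q" using False by auto
  then have "p \<in> P" using p(1) by (auto simp: P_def intro: prime_imp_coprime)
  then show ?thesis using character_sum_prime_power[of p k] p by (simp del: of_nat_power)
qed

private definition main_sum :: "nat \<Rightarrow> real" where
  "main_sum J = real (totient q) *
      (2 * weighted_sum J (residue_class 1) - weighted_sum J (residue_class x) - weighted_sum J (residue_class y)) +
    (\<Sum>p\<in>P. real (totient (Q p)) *
      (2 * weighted_sum J (prime_power_class p (Q p) 1) - weighted_sum J (prime_power_class p (Q p) x)
        - weighted_sum J (prime_power_class p (Q p) y)))"

private lemma has_sum_main_sum:
  assumes J: "J \<ge> 1"
  shows "((\<lambda>n. weighted_mangoldt J n * coefficient n) has_sum main_sum J) UNIV"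
proof -
  note ind = has_sum_weighted_indicator[OF J]
  have combine: "((\<lambda>n. c * (2 * (weighted_mangoldt J n * of_bool (n \<in> A)) + - (weighted_mangoldt J n * of_bool (n \<in> B))
      + - (weighted_mangoldt J n * of_bool (n \<in> D)))) has_sum
      (c * (2 * weighted_sum J A + - weighted_sum J B + - weighted_sum J D))) UNIV" for c :: real and A B D
    by (intro has_sum_cmult_right has_sum_add has_sum_uminusI ind)
  show ?thesis
    using has_sum_add[OF combine[of "real (totient q)" "residue_class 1" "residue_class x" "residue_class y"]
      has_sum_finite_sum[OF finite_P combine[of "real (totient (Q _))" "prime_power_class _ (Q _) 1"
        "prime_power_class _ (Q _) x" "prime_power_class _ (Q _) y"]]]
    unfolding main_sum_def coefficient_def distrib_left sum_distrib_left right_diff_distrib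
    by (simp add: mult_ac)
qed

private lemma v_le: "dirichlet_character q chi \<Longrightarrow> v chi \<le> 4"
proof -
  assume chi: "dirichlet_character q chi"
  have "norm (chi a - chi b) \<le> 1 + 1"
    using norm_triangle_ineq4[of "chi a" "chi b"] norm_dirichlet_character_le[OF chi, of a]
      norm_dirichlet_character_le[OF chi, of b] by linarith
  then have "(norm (chi a - chi b))\<^sup>2 \<le> 2\<^sup>2" by (intro power_mono) auto
  then show "v chi \<le> 4" by (simp add: v_def)
qed

text \<open>The principal character has \<open>v = 0\<close>, so adding it completes the character
  sums. Each of the at most \<open>totient q\<close> errors carries a factor
  \<open>v chi \<le> 4\<close> and is incurred at the modulus \<open>d \<le> q\<close> of the
  inducing character.\<close>

private lemma Mstar_approx:
  assumes GRH and J: "J \<ge> 1"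
  shows "norm (Mstar q a b + of_real (main_sum J)) \<le> real (totient q) * (4 * (1440 * ln (37 * real q) * (8 / 9) ^ J))"
proof -
  define C where "C = {chi. dirichlet_character q chi}"
  define C' where "C' = {chi. dirichlet_character q chi \<and> chi \<noteq> principal_character q}"
  define X where "X = (\<lambda>chi. \<Sum>n. mangoldt_coeff (inducing_primitive q chi) n / of_nat (Suc n) * of_real (poisson_weight J (Suc n)))"
  define L where "L = (\<lambda>chi. deriv (Dirichlet_L (inducing_primitive q chi)) 1 / Dirichlet_L (inducing_primitive q chi) 1)"
  have fin: "finite C" unfolding C_def by (rule finite_dirichlet_characters)
  have C': "C' = C - {principal_character q}" by (auto simp: C_def C'_def)
  have "((\<lambda>n. \<Sum>chi\<in>C. of_real (v chi) * (inducing_primitive q chi (int n) * of_real (weighted_mangoldt J n)))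
      has_sum (\<Sum>chi\<in>C. of_real (v chi) * X chi)) UNIV"
    unfolding X_def
    by (intro has_sum_finite_sum[OF fin] has_sum_cmult_right has_sum_weighted_character[OF J] norm_inducing_primitive_le)
      (simp add: C_def)
  moreover have "(\<Sum>chi\<in>C. of_real (v chi) * (inducing_primitive q chi (int n) * of_real (weighted_mangoldt J n)))
      = complex_of_real (weighted_mangoldt J n * coefficient n)" for n
    unfolding weighted_character_sum[symmetric] C_def by (simp add: sum_distrib_left mult_ac)
  ultimately have "((\<lambda>n. complex_of_real (weighted_mangoldt J n * coefficient n))
      has_sum (\<Sum>chi\<in>C. of_real (v chi) * X chi)) UNIV" by (simp only:)
  moreover have "((\<lambda>n. complex_of_real (weighted_mangoldt J n * coefficient n)) has_sum of_real (main_sum J)) UNIV"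
    by (rule has_sum_of_real[OF has_sum_main_sum[OF J]])
  ultimately have main: "(\<Sum>chi\<in>C. of_real (v chi) * X chi) = of_real (main_sum J)" by (rule has_sum_unique)
  have "v (principal_character q) = 0" using cop by (simp add: v_def principal_character_def)
  then have main': "(\<Sum>chi\<in>C'. of_real (v chi) * X chi) = of_real (main_sum J)"
    unfolding main[symmetric] C' using fin by (intro sum.mono_neutral_left) auto
  have "Mstar q a b + of_real (main_sum J) = (\<Sum>chi\<in>C'. of_real (v chi) * (L chi + X chi))"
    unfolding main'[symmetric] Mstar_def C'_def L_def v_def by (simp only: distrib_left sum.distrib)
  also have "norm \<dots> \<le> (\<Sum>chi\<in>C'. 4 * (1440 * ln (37 * real q) * (8 / 9) ^ J))"
  proof (rule sum_norm_le)
    fix chi assume "chi \<in> C'"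
    then have chi: "dirichlet_character q chi" "chi \<noteq> principal_character q" by (auto simp: C'_def)
    obtain d where d: "dirichlet_character d (inducing_primitive q chi)" "d dvd q"
      "inducing_primitive q chi \<noteq> principal_character d"
      using inducing_primitive_nonprincipal[OF chi] by blast
    have "d > 0" "d \<le> q" using dirichlet_character_pos[OF d(1)] d(2) q by (auto intro: dvd_imp_le)
    then have "1440 * ln (37 * real d) * (8 / 9) ^ J \<le> 1440 * ln (37 * real q) * (8 / 9) ^ J"
      by (intro mult_right_mono mult_left_mono ln_mono) auto
    with log_derivative_one_approx[OF \<open>GRH\<close> d(1,3), of J]
    have "norm (L chi + X chi) \<le> 1440 * ln (37 * real q) * (8 / 9) ^ J" unfolding L_def X_def by linarith
    then have "v chi * norm (L chi + X chi) \<le> 4 * (1440 * ln (37 * real q) * (8 / 9) ^ J)"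
      using v_le[OF chi(1)] by (intro mult_mono) auto
    moreover have "v chi \<ge> 0" by (simp add: v_def)
    ultimately show "norm (of_real (v chi) * (L chi + X chi)) \<le> 4 * (1440 * ln (37 * real q) * (8 / 9) ^ J)"
      by (simp add: norm_mult)
  qed
  also have "\<dots> = real (card C') * (4 * (1440 * ln (37 * real q) * (8 / 9) ^ J))" by simp
  also have "\<dots> \<le> real (totient q) * (4 * (1440 * ln (37 * real q) * (8 / 9) ^ J))"
  proof (rule mult_right_mono)
    have "card C' \<le> card C" unfolding C' by (rule card_Diff1_le)
    also have "card C = totient q" unfolding C_def using q by (intro card_dirichlet_characters) simp
    finally show "real (card C') \<le> real (totient q)" by simp
  qed (use q in simp)
  finally show ?thesis .
qed

section \<open>Collecting the error terms\<close>

private definition target :: real where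
  "target = mangoldt (least_positive_residue q x) / real (least_positive_residue q x)
    + mangoldt (least_positive_residue q y) / real (least_positive_residue q y) + H_sum q a b"

text \<open>The plus sign is due to \<open>main_sum\<close> approximating the negative of
  \<open>Mstar\<close>, since the von Mangoldt series is the negative of the logarithmic
  derivative.\<close>

private lemma main_sum_approx:
  assumes J: "J \<ge> 1"
  shows "\<bar>main_sum J + real (totient q) * target\<bar> \<le> real (totient q) *
    (72 * (real (J + 1))\<^sup>2 / real q + 4 * ln (real q) * (1 / 2) ^ J + ln (real q) * (16 / real q + 2 * (1 / 2) ^ J))"
proof -
  define phi where "phi = real (totient q)"
  have phi: "phi > 0" using q by (simp add: phi_def)
  define B where "B = 18 * (real (J + 1))\<^sup>2 / real q + ln (real q) * (1 / 2) ^ J"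
  define U where "U = (\<lambda>z. weighted_sum J (residue_class z))"
  define W where "W = (\<lambda>p z. weighted_sum J (prime_power_class p (Q p) z))"
  define m where "m = (\<lambda>p z. least_power_term p (Q p) z)"
  define rx where "rx = mangoldt (least_positive_residue q x) / real (least_positive_residue q x)"
  define ry where "ry = mangoldt (least_positive_residue q y) / real (least_positive_residue q y)"
  have U: "\<bar>U z - mangoldt r / real r\<bar> \<le> B"
    if "coprime z (int q)" "1 \<le> r" "r \<le> q" "[int r = z] (mod int q)" for z r
    unfolding U_def residue_class_def B_def using q by (intro weighted_sum_residue_class[OF J _ that])
  have q0: "q > 0" using q by simp
  have Ux: "\<bar>U x - rx\<bar> \<le> B" and Uy: "\<bar>U y - ry\<bar> \<le> B"
    unfolding rx_def ry_def by (intro U cop_xy least_positive_residue[OF q0])+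
  have U1: "\<bar>U 1\<bar> \<le> B" using U[of 1 1] q by simp
  \<comment> \<open>Twice the error of the class of 1 and once that of each of the other two
    classes.\<close>
  have first: "\<bar>phi * (2 * U 1 - U x - U y) + phi * (rx + ry)\<bar> \<le> phi * (4 * B)"
  proof -
    have "\<bar>2 * U 1 - U x - U y + (rx + ry)\<bar> \<le> 4 * B" using Ux Uy U1 by linarith
    then have "phi * \<bar>2 * U 1 - U x - U y + (rx + ry)\<bar> \<le> phi * (4 * B)" using phi by (intro mult_left_mono) auto
    then show ?thesis using phi by (simp add: abs_mult flip: distrib_left)
  qed
  have local: "\<bar>real (totient (Q p)) * (2 * W p 1 - W p x - W p y) + phi * (h_term q p x + h_term q p y)\<bar>
      \<le> phi * (ln (real p) * (16 / real q + 2 * (1 / 2) ^ J))" if p: "p \<in> P" for p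
  proof -
    note Qp = Q[OF p]
    define t where "t = real (totient (p ^ multiplicity p q))"
    have t1: "t \<ge> 1" using prime_gt_0_nat[OF Qp(1)] by (simp add: t_def Suc_le_eq)
    have "phi = t * real (totient (Q p))"
      using arg_cong[OF Qp(6), of real] by (simp only: phi_def t_def of_nat_mult)
    then have tq: "real (totient (Q p)) = phi / t" using t1 by simp
    have l0: "ln (real p) \<ge> 0" using prime_ge_1_nat[OF Qp(1)] by simp
    \<comment> \<open>The roles of \<open>x\<close> and \<open>y\<close> are exchanged here; only
      the sum of both terms enters.\<close>
    have h: "h_term q p x = m p y / t" "h_term q p y = m p x / t"
      using h_term_eq[OF xy q0, of p] h_term_eq[of y x q p] xy q0
      by (simp_all add: m_def t_def Q_def mult.commute)
    have Wz: "\<bar>W p z - m p z\<bar> \<le> 2 * ln (real p) / real (Q p) + ln (real p) * (1 / 2) ^ J" for z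
      unfolding W_def m_def least_power_term_def Let_def by (rule weighted_sum_prime_power_class[OF J Qp(1,3,4)])
    have W1: "W p 1 \<le> 2 * ln (real p) / real (Q p)" "W p 1 \<ge> 0"
      unfolding W_def by (rule weighted_sum_prime_power_class_1[OF J Qp(1,4)], rule weighted_sum_nonneg)
    have "\<bar>(2 * W p 1 - W p x - W p y) + (m p y + m p x)\<bar>
        \<le> 4 * (2 * ln (real p) / real (Q p)) + 2 * (ln (real p) * (1 / 2) ^ J)"
      using Wz[of x] Wz[of y] W1 by linarith
    also have "\<dots> = ln (real p) * (8 / real (Q p) + 2 * (1 / 2) ^ J)" by (simp add: algebra_simps)
    finally have "phi / t * \<bar>(2 * W p 1 - W p x - W p y) + (m p y + m p x)\<bar>
        \<le> phi / t * (ln (real p) * (8 / real (Q p) + 2 * (1 / 2) ^ J))"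
      using phi t1 by (intro mult_left_mono) auto
    also have "\<dots> = phi * (ln (real p) * (8 / (t * real (Q p)) + 2 * (1 / 2) ^ J / t))"
      using t1 by (simp add: field_simps)
    also have "\<dots> \<le> phi * (ln (real p) * (16 / real q + 2 * (1 / 2) ^ J))"
    proof (intro mult_left_mono add_mono)
      show "8 / (t * real (Q p)) \<le> 16 / real q"
        using Qp(4,7) t1 q by (simp add: t_def field_simps)
      show "2 * (1 / 2) ^ J / t \<le> 2 * (1 / 2) ^ J" using t1 by (simp add: divide_le_eq mult_left_le_imp_le)
    qed (use l0 phi in auto)
    finally have "phi / t * \<bar>(2 * W p 1 - W p x - W p y) + (m p y + m p x)\<bar>
        \<le> phi * (ln (real p) * (16 / real q + 2 * (1 / 2) ^ J))" .
    moreover have "real (totient (Q p)) * (2 * W p 1 - W p x - W p y) + phi * (h_term q p x + h_term q p y)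
        = phi / t * ((2 * W p 1 - W p x - W p y) + (m p y + m p x))"
      unfolding tq h by (simp add: distrib_left add_divide_distrib)
    moreover have "\<bar>phi / t * w\<bar> = phi / t * \<bar>w\<bar>" for w using phi t1 by (simp add: abs_mult)
    ultimately show ?thesis by (simp only:)
  qed
  have "main_sum J + phi * target = (phi * (2 * U 1 - U x - U y) + phi * (rx + ry))
      + (\<Sum>p\<in>P. real (totient (Q p)) * (2 * W p 1 - W p x - W p y) + phi * (h_term q p x + h_term q p y))"
    unfolding main_sum_def target_def H_sum_def x_def[symmetric] y_def[symmetric] P_def[symmetric]
      U_def W_def rx_def[symmetric] ry_def[symmetric] phi_def[symmetric]
    by (simp add: sum.distrib distrib_left sum_distrib_left)
  then have "\<bar>main_sum J + phi * target\<bar> \<le> \<bar>phi * (2 * U 1 - U x - U y) + phi * (rx + ry)\<bar>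
      + \<bar>\<Sum>p\<in>P. real (totient (Q p)) * (2 * W p 1 - W p x - W p y) + phi * (h_term q p x + h_term q p y)\<bar>"
    by (simp only: abs_triangle_ineq)
  also have "\<dots> \<le> phi * (4 * B) + (\<Sum>p\<in>P. phi * (ln (real p) * (16 / real q + 2 * (1 / 2) ^ J)))"
    by (intro add_mono first order_trans[OF sum_abs] sum_mono local)
  also have "(\<Sum>p\<in>P. phi * (ln (real p) * (16 / real q + 2 * (1 / 2) ^ J)))
      = phi * ((\<Sum>p\<in>P. ln (real p)) * (16 / real q + 2 * (1 / 2) ^ J))"
    by (simp only: sum_distrib_left sum_distrib_right)
  \<comment> \<open>Each local error carries \<open>ln p\<close>, and these add up to at most
    \<open>ln q\<close>, so the number of primes dividing \<open>q\<close> costs nothing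
    further.\<close>
  also have "\<dots> \<le> phi * (ln (real q) * (16 / real q + 2 * (1 / 2) ^ J))"
    using sum_ln_prime_divisors_le[OF q0] phi unfolding P_def by (intro mult_left_mono mult_right_mono) auto
  finally show ?thesis by (simp add: B_def phi_def algebra_simps)
qed

lemma Mstar_asymptotics:
  assumes GRH and q3: "q \<ge> 3"
  shows "norm (Mstar q a b - complex_of_real (real (totient q) *
      (mangoldt (least_positive_residue q (residue_quotient q a b)) / real (least_positive_residue q (residue_quotient q a b))
      + mangoldt (least_positive_residue q (residue_quotient q b a)) / real (least_positive_residue q (residue_quotient q b a))
      + H_sum q a b)))
    \<le> real (totient q) * (40000 * (ln (real q))\<^sup>2 / real q)"
proof -
  define l where "l = ln (real q)"
  define J where "J = nat \<lceil>9 * l\<rceil>"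
  have "exp 1 \<le> real q" using q3 exp_le by linarith
  then have l1: "l \<ge> 1" unfolding l_def using q by (subst ln_ge_iff) auto
  have J_ge: "9 * l \<le> real J" unfolding J_def by linarith
  \<comment> \<open>\<open>J + 1 \<le> 9 * l + 2 \<le> 11 * l\<close>, as
    \<open>l \<ge> 1\<close>.\<close>
  have J_le: "real (J + 1) \<le> 11 * l" unfolding J_def using l1 by linarith
  have J: "J \<ge> 1" using J_ge l1 by linarith
  have inv_q: "(8 / 9 :: real) ^ J \<le> 1 / real q"
  proof -
    have "(8 / 9 :: real) \<le> exp (- 1 / 9)" using exp_ge_add_one_self[of "- 1 / 9 :: real"] by simp
    then have "(8 / 9 :: real) ^ J \<le> exp (- 1 / 9) ^ J" by (intro power_mono) auto
    also have "\<dots> = exp (real J * (- 1 / 9))" by (simp only: exp_of_nat_mult)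
    also have "\<dots> \<le> exp (- l)" using J_ge by simp
    also have "\<dots> = 1 / real q" using q by (simp add: l_def exp_minus divide_inverse)
    finally show ?thesis .
  qed
  have half: "(1 / 2 :: real) ^ J \<le> 1 / real q"
    using power_mono[of "1 / 2 :: real" "8 / 9" J] inv_q by linarith
  have ln37: "ln (37 * real q) \<le> 5 * l"
  proof -
    have "ln (37 * real q) \<le> ln (real q ^ 5)"
    proof (rule ln_mono)
      have "(3::real) ^ 4 \<le> real q ^ 4" using q3 by (intro power_mono) auto
      then have "37 \<le> real q ^ 4" by simp
      then have "37 * real q \<le> real q ^ 4 * real q" by (intro mult_right_mono) auto
      then show "37 * real q \<le> real q ^ 5" using power_add[of "real q" 4 1] by simp
    qed (use q in auto)
    also have "\<dots> = 5 * l" using q by (simp add: l_def ln_realpow)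
    finally show ?thesis .
  qed
  have ll: "l \<le> l\<^sup>2" using l1 by (simp add: power2_eq_square)
  define phi where "phi = real (totient q)"
  define iq where "iq = 1 / real q"
  have phi: "phi \<ge> 0" and iq: "iq \<ge> 0" by (simp_all add: phi_def iq_def)
  have "norm (Mstar q a b - of_real (phi * target)) =
      norm ((Mstar q a b + of_real (main_sum J)) - of_real (main_sum J + phi * target))" by simp
  also have "\<dots> \<le> norm (Mstar q a b + of_real (main_sum J)) + \<bar>main_sum J + phi * target\<bar>"
    using norm_triangle_ineq4[of "Mstar q a b + of_real (main_sum J)" "of_real (main_sum J + phi * target)"]
    by (simp only: norm_of_real)
  also have "\<dots> \<le> phi * (4 * (1440 * ln (37 * real q) * (8 / 9) ^ J)) + phi *
      (72 * (real (J + 1))\<^sup>2 / real q + 4 * l * (1 / 2) ^ J + l * (16 / real q + 2 * (1 / 2) ^ J))"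
    unfolding phi_def l_def by (intro add_mono Mstar_approx[OF \<open>GRH\<close> J] main_sum_approx[OF J])
  \<comment> \<open>28800 is 4 * 1440 * 5, from the Taylor remainders; 8734 is 72 * 121 + 6 + 16,
    from the residue classes and prime powers.\<close>
  also have "\<dots> \<le> phi * (28800 * (l\<^sup>2 * iq)) + phi * (8734 * (l\<^sup>2 * iq))"
  proof (intro add_mono mult_left_mono phi)
    have liq: "l * iq \<le> l\<^sup>2 * iq" using ll iq by (intro mult_right_mono)
    have "ln (37 * real q) * (8 / 9) ^ J \<le> 5 * l * iq"
      using ln37 inv_q l1 by (intro mult_mono) (auto simp: iq_def)
    then show "4 * (1440 * ln (37 * real q) * (8 / 9) ^ J) \<le> 28800 * (l\<^sup>2 * iq)" using liq by linarith
    have "(real (J + 1))\<^sup>2 \<le> (11 * l)\<^sup>2" using J_le by (intro power_mono) auto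
    then have "(real (J + 1))\<^sup>2 * iq \<le> (11 * l)\<^sup>2 * iq" using iq by (intro mult_right_mono)
    then have 1: "72 * (real (J + 1))\<^sup>2 / real q \<le> 8712 * (l\<^sup>2 * iq)"
      by (simp add: iq_def power_mult_distrib)
    have 2: "l * (1 / 2) ^ J \<le> l * iq" using half l1 by (intro mult_left_mono) (auto simp: iq_def)
    have "4 * l * (1 / 2) ^ J + l * (16 / real q + 2 * (1 / 2) ^ J) = 6 * (l * (1 / 2) ^ J) + 16 * (l * iq)"
      by (simp add: iq_def algebra_simps)
    then show "72 * (real (J + 1))\<^sup>2 / real q + 4 * l * (1 / 2) ^ J + l * (16 / real q + 2 * (1 / 2) ^ J)
        \<le> 8734 * (l\<^sup>2 * iq)" using 1 2 liq by linarith
  qed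
  also have "\<dots> = phi * (37534 * (l\<^sup>2 * iq))" by (simp add: algebra_simps)
  also have "\<dots> \<le> phi * (40000 * l\<^sup>2 / real q)"
    using phi iq by (intro mult_left_mono) (auto simp: iq_def divide_right_mono)
  finally show ?thesis unfolding target_def x_def y_def phi_def l_def .
qed

end

theorem theorem1p7:
  assumes GRH
  shows "\<exists>C::real. \<forall>(q::nat) (a::int) (b::int).
    q > 0 \<longrightarrow> coprime a (int q) \<longrightarrow> coprime b (int q) \<longrightarrow> \<not> [a = b] (mod int q) \<longrightarrow>
    (let r1 = least_positive_residue q (residue_quotient q a b);
         r2 = least_positive_residue q (residue_quotient q b a)
     in cmod (Mstar q a b -
          complex_of_real (real (totient q) *
            (mangoldt r1 / real r1 + mangoldt r2 / real r2 + H_sum q a b)))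
        \<le> real (totient q) * (C * (ln (real q))\<^sup>2 / real q))"
proof (intro exI[of _ 40000] allI impI)
  fix q :: nat and a b :: int
  assume q: "q > 0" and cop: "coprime a (int q)" "coprime b (int q)" and ne: "\<not> [a = b] (mod int q)"
  \<comment> \<open>Distinct reduced residues exist only from \<open>q = 3\<close> on, which makes
    \<open>ln q \<ge> 1\<close> and lets \<open>ln q\<close> be absorbed into its square.\<close>
  have "q \<noteq> 1" using ne by auto
  moreover have "q \<noteq> 2" using ne cop by (auto simp: coprime_right_2_iff_odd cong_def odd_iff_mod_2_eq_one)
  ultimately have "q \<ge> 3" using q by linarith
  then show "let r1 = least_positive_residue q (residue_quotient q a b);
         r2 = least_positive_residue q (residue_quotient q b a)
     in cmod (Mstar q a b -
          complex_of_real (real (totient q) *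
            (mangoldt r1 / real r1 + mangoldt r2 / real r2 + H_sum q a b)))
        \<le> real (totient q) * (40000 * (ln (real q))\<^sup>2 / real q)"
    unfolding Let_def using cop by (intro Mstar_asymptotics assms) auto
qed

end
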